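(* Consider the finite-server system under GRAND-F and suppose that there exists $\boldsymbol{x}\in\mathcal{X}^{\diamond}$ such that $x_{\boldsymbol{0}^s}>0$ for all $s\in\mathcal{S}$. Then there exists $\epsilon>0$ such that, uniformly over all fluid sample paths (FSPs) with initial states $\boldsymbol{x}(0)\in\mathcal{X}^{\Box}\cap\{\|\boldsymbol{x}-\boldsymbol{x}^{*,\Box}\|\le\epsilon\}$, $$\boldsymbol{x}(t)\to\boldsymbol{x}^{*,\Box},\qquad t\to\infty.$$
   Context: **Configurations.** There are customer types $i\in\mathcal{I}=\{1,\dots,I\}$ and server types $s\in\mathcal{S}=\{1,\dots,S\}$. For each $s$ there is a finite set $\bar{\mathcal{K}}^s$ of allowed type-$s$ server configurations $\boldsymbol{k}=(k_1,\dots,k_I;s)$ with non-negative integers $k_i$ (a type-$s$ server may simultaneously serve $k_i$ customers of each type $i$). Monotonicity: if $\boldsymbol{k}\in\bar{\mathcal{K}}^s$ and $0\le k_i'\le k_i$ for all $i$, then $(k_1',\dots,k_I';s)\in\bar{\mathcal{K}}^s$. The zero configuration $\boldsymbol{0}^s=(0,\dots,0;s)$ belongs to $\bar{\mathcal{K}}^s$ for each $s$. For each $i$ there is at least one $s$ with $(\boldsymbol{e}_i;s)\in\bar{\mathcal{K}}^s$, where $\boldsymbol{e}_i$ is the $i$-th unit vector. Put $\mathcal{K}^s=\bar{\mathcal{K}}^s\setminus\{\boldsymbol{0}^s\}$, $\bar{\mathcal{K}}=\bigcup_s\bar{\mathcal{K}}^s$, $\mathcal{K}=\bigcup_s\mathcal{K}^s$.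 For $\boldsymbol{k}\in\bar{\mathcal{K}}$, $\boldsymbol{k}\pm\boldsymbol{e}_i$ denotes $\boldsymbol{k}$ with $k_i$ replaced by $k_i\pm1$ (same server type). $\mathcal{M}$ is the set of pairs $(\boldsymbol{k},i)$ with $\boldsymbol{k}\in\mathcal{K}$, $\boldsymbol{k}-\boldsymbol{e}_i\in\bar{\mathcal{K}}$; each is identified with the edge $(\boldsymbol{k}-\boldsymbol{e}_i,\boldsymbol{k})$. An arrival (departure) along $(\boldsymbol{k},i)$ is the placement of a type-$i$ customer into a server in configuration $\boldsymbol{k}-\boldsymbol{e}_i$, making it $\boldsymbol{k}$ (respectively, the departure of a type-$i$ customer from a server in configuration $\boldsymbol{k}$, making it $\boldsymbol{k}-\boldsymbol{e}_i$). **Finite-server system and GRAND-F, indexed by $r$.** The scaling parameter $r\ge1$ goes to infinity along a discrete sequence. There are $H_s=h_sr$ servers of type $s$ (integers), $h_s>0$ fixed. Type-$i$ customers arrive as independent Poisson processes of rate $\lambda_ir$, with independent exponential service times of mean $1/\mu_i$ ($\lambda_i,\mu_i>0$ fixed), unaffected by simultaneous service. $\rho_i=\lambda_i/\mu_i$, normalized so that $\sum_i\rho_i=1$. $X^r_{\boldsymbol{k}}(t)$ is the number of servers in configuration $\boldsymbol{k}\in\bar{\mathcal{K}}$; $\sum_{\boldsymbol{k}\in\bar{\mathcal{K}}^s}X^r_{\boldsymbol{k}}(t)=H_s$. The state is $\boldsymbol{X}^r(t)=\{X^r_{\boldsymbol{k}}(t),\boldsymbol{k}\in\mathcal{K}\}$.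 Under GRAND-F an arriving type-$i$ customer is placed into a server chosen uniformly at random among all $X^r_{(i)}(t)=\sum_{\boldsymbol{k}\in\bar{\mathcal{K}}:\,\boldsymbol{k}+\boldsymbol{e}_i\in\mathcal{K}}X^r_{\boldsymbol{k}}(t)$ servers where it can fit; if $X^r_{(i)}(t)=0$, it is blocked (leaves immediately). **Driving processes.** The processes for all $r$ are constructed from common primitives: independent unit-rate Poisson processes $\Pi_{\boldsymbol{k}i}$, $(\boldsymbol{k},i)\in\mathcal{M}$, and $\Pi_i$, $i\in\mathcal{I}$, and independent i.i.d. sequences $\xi_i(1),\xi_i(2),\dots$, uniform on $[0,1]$. The number of departures along $(\boldsymbol{k},i)$ in $[0,t]$ is $D^r_{\boldsymbol{k}i}(t)=\Pi_{\boldsymbol{k}i}\big(\int_0^tX^r_{\boldsymbol{k}}(u)k_i\mu_i\,du\big)$; the number of type-$i$ arrivals in $[0,t]$ is $A^r_i(t)=\Pi_i(\lambda_irt)$. The configurations that can fit an additional type-$i$ customer are listed in an arbitrary fixed order; the $m$-th type-$i$ arrival, if $X^r_{(i)}\ge1$, is assigned to a server in the $j$-th configuration in the list, where the $j$-th configuration corresponds to the $j$-th consecutive subinterval of $[0,1]$ containing $\xi_i(m)$ in the partition into intervals of lengths $X^r_{\boldsymbol{k}}/X^r_{(i)}$. $A^r_{\boldsymbol{k}i}(t)$ is the number of arrivals placed along $(\boldsymbol{k},i)$ in $[0,t]$. Fluid scaling: $x^r_{\boldsymbol{k}}=X^r_{\boldsymbol{k}}/r$, $d^r_{\boldsymbol{k}i}=D^r_{\boldsymbol{k}i}/r$,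 $a^r_{\boldsymbol{k}i}=A^r_{\boldsymbol{k}i}/r$. **FSP.** A set of locally Lipschitz continuous functions $[\{x_{\boldsymbol{k}}(\cdot)\}_{\boldsymbol{k}\in\mathcal{K}},\{d_{\boldsymbol{k}i}(\cdot)\}_{(\boldsymbol{k},i)\in\mathcal{M}},\{a_{\boldsymbol{k}i}(\cdot)\}_{(\boldsymbol{k},i)\in\mathcal{M}}]$ on $[0,\infty)$ is a fluid sample path if there exist realizations of the primitives satisfying, as $r\to\infty$, uniformly on compact sets, $\frac1r\Pi_{\boldsymbol{k}i}(rt)\to t$, $\frac1r\Pi_i(rt)\to t$ and $\frac1r\sum_{m=1}^{\lfloor r\sigma\rfloor}I\{\xi_i(m)\le\zeta\}\to\sigma\zeta$ ($\sigma\ge0$, $0\le\zeta\le1$), and a subsequence of $r$ (with some initial states $\boldsymbol{X}^r(0)$), along which $[\{x^r_{\boldsymbol{k}}\},\{d^r_{\boldsymbol{k}i}\},\{a^r_{\boldsymbol{k}i}\}]$ converges to it uniformly on compact sets. $\boldsymbol{x}(t)=\{x_{\boldsymbol{k}}(t)\}_{\boldsymbol{k}\in\mathcal{K}}$. **Sets and optimal point.** $\mathcal{X}^{\Box}=\{\boldsymbol{x}\in\mathbb{R}_+^{|\mathcal{K}|}:\sum_{\boldsymbol{k}\in\mathcal{K}^s}x_{\boldsymbol{k}}\le h_s\ \forall s\}$. For $\boldsymbol{x}\in\mathcal{X}^{\Box}$ put $x_{\boldsymbol{0}^s}=h_s-\sum_{\boldsymbol{k}\in\mathcal{K}^s}x_{\boldsymbol{k}}$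 and $\bar{\boldsymbol{x}}=\{x_{\boldsymbol{k}},\boldsymbol{k}\in\bar{\mathcal{K}}\}$. $\mathcal{X}^{\diamond}=\{\boldsymbol{x}\in\mathcal{X}^{\Box}:\sum_{\boldsymbol{k}\in\mathcal{K}}k_ix_{\boldsymbol{k}}=\rho_i\ \forall i\}$. With $c_{\boldsymbol{k}}=\prod_ik_i!$ and $0\log0=0$, $L^{\Box}(\bar{\boldsymbol{x}})=\sum_{\boldsymbol{k}\in\bar{\mathcal{K}}}x_{\boldsymbol{k}}\log[x_{\boldsymbol{k}}c_{\boldsymbol{k}}/e]$, which is strictly convex. $\boldsymbol{x}^{*,\Box}$ is the unique minimizer of $L^{\Box}(\bar{\boldsymbol{x}})$ over $\boldsymbol{x}\in\mathcal{X}^{\diamond}$. $\|\cdot\|$ is the Euclidean norm. *)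

theory Defs
  imports "HOL-Probability.Probability"
begin

section \<open>Configurations\<close>

text \<open>A configuration is a pair of an occupancy vector and a server type; the finite type variables
  \<open>'i\<close> and \<open>'s\<close> are the sets of customer and server types.\<close>

type_synonym ('i, 's) config = "('i \<Rightarrow> nat) \<times> 's"

definition zero_cfg :: "'s \<Rightarrow> ('i, 's) config" where
  "zero_cfg s = ((\<lambda>_. 0), s)"

definition add_cust :: "'i \<Rightarrow> ('i, 's) config \<Rightarrow> ('i, 's) config" where
  "add_cust i k = ((fst k)(i := fst k i + 1), snd k)"

definition rem_cust :: "'i \<Rightarrow> ('i, 's) config \<Rightarrow> ('i, 's) config" where
  "rem_cust i k = ((fst k)(i := fst k i - 1), snd k)"

text \<open>\<open>scaling n\<close> is the \<open>n\<close>-th value of the scaling parameter \<open>r\<close>, and \<open>fit_order i\<close> is the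
  fixed list of the configurations that can fit one more type-\<open>i\<close> customer.\<close>

record ('i, 's) server_system =
  Kbar :: "('i, 's) config set"
  server_frac :: "'s \<Rightarrow> real"
  arrival_rate :: "'i \<Rightarrow> real"
  service_rate :: "'i \<Rightarrow> real"
  scaling :: "nat \<Rightarrow> real"
  fit_order :: "'i \<Rightarrow> ('i, 's) config list"

definition Kbar_of :: "('i, 's) server_system \<Rightarrow> 's \<Rightarrow> ('i, 's) config set" where
  "Kbar_of P s = {k \<in> Kbar P. snd k = s}"

definition K_of :: "('i, 's) server_system \<Rightarrow> 's \<Rightarrow> ('i, 's) config set" where
  "K_of P s = Kbar_of P s - {zero_cfg s}"

definition K :: "('i, 's) server_system \<Rightarrow> ('i, 's) config set" where
  "K P = (\<Union>s. K_of P s)"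

text \<open>The guard \<open>1 \<le> fst k i\<close> is needed because subtraction on \<open>nat\<close> truncates.\<close>

definition edges :: "('i, 's) server_system \<Rightarrow> (('i, 's) config \<times> 'i) set" where
  "edges P = {(k, i). k \<in> K P \<and> 1 \<le> fst k i \<and> rem_cust i k \<in> Kbar P}"

definition fit_set :: "('i, 's) server_system \<Rightarrow> 'i \<Rightarrow> ('i, 's) config set" where
  "fit_set P i = {k \<in> Kbar P. add_cust i k \<in> K P}"

definition load :: "('i, 's) server_system \<Rightarrow> 'i \<Rightarrow> real" where
  "load P i = arrival_rate P i / service_rate P i"

locale finite_server_system =
  fixes P :: "('i::finite, 's::finite) server_system"
  assumes finite_Kbar_of: "\<And>s. finite (Kbar_of P s)"
    and Kbar_mono: "\<And>f g s. (f, s) \<in> Kbar P \<Longrightarrow> (\<And>i. g i \<le> f i) \<Longrightarrow> (g, s) \<in> Kbar P"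
    and zero_in_Kbar: "\<And>s. zero_cfg s \<in> Kbar P"
    and unit_in_Kbar: "\<And>i. \<exists>s. add_cust i (zero_cfg s) \<in> Kbar P"
    and server_frac_pos: "\<And>s. 0 < server_frac P s"
    and arrival_rate_pos: "\<And>i. 0 < arrival_rate P i"
    and service_rate_pos: "\<And>i. 0 < service_rate P i"
    and load_sum: "(\<Sum>i\<in>UNIV. load P i) = 1"
    and scaling_ge_1: "\<And>n. 1 \<le> scaling P n"
    and scaling_lim: "filterlim (scaling P) at_top sequentially"
    and servers_Nats: "\<And>s n. server_frac P s * scaling P n \<in> \<nat>"
    and fit_order_distinct: "\<And>i. distinct (fit_order P i)"
    and fit_order_set: "\<And>i. set (fit_order P i) = fit_set P i"

section \<open>Driving processes\<close>

definition counting_path :: "(real \<Rightarrow> nat) \<Rightarrow> bool" where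
  "counting_path N \<longleftrightarrow> N 0 = 0 \<and> mono_on {0..} N \<and>
     (\<forall>t\<ge>0. continuous (at_right t) N) \<and>
     (\<forall>t>0. \<forall>\<^sub>F u in at_left t. N t \<le> Suc (N u))"

definition unit_poisson :: "'w measure \<Rightarrow> ('w \<Rightarrow> real \<Rightarrow> nat) \<Rightarrow> bool" where
  "unit_poisson M N \<longleftrightarrow>
     (\<forall>\<omega>\<in>space M. counting_path (N \<omega>)) \<and>
     (\<forall>t\<ge>0. (\<lambda>\<omega>. N \<omega> t) \<in> measurable M (count_space UNIV)) \<and>
     (\<forall>s t. 0 \<le> s \<and> s < t \<longrightarrow>
        distr M (count_space UNIV) (\<lambda>\<omega>. N \<omega> t - N \<omega> s) = measure_pmf (poisson_pmf (t - s))) \<and>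
     (\<forall>\<tau>::nat \<Rightarrow> real. mono \<tau> \<and> 0 \<le> \<tau> 0 \<longrightarrow>
        prob_space.indep_vars M (\<lambda>_. count_space UNIV)
          (\<lambda>j \<omega>. N \<omega> (\<tau> (Suc j)) - N \<omega> (\<tau> j)) UNIV)"

record ('i, 's, 'w) primitives =
  sample_space :: "'w measure"
  dep_process :: "('i, 's) config \<times> 'i \<Rightarrow> 'w \<Rightarrow> real \<Rightarrow> nat"
  arr_process :: "'i \<Rightarrow> 'w \<Rightarrow> real \<Rightarrow> nat"
  mark :: "'i \<Rightarrow> nat \<Rightarrow> 'w \<Rightarrow> real"

datatype ('i, 's) source = Departure "('i, 's) config \<times> 'i" | Arrival 'i | Mark 'i nat

text \<open>The \<open>\<sigma>\<close>-algebra generated by one primitive process, respectively by one mark.\<close>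

fun source_events :: "('i, 's, 'w) primitives \<Rightarrow> ('i, 's) source \<Rightarrow> 'w set set" where
  "source_events W (Departure e) = sigma_sets (space (sample_space W))
     {(\<lambda>\<omega>. dep_process W e \<omega> t) -` B \<inter> space (sample_space W) | t B. 0 \<le> t}"
| "source_events W (Arrival i) = sigma_sets (space (sample_space W))
     {(\<lambda>\<omega>. arr_process W i \<omega> t) -` B \<inter> space (sample_space W) | t B. 0 \<le> t}"
| "source_events W (Mark i m) = sigma_sets (space (sample_space W))
     {mark W i m -` B \<inter> space (sample_space W) | B. B \<in> sets borel}"

locale driving_primitives =
  fixes P :: "('i::finite, 's::finite) server_system"
    and W :: "('i, 's, 'w) primitives"
  assumes prob_sample_space: "prob_space (sample_space W)"
    and dep_poisson: "\<And>e. e \<in> edges P \<Longrightarrow> unit_poisson (sample_space W) (dep_process W e)"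
    and arr_poisson: "\<And>i. unit_poisson (sample_space W) (arr_process W i)"
    and mark_measurable: "\<And>i m. 1 \<le> m \<Longrightarrow> mark W i m \<in> borel_measurable (sample_space W)"
    and mark_range: "\<And>i m \<omega>. 1 \<le> m \<Longrightarrow> \<omega> \<in> space (sample_space W) \<Longrightarrow> mark W i m \<omega> \<in> {0..1}"
    and mark_uniform: "\<And>i m. 1 \<le> m \<Longrightarrow>
      distr (sample_space W) borel (mark W i m) = uniform_measure lborel {0..1}"
    and sources_indep: "prob_space.indep_sets (sample_space W) (source_events W)
      (Departure ` edges P \<union> range Arrival \<union> {Mark i m | i m. 1 \<le> m})"

section \<open>Sample paths under GRAND-F\<close>

definition arrivals ::
  "('i, 's) server_system \<Rightarrow> ('i, 's, 'w) primitives \<Rightarrow> 'w \<Rightarrow> real \<Rightarrow> 'i \<Rightarrow> real \<Rightarrow> nat" where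
  "arrivals P W \<omega> r i t = arr_process W i \<omega> (arrival_rate P i * r * t)"

definition arrival_time ::
  "('i, 's) server_system \<Rightarrow> ('i, 's, 'w) primitives \<Rightarrow> 'w \<Rightarrow> real \<Rightarrow> 'i \<Rightarrow> nat \<Rightarrow> real" where
  "arrival_time P W \<omega> r i m = Inf {t. 0 \<le> t \<and> m \<le> arrivals P W \<omega> r i t}"

definition fit_count ::
  "('i, 's) server_system \<Rightarrow> 'i \<Rightarrow> (('i, 's) config \<Rightarrow> nat) \<Rightarrow> nat" where
  "fit_count P i u = (\<Sum>k\<in>fit_set P i. u k)"

text \<open>The consecutive intervals are taken half-open on the left, except that the first non-degenerate
  one also contains 0; they partition \<open>[0, 1]\<close>, and configurations with no server get the empty
  interval.\<close>

definition grand_interval ::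
  "('i, 's) server_system \<Rightarrow> 'i \<Rightarrow> (('i, 's) config \<Rightarrow> nat) \<Rightarrow> nat \<Rightarrow> real set" where
  "grand_interval P i u j =
    (let a = (\<Sum>l<j. real (u (fit_order P i ! l)) / real (fit_count P i u));
         b = (\<Sum>l\<le>j. real (u (fit_order P i ! l)) / real (fit_count P i u))
     in if a = 0 \<and> 0 < b then {0..b} else {a<..b})"

text \<open>In state \<open>u\<close>, a type-\<open>i\<close> arrival with mark \<open>z\<close> turns a server into configuration \<open>k\<close>.\<close>

definition placed_along :: "('i, 's) server_system \<Rightarrow> 'i \<Rightarrow> (('i, 's) config \<Rightarrow> nat) \<Rightarrow> real
    \<Rightarrow> ('i, 's) config \<Rightarrow> bool" where
  "placed_along P i u z k \<longleftrightarrow> 1 \<le> fit_count P i u \<and>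
     (\<exists>j<length (fit_order P i). add_cust i (fit_order P i ! j) = k \<and> z \<in> grand_interval P i u j)"

definition state_before :: "(real \<Rightarrow> ('i, 's) config \<Rightarrow> nat) \<Rightarrow> real \<Rightarrow> ('i, 's) config \<Rightarrow> nat" where
  "state_before X t = (\<lambda>k. Lim (at_left t) (\<lambda>u. X u k))"

text \<open>\<open>X t k\<close> is the number of servers in configuration \<open>k\<close> at time \<open>t\<close>; \<open>D (k, i) t\<close> and
  \<open>A (k, i) t\<close> count the departures and the placed arrivals along the edge \<open>(k, i)\<close> in \<open>[0, t]\<close>.
  An arrival is placed according to the state just before it, so \<open>state_before\<close> is a left limit.
  No tie-breaking rule is given for coinciding events, which almost surely do not occur.\<close>

definition grand_f_path ::
  "('i::finite, 's::finite) server_system \<Rightarrow> ('i, 's, 'w) primitives \<Rightarrow> 'w \<Rightarrow> real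
    \<Rightarrow> (real \<Rightarrow> ('i, 's) config \<Rightarrow> nat)
    \<Rightarrow> (('i, 's) config \<times> 'i \<Rightarrow> real \<Rightarrow> nat) \<Rightarrow> (('i, 's) config \<times> 'i \<Rightarrow> real \<Rightarrow> nat) \<Rightarrow> bool" where
  "grand_f_path P W \<omega> r X D A \<longleftrightarrow>
     (\<forall>t\<ge>0. \<forall>s. (\<Sum>k\<in>Kbar_of P s. real (X t k)) = server_frac P s * r) \<and>
     (\<forall>t\<ge>0. \<forall>k\<in>Kbar P. real (X t k) = real (X 0 k)
        + (\<Sum>i | (k, i) \<in> edges P. real (A (k, i) t) - real (D (k, i) t))
        - (\<Sum>i | (add_cust i k, i) \<in> edges P.
             real (A (add_cust i k, i) t) - real (D (add_cust i k, i) t))) \<and>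
     (\<forall>(k, i)\<in>edges P. \<forall>t\<ge>0. (\<lambda>u. real (X u k)) integrable_on {0..t} \<and>
        D (k, i) t = dep_process W (k, i) \<omega>
          (integral {0..t} (\<lambda>u. real (X u k) * real (fst k i) * service_rate P i))) \<and>
     (\<forall>(k, i)\<in>edges P. \<forall>t\<ge>0. A (k, i) t = card {m \<in> {1..arrivals P W \<omega> r i t}.
        placed_along P i (state_before X (arrival_time P W \<omega> r i m)) (mark W i m \<omega>) k})"

section \<open>Fluid sample paths\<close>

definition uoc_limit ::
  "'a::topological_space set \<Rightarrow> (nat \<Rightarrow> 'a \<Rightarrow> real) \<Rightarrow> ('a \<Rightarrow> real) \<Rightarrow> bool" where
  "uoc_limit S f g \<longleftrightarrow> (\<forall>C. compact C \<and> C \<subseteq> S \<longrightarrow> uniform_limit C f g sequentially)"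

definition loc_lipschitz :: "(real \<Rightarrow> real) \<Rightarrow> bool" where
  "loc_lipschitz f \<longleftrightarrow> (\<forall>t\<ge>0. \<exists>e>0. \<exists>L. L-lipschitz_on (cball t e \<inter> {0..}) f)"

definition lln_realization ::
  "('i, 's) server_system \<Rightarrow> ('i, 's, 'w) primitives \<Rightarrow> 'w \<Rightarrow> bool" where
  "lln_realization P W \<omega> \<longleftrightarrow>
     (\<forall>e\<in>edges P. uoc_limit {0..}
        (\<lambda>n t. real (dep_process W e \<omega> (scaling P n * t)) / scaling P n) (\<lambda>t. t)) \<and>
     (\<forall>i. uoc_limit {0..}
        (\<lambda>n t. real (arr_process W i \<omega> (scaling P n * t)) / scaling P n) (\<lambda>t. t)) \<and>
     (\<forall>i. uoc_limit ({0..} \<times> {0..1})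
        (\<lambda>n (\<sigma>, \<zeta>). (\<Sum>m = 1..nat \<lfloor>scaling P n * \<sigma>\<rfloor>. indicator {..\<zeta>} (mark W i m \<omega>)) / scaling P n)
        (\<lambda>(\<sigma>, \<zeta>). \<sigma> * \<zeta>))"

definition fsp :: "('i::finite, 's::finite) server_system \<Rightarrow> ('i, 's, 'w) primitives
    \<Rightarrow> (('i, 's) config \<Rightarrow> real \<Rightarrow> real)
    \<Rightarrow> (('i, 's) config \<times> 'i \<Rightarrow> real \<Rightarrow> real) \<Rightarrow> (('i, 's) config \<times> 'i \<Rightarrow> real \<Rightarrow> real) \<Rightarrow> bool" where
  "fsp P W x d a \<longleftrightarrow>
     (\<forall>k\<in>K P. loc_lipschitz (x k)) \<and>
     (\<forall>e\<in>edges P. loc_lipschitz (d e) \<and> loc_lipschitz (a e)) \<and>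
     (\<exists>\<omega>\<in>space (sample_space W). lln_realization P W \<omega> \<and>
       (\<exists>\<phi> X D A. strict_mono (\<phi> :: nat \<Rightarrow> nat) \<and>
         (\<forall>n. grand_f_path P W \<omega> (scaling P (\<phi> n)) (X n) (D n) (A n)) \<and>
         (\<forall>k\<in>K P. uoc_limit {0..} (\<lambda>n t. real (X n t k) / scaling P (\<phi> n)) (x k)) \<and>
         (\<forall>e\<in>edges P. uoc_limit {0..} (\<lambda>n t. real (D n e t) / scaling P (\<phi> n)) (d e) \<and>
                      uoc_limit {0..} (\<lambda>n t. real (A n e t) / scaling P (\<phi> n)) (a e))))"

definition state_at :: "('i, 's) server_system \<Rightarrow> (('i, 's) config \<Rightarrow> real \<Rightarrow> real) \<Rightarrow> real
    \<Rightarrow> (('i, 's) config \<Rightarrow> real)" where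
  "state_at P x t = (\<lambda>k\<in>K P. x k t)"

section \<open>The optimal point\<close>

text \<open>Vectors indexed by \<open>K P\<close> are functions that are extensional on \<open>K P\<close>.\<close>

definition X_box :: "('i, 's) server_system \<Rightarrow> (('i, 's) config \<Rightarrow> real) set" where
  "X_box P = {x \<in> K P \<rightarrow>\<^sub>E {0..}. \<forall>s. (\<Sum>k\<in>K_of P s. x k) \<le> server_frac P s}"

definition xbar :: "('i, 's) server_system \<Rightarrow> (('i, 's) config \<Rightarrow> real) \<Rightarrow> (('i, 's) config \<Rightarrow> real)" where
  "xbar P x = (\<lambda>k. if k = zero_cfg (snd k)
     then server_frac P (snd k) - (\<Sum>l\<in>K_of P (snd k). x l) else x k)"

definition X_diamond :: "('i, 's) server_system \<Rightarrow> (('i, 's) config \<Rightarrow> real) set" where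
  "X_diamond P = {x \<in> X_box P. \<forall>i. (\<Sum>k\<in>K P. real (fst k i) * x k) = load P i}"

text \<open>The convention \<open>0 log 0 = 0\<close> holds automatically.\<close>

definition L_box :: "('i::finite, 's) server_system \<Rightarrow> (('i, 's) config \<Rightarrow> real) \<Rightarrow> real" where
  "L_box P y = (\<Sum>k\<in>Kbar P. y k * ln (y k * (\<Prod>i\<in>UNIV. fact (fst k i)) / exp 1))"

definition x_opt :: "('i::finite, 's) server_system \<Rightarrow> (('i, 's) config \<Rightarrow> real)" where
  "x_opt P = (THE x. is_arg_min (\<lambda>x. L_box P (xbar P x)) (\<lambda>x. x \<in> X_diamond P) x)"

definition vec_dist ::
  "('i, 's) server_system \<Rightarrow> (('i, 's) config \<Rightarrow> real) \<Rightarrow> (('i, 's) config \<Rightarrow> real) \<Rightarrow> real" where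
  "vec_dist P x y = L2_set (\<lambda>k. x k - y k) (K P)"

end

theory Submission
  imports Defs "HOL-Real_Asymp.Real_Asymp"
begin

text \<open>
The minimiser \<open>p = xbar P (x_opt P)\<close> of the entropy is a detailed-balance equilibrium of the fluid
dynamics, and near it a quadratic Lyapunov function decays at an exponential rate.

\<^emph>\<open>Equilibrium.\<close> The entropy is strictly convex on a compact set, so the minimiser exists and is
unique. It is positive in every coordinate: the entropy has slope \<open>- \<infinity>\<close> at a zero coordinate, and
because some feasible point keeps servers of every type empty, every configuration is used by some
feasible point (\<open>minimizer_positive\<close>, \<open>feasible_positive_at\<close>). Moving mass across one edge of type
\<open>i\<close> upwards and across another edge of type \<open>i\<close> downwards keeps all constraints. Stationarity
in this direction says that the ratio \<open>k\<^sub>i p\<^sub>k / p\<^bsub>k - e_i\<^esub>\<close> is the same for all edges of type \<open>i\<close>,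
which is detailed balance (\<open>minimizer_balance\<close>).

\<^emph>\<open>Fluid dynamics.\<close> A departure count is a time-changed Poisson process, so by the law of large
numbers its limit has rate \<open>k\<^sub>i \<mu>\<^sub>i x\<^sub>k\<close>. For arrivals, while the state is close to \<open>x(t)\<close> the interval of marks
that leads to a given configuration is squeezed between two fixed intervals; the law of large numbers
for the marks turns this into the rate \<open>\<lambda>\<^sub>i x\<^bsub>k - e_i\<^esub> / x\<^bsub>(i)\<^esub>\<close> (\<open>arrivals_derivative\<close>). Only times
\<open>t > 0\<close> at which every \<open>x\<^bsub>(i)\<^esub>\<close> is positive are treated; there the paths are differentiable.

\<^emph>\<open>Decay.\<close> Put \<open>u\<^sub>k = x\<^sub>k / p\<^sub>k - 1\<close> and let \<open>Y\<^sub>i\<close> be the relative deviation of the number of type-\<open>i\<close> customers from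
\<open>\<rho>\<^sub>i\<close>. Summation by parts gives for \<open>\<Sum>\<^sub>k p\<^sub>k u\<^sub>k\<^sup>2 / 2\<close> a derivative \<open>- \<Sum> q r\<^sup>2\<close> plus error terms,
where \<open>q\<close> is the equilibrium flow along an edge and \<open>r\<close> its relative imbalance
(\<open>dissipation_identity\<close>). The error terms are of third order or contain a factor \<open>Y\<^sub>i\<close>. Conversely,
if all \<open>r\<close> and all \<open>Y\<^sub>i\<close> vanish then to first order \<open>u\<^sub>k\<close> is affine in \<open>k\<close> for each server type, hence
orthogonal to itself, hence \<open>0\<close>: this is \<open>energy_identity\<close>, and it bounds \<open>u\<close> by \<open>r\<close> and \<open>Y\<close>.
Since \<open>Y\<^sub>i' = - \<mu>\<^sub>i Y\<^sub>i\<close> exactly, adding a large multiple of \<open>\<Sum>\<^sub>i Y\<^sub>i\<^sup>2\<close> absorbs the terms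
containing \<open>Y\<^sub>i\<close>. The resulting function \<open>V\<close> satisfies \<open>V' \<le> - c V\<close> as long as \<open>V\<close> is small
(\<open>dissipative_near_equilibrium\<close>), so it stays small and decays like \<open>exp (- c t)\<close>, with
constants that depend on the system only. This is the required uniformity.
\<close>

section \<open>The graph of configurations\<close>

lemma rem_add_cust [simp]: "rem_cust i (add_cust i k) = k"
  by (simp add: rem_cust_def add_cust_def)

lemma add_rem_cust: "1 \<le> fst k i \<Longrightarrow> add_cust i (rem_cust i k) = k"
  by (cases k) (auto simp: rem_cust_def add_cust_def fun_eq_iff)

lemma snd_add_cust [simp]: "snd (add_cust i k) = snd k"
  by (simp add: add_cust_def)

lemma snd_zero_cfg [simp]: "snd (zero_cfg s) = s"
  by (simp add: zero_cfg_def)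

lemma fst_zero_cfg [simp]: "fst (zero_cfg s) i = 0"
  by (simp add: zero_cfg_def)

lemma fst_add_cust: "fst (add_cust i k) j = fst k j + (if j = i then 1 else 0)"
  by (simp add: add_cust_def)

lemma add_cust_neq_zero [simp]: "add_cust i k \<noteq> zero_cfg s"
proof
  assume "add_cust i k = zero_cfg s"
  then have "fst (add_cust i k) i = fst (zero_cfg s) i" by (rule arg_cong)
  then show False by (simp add: fst_add_cust)
qed

lemma inj_add_cust: "add_cust i k = add_cust i l \<longleftrightarrow> k = l"
  by (metis rem_add_cust)

lemma config_eq_zero_iff: "k = zero_cfg (snd k) \<longleftrightarrow> (\<forall>i. fst k i = 0)"
  by (cases k) (auto simp: zero_cfg_def fun_eq_iff)

text \<open>The factor \<open>c\<^sub>k\<close> in \<^const>\<open>L_box\<close>.\<close>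

definition cfg_fact :: "('i::finite, 's) config \<Rightarrow> real" where
  "cfg_fact k = (\<Prod>i\<in>UNIV. fact (fst k i))"

lemma cfg_fact_pos: "0 < cfg_fact k"
  by (simp add: cfg_fact_def prod_pos)

lemma cfg_fact_add: "cfg_fact (add_cust i k) = real (fst k i + 1) * cfg_fact k"
proof -
  have "cfg_fact (add_cust i k) = (fact (fst k i + 1) :: real) * (\<Prod>j\<in>UNIV - {i}. fact (fst k j))"
    unfolding cfg_fact_def
    by (subst prod.remove[of _ i]) (auto simp: fst_add_cust intro!: prod.cong)
  also have "\<dots> = real (fst k i + 1) * cfg_fact k"
    unfolding cfg_fact_def
    by (subst (2) prod.remove[of _ i]) auto
  finally show ?thesis .
qed

text \<open>For a state \<open>y\<close>, the quantity \<open>x\<^bsub>(i)\<^esub>\<close>: the mass of servers that can take one more type-\<open>i\<close> customer.\<close>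

definition fit_mass :: "('i, 's) server_system \<Rightarrow> 'i \<Rightarrow> (('i, 's) config \<Rightarrow> real) \<Rightarrow> real" where
  "fit_mass P i y = (\<Sum>k\<in>fit_set P i. y k)"

context finite_server_system
begin

lemma finite_Kbar [simp]: "finite (Kbar P)"
proof -
  have "Kbar P = (\<Union>s. Kbar_of P s)" by (auto simp: Kbar_of_def)
  then show ?thesis using finite_Kbar_of by simp
qed

lemma K_eq: "K P = {k \<in> Kbar P. k \<noteq> zero_cfg (snd k)}"
  by (auto simp: K_def K_of_def Kbar_of_def)

lemma K_of_eq: "K_of P s = {k \<in> K P. snd k = s}"
  by (auto simp: K_def K_of_def Kbar_of_def)

lemma finite_K [simp]: "finite (K P)"
  by (simp add: K_eq)

lemma sum_Kbar_of: "(\<Sum>k\<in>Kbar P. f k) = (\<Sum>s\<in>UNIV. \<Sum>k\<in>Kbar_of P s. f k)"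
  unfolding Kbar_of_def using sum.group[of "Kbar P" UNIV snd f] by simp

lemma sum_Kbar_of_zero: "(\<Sum>k\<in>Kbar_of P s. f k) = f (zero_cfg s) + (\<Sum>k\<in>K_of P s. f k)"
proof -
  have "zero_cfg s \<in> Kbar_of P s" using zero_in_Kbar by (simp add: Kbar_of_def)
  then show ?thesis unfolding K_of_def using finite_Kbar_of by (simp add: sum.remove)
qed

lemma fit_set_eq: "fit_set P i = {k \<in> Kbar P. add_cust i k \<in> Kbar P}"
  by (simp add: fit_set_def K_eq)

lemma fit_set_Kbar: "k \<in> fit_set P i \<Longrightarrow> k \<in> Kbar P"
  and fit_set_add: "k \<in> fit_set P i \<Longrightarrow> add_cust i k \<in> Kbar P"
  by (auto simp: fit_set_eq)

lemma finite_fit_set [simp]: "finite (fit_set P i)"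
  by (simp add: fit_set_eq)

lemma fit_set_nonempty: "fit_set P i \<noteq> {}"
proof -
  obtain s where "add_cust i (zero_cfg s) \<in> Kbar P" using unit_in_Kbar by blast
  then have "zero_cfg s \<in> fit_set P i" using zero_in_Kbar by (simp add: fit_set_eq)
  then show ?thesis by blast
qed

lemma rem_cust_Kbar: "k \<in> Kbar P \<Longrightarrow> rem_cust i k \<in> Kbar P"
  using Kbar_mono[of "fst k" "snd k" "(fst k)(i := fst k i - 1)"]
  by (auto simp: rem_cust_def)

lemma edges_iff: "(k, i) \<in> edges P \<longleftrightarrow> k \<in> Kbar P \<and> 1 \<le> fst k i"
proof -
  have "k \<noteq> zero_cfg (snd k)" if "1 \<le> fst k i"
    using that config_eq_zero_iff[of k] by (metis not_one_le_zero)
  then show ?thesis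
    unfolding edges_def K_eq using rem_cust_Kbar by blast
qed

lemma edges_add_iff: "(add_cust i k, i) \<in> edges P \<longleftrightarrow> add_cust i k \<in> Kbar P"
  by (simp add: edges_iff fst_add_cust)

lemma add_in_Kbar_fit: "add_cust i k \<in> Kbar P \<Longrightarrow> k \<in> fit_set P i"
  using rem_cust_Kbar[of "add_cust i k" i] by (simp add: fit_set_eq)

text \<open>Edges of type \<open>i\<close> are from here on indexed by their lower end \<open>k \<in> fit_set P i\<close>.\<close>

lemma sum_upper_end:
  "(\<Sum>k | k \<in> Kbar P \<and> 1 \<le> fst k i. f k) = (\<Sum>k\<in>fit_set P i. f (add_cust i k))"
  by (rule sum.reindex_bij_witness[of _ "add_cust i" "rem_cust i"])
     (auto simp: add_rem_cust fit_set_eq rem_cust_Kbar fst_add_cust)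

text \<open>The change of \<open>\<Sum>\<^sub>k f\<^sub>k x\<^sub>k\<close> under edge flows \<open>w\<close>: each unit of flow along an edge moves one server from
  the lower to the upper end. All balance equations are used in this weak form.\<close>

lemma sum_by_parts:
  fixes f :: "('i, 's) config \<Rightarrow> real"
  shows "(\<Sum>k\<in>Kbar P. f k * ((\<Sum>i | (k, i) \<in> edges P. w (k, i))
            - (\<Sum>i | (add_cust i k, i) \<in> edges P. w (add_cust i k, i))))
       = (\<Sum>i\<in>UNIV. \<Sum>k\<in>fit_set P i. (f (add_cust i k) - f k) * w (add_cust i k, i))"
proof -
  have 1: "(\<Sum>k\<in>Kbar P. f k * (\<Sum>i | (k, i) \<in> edges P. w (k, i)))
      = (\<Sum>i\<in>UNIV. \<Sum>k\<in>fit_set P i. f (add_cust i k) * w (add_cust i k, i))"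
  proof -
    have "(\<Sum>k\<in>Kbar P. f k * (\<Sum>i | (k, i) \<in> edges P. w (k, i)))
        = (\<Sum>k\<in>Kbar P. \<Sum>i\<in>UNIV. if 1 \<le> fst k i then f k * w (k, i) else 0)"
      by (auto simp: sum_distrib_left edges_iff sum.If_cases intro!: sum.cong)
    also have "\<dots> = (\<Sum>i\<in>UNIV. \<Sum>k\<in>Kbar P. if 1 \<le> fst k i then f k * w (k, i) else 0)"
      by (rule sum.swap)
    also have "\<dots> = (\<Sum>i\<in>UNIV. \<Sum>k | k \<in> Kbar P \<and> 1 \<le> fst k i. f k * w (k, i))"
      by (simp add: sum.inter_filter)
    finally show ?thesis by (simp only: sum_upper_end)
  qed
  have 2: "(\<Sum>k\<in>Kbar P. f k * (\<Sum>i | (add_cust i k, i) \<in> edges P. w (add_cust i k, i)))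
      = (\<Sum>i\<in>UNIV. \<Sum>k\<in>fit_set P i. f k * w (add_cust i k, i))"
  proof -
    have "(\<Sum>k\<in>Kbar P. f k * (\<Sum>i | (add_cust i k, i) \<in> edges P. w (add_cust i k, i)))
        = (\<Sum>k\<in>Kbar P. \<Sum>i\<in>UNIV. if add_cust i k \<in> Kbar P then f k * w (add_cust i k, i) else 0)"
      by (auto simp: sum_distrib_left edges_add_iff sum.If_cases intro!: sum.cong)
    also have "\<dots> = (\<Sum>i\<in>UNIV. \<Sum>k\<in>Kbar P. if add_cust i k \<in> Kbar P then f k * w (add_cust i k, i) else 0)"
      by (rule sum.swap)
    finally show ?thesis by (simp add: sum.inter_filter[symmetric] fit_set_eq)
  qed
  show ?thesis
    by (simp add: right_diff_distrib left_diff_distrib sum_subtractf 1 2)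
qed

lemma load_pos: "0 < load P i"
  using arrival_rate_pos service_rate_pos by (simp add: load_def)

end

section \<open>The entropy and its minimiser\<close>

definition entropy_term :: "real \<Rightarrow> real \<Rightarrow> real" where
  "entropy_term c y = y * ln (y * c / exp 1)"

text \<open>One summand of \<^const>\<open>L_box\<close>, with \<open>c = c\<^sub>k\<close>. Strict convexity is derived from the strict tangent
  inequality rather than from second derivatives, because it has to include the boundary point \<open>0\<close>,
  where the function is not differentiable.\<close>

lemma entropy_term_alt:
  assumes "0 \<le> y" "0 < c"
  shows "entropy_term c y = y * ln y + y * (ln c - 1)"
  using assms by (cases "y = 0") (auto simp: entropy_term_def ln_mult ln_div algebra_simps)

lemma entropy_term_above_tangent:
  assumes "0 \<le> y" "0 < m" "0 < c" "y \<noteq> m"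
  shows "entropy_term c m + ln (m * c) * (y - m) < entropy_term c y"
proof (cases "y = 0")
  case True
  then show ?thesis using assms
    by (simp add: entropy_term_alt ln_mult algebra_simps)
next
  case False
  then have y: "0 < y" using assms by simp
  have "ln (m / y) < m / y - 1"
    using ln_le_minus_one[of "m / y"] ln_eq_minus_one[of "m / y"] y assms
    by (smt (verit) divide_pos_pos divide_eq_1_iff)
  then have "y * (ln m - ln y) < y * (m / y - 1)"
    using y assms by (simp add: ln_div)
  then have "y * ln m - y * ln y < m - y"
    using y by (simp add: right_diff_distrib)
  then show ?thesis using assms
    by (simp add: entropy_term_alt ln_mult algebra_simps)
qed

lemma entropy_term_strictly_convex:
  assumes "0 \<le> p" "0 \<le> y" "0 < c" "0 < t" "t < 1" "p \<noteq> y"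
  shows "entropy_term c ((1 - t) * p + t * y) < (1 - t) * entropy_term c p + t * entropy_term c y"
proof -
  define m where "m = (1 - t) * p + t * y"
  have m: "0 < m"
    using assms unfolding m_def
    by (smt (verit) mult_nonneg_nonneg mult_pos_pos)
  have pm: "p - m = t * (p - y)" and ym: "y - m = (1 - t) * (y - p)"
    by (auto simp: m_def algebra_simps)
  have "p \<noteq> m" "y \<noteq> m" using pm ym assms by auto
  then have "entropy_term c m + ln (m * c) * (p - m) < entropy_term c p"
    and "entropy_term c m + ln (m * c) * (y - m) < entropy_term c y"
    using entropy_term_above_tangent m assms by auto
  then have "(1 - t) * (entropy_term c m + ln (m * c) * (p - m))
        + t * (entropy_term c m + ln (m * c) * (y - m))
      < (1 - t) * entropy_term c p + t * entropy_term c y"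
    using assms by (intro add_strict_mono mult_strict_left_mono) auto
  also have "(1 - t) * (entropy_term c m + ln (m * c) * (p - m))
        + t * (entropy_term c m + ln (m * c) * (y - m)) = entropy_term c m"
    unfolding pm ym by (simp add: algebra_simps)
  finally show ?thesis by (simp add: m_def)
qed

lemma entropy_term_convex:
  assumes "0 \<le> p" "0 \<le> y" "0 < c" "0 < t" "t < 1"
  shows "entropy_term c ((1 - t) * p + t * y) \<le> (1 - t) * entropy_term c p + t * entropy_term c y"
proof (cases "p = y")
  case True
  then show ?thesis by (simp add: algebra_simps flip: distrib_right)
next
  case False
  then show ?thesis using entropy_term_strictly_convex[OF assms] by simp
qed

text \<open>The summand \<open>t y ln t\<close> is of larger order than \<open>t\<close>; it is what makes the slope at \<open>0\<close> infinite.\<close>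

lemma entropy_term_scale:
  assumes "0 \<le> y" "0 < c" "0 < t"
  shows "entropy_term c (t * y) = t * entropy_term c y + t * y * ln t"
  using assms by (cases "y = 0") (auto simp: entropy_term_alt ln_mult algebra_simps)

lemma continuous_on_entropy_term:
  assumes "0 < c"
  shows "continuous_on {0..} (entropy_term c)"
proof -
  have "continuous_on {0..} (\<lambda>y. y * ln y :: real)"
    unfolding continuous_on_eq_continuous_within
  proof
    fix y :: real assume y: "y \<in> {0..}"
    show "continuous (at y within {0..}) (\<lambda>y. y * ln y)"
    proof (cases "y = 0")
      case True
      have "((\<lambda>y::real. y * ln y) \<longlongrightarrow> 0) (at_right 0)" by real_asymp
      then show ?thesis
        using True by (simp add: continuous_within at_within_Ici_at_right)
    next
      case False
      then show ?thesis using y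
        by (intro continuous_intros) auto
    qed
  qed
  then have "continuous_on {0..} (\<lambda>y. y * ln y + y * (ln c - 1))"
    by (rule continuous_on_add) (intro continuous_on_mult continuous_on_id continuous_on_const)
  then show ?thesis
    by (rule continuous_on_eq) (use assms in \<open>auto simp: entropy_term_alt\<close>)
qed

lemma L_box_entropy: "L_box P y = (\<Sum>k\<in>Kbar P. entropy_term (cfg_fact k) (y k))"
  by (simp add: L_box_def entropy_term_def cfg_fact_def)

text \<open>The image of \<^const>\<open>X_diamond\<close> under \<^const>\<open>xbar\<close>: on \<^const>\<open>Kbar\<close> the zero configurations are
  ordinary coordinates and the constraints become linear equations.\<close>

definition feasible :: "('i, 's) server_system \<Rightarrow> (('i, 's) config \<Rightarrow> real) \<Rightarrow> bool" where
  "feasible P y \<longleftrightarrow> (\<forall>k\<in>Kbar P. 0 \<le> y k) \<and>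
     (\<forall>s. (\<Sum>k\<in>Kbar_of P s. y k) = server_frac P s) \<and>
     (\<forall>i. (\<Sum>k\<in>Kbar P. real (fst k i) * y k) = load P i)"

context finite_server_system
begin

lemma sum_K_weighted:
  "(\<Sum>k\<in>Kbar P. real (fst k i) * y k) = (\<Sum>k\<in>K P. real (fst k i) * y k)"
  by (rule sum.mono_neutral_right) (auto simp: K_eq config_eq_zero_iff)

lemma sum_xbar: "(\<Sum>k\<in>Kbar_of P s. xbar P x k) = server_frac P s"
proof -
  have "(\<Sum>k\<in>K_of P s. xbar P x k) = (\<Sum>k\<in>K_of P s. x k)"
    by (rule sum.cong) (auto simp: xbar_def K_of_eq K_eq)
  then show ?thesis by (simp add: sum_Kbar_of_zero xbar_def)
qed

lemma xbar_K: "k \<in> K P \<Longrightarrow> xbar P x k = x k"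
  by (auto simp: xbar_def K_eq)

lemma feasible_xbar: "x \<in> X_diamond P \<Longrightarrow> feasible P (xbar P x)"
proof -
  assume x: "x \<in> X_diamond P"
  then have nn: "\<And>k. k \<in> K P \<Longrightarrow> 0 \<le> x k" and le: "\<And>s. (\<Sum>k\<in>K_of P s. x k) \<le> server_frac P s"
    and ld: "\<And>i. (\<Sum>k\<in>K P. real (fst k i) * x k) = load P i"
    by (auto simp: X_diamond_def X_box_def)
  have "0 \<le> xbar P x k" if "k \<in> Kbar P" for k
    using that nn le[of "snd k"] by (auto simp: xbar_def K_eq)
  moreover have "(\<Sum>k\<in>Kbar P. real (fst k i) * xbar P x k) = load P i" for i
    unfolding sum_K_weighted using ld[of i] by (simp add: xbar_K)
  ultimately show ?thesis by (simp add: feasible_def sum_xbar)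
qed

lemma feasible_restrict:
  assumes "feasible P y"
  shows "restrict y (K P) \<in> X_diamond P"
    and "k \<in> Kbar P \<Longrightarrow> xbar P (restrict y (K P)) k = y k"
proof -
  have eq: "(\<Sum>k\<in>K_of P s. restrict y (K P) k) = (\<Sum>k\<in>K_of P s. y k)" for s
    by (rule sum.cong) (auto simp: K_of_eq)
  have tot: "server_frac P s = y (zero_cfg s) + (\<Sum>k\<in>K_of P s. y k)" for s
    using assms by (simp add: feasible_def flip: sum_Kbar_of_zero)
  have nn: "0 \<le> y k" if "k \<in> Kbar P" for k using that assms by (simp add: feasible_def)
  have "(\<Sum>k\<in>K P. real (fst k i) * restrict y (K P) k) = load P i" for i
    using assms by (simp add: feasible_def sum_K_weighted)
  moreover have "restrict y (K P) \<in> X_box P"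
    unfolding X_box_def
  proof (intro CollectI conjI allI)
    show "restrict y (K P) \<in> K P \<rightarrow>\<^sub>E {0..}" using nn by (auto simp: K_eq)
    show "(\<Sum>k\<in>K_of P s. restrict y (K P) k) \<le> server_frac P s" for s
      unfolding eq using tot[of s] nn[OF zero_in_Kbar, of s] by linarith
  qed
  ultimately show "restrict y (K P) \<in> X_diamond P" by (simp add: X_diamond_def)
  assume "k \<in> Kbar P"
  then show "xbar P (restrict y (K P)) k = y k"
    unfolding xbar_def eq using tot[of "snd k"] by (auto simp: K_eq)
qed

text \<open>Compactness is that of a product of intervals (Tychonoff). Outside \<open>K P\<close> the factors are the single
  point \<open>undefined\<close>, since vectors are extensional functions.\<close>

lemma compact_X_diamond: "compact (X_diamond P)"
proof -
  define B where "B = (\<Sum>s\<in>UNIV. server_frac P s)"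
  have cont: "continuous_on UNIV (\<lambda>x::('i,'s) config \<Rightarrow> real. x k)" for k
    by (rule continuous_on_product_coordinates)
  define box where "box = PiE UNIV (\<lambda>k. if k \<in> K P then {0..B} else {undefined})"
  have "compactin (product_topology (\<lambda>_::('i,'s) config. euclidean :: real topology) UNIV) box"
    unfolding box_def compactin_PiE by auto
  then have cbox: "compact box" by (simp add: euclidean_product_topology)
  have cl: "closed {x. (\<Sum>k\<in>K_of P s. x k) \<le> server_frac P s}" for s
    by (intro closed_Collect_le continuous_on_sum cont continuous_on_const)
  have cl': "closed {x. (\<Sum>k\<in>K P. real (fst k i) * x k) = load P i}" for i
    by (intro closed_Collect_eq continuous_on_sum cont continuous_on_const continuous_on_mult)
  have "X_diamond P = box \<inter> (\<Inter>s. {x. (\<Sum>k\<in>K_of P s. x k) \<le> server_frac P s})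
      \<inter> (\<Inter>i. {x. (\<Sum>k\<in>K P. real (fst k i) * x k) = load P i})"
  proof (intro equalityI subsetI)
    fix x assume x: "x \<in> X_diamond P"
    then have nn: "\<And>k. k \<in> K P \<Longrightarrow> 0 \<le> x k" and le: "\<And>s. (\<Sum>k\<in>K_of P s. x k) \<le> server_frac P s"
      by (auto simp: X_diamond_def X_box_def)
    have "x k \<le> B" if k: "k \<in> K P" for k
    proof -
      have "x k \<le> (\<Sum>l\<in>K_of P (snd k). x l)"
        using k nn by (intro member_le_sum) (auto simp: K_of_eq)
      also have "\<dots> \<le> server_frac P (snd k)" by (rule le)
      also have "\<dots> \<le> B" unfolding B_def
        using server_frac_pos by (intro member_le_sum) (auto intro: less_imp_le)
      finally show ?thesis .
    qed
    then have "x \<in> box"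
      using x nn by (auto simp: box_def X_diamond_def X_box_def PiE_def extensional_def)
    then show "x \<in> box \<inter> (\<Inter>s. {x. (\<Sum>k\<in>K_of P s. x k) \<le> server_frac P s})
      \<inter> (\<Inter>i. {x. (\<Sum>k\<in>K P. real (fst k i) * x k) = load P i})"
      using x le by (auto simp: X_diamond_def)
  next
    fix x assume x: "x \<in> box \<inter> (\<Inter>s. {x. (\<Sum>k\<in>K_of P s. x k) \<le> server_frac P s})
      \<inter> (\<Inter>i. {x. (\<Sum>k\<in>K P. real (fst k i) * x k) = load P i})"
    have xk: "x k \<in> (if k \<in> K P then {0..B} else {undefined})" for k
      using x PiE_mem[of x UNIV _ k] unfolding box_def by blast
    have "0 \<le> x k" if "k \<in> K P" for k using xk[of k] that by simp
    moreover have "x k = undefined" if "k \<notin> K P" for k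
      using xk[of k] that by simp
    ultimately have "x \<in> K P \<rightarrow>\<^sub>E {0..}"
      by (intro PiE_I) auto
    then show "x \<in> X_diamond P" using x by (auto simp: X_diamond_def X_box_def)
  qed
  moreover have "closed (\<Inter>s. {x. (\<Sum>k\<in>K_of P s. x k) \<le> server_frac P s})"
    and "closed (\<Inter>i. {x. (\<Sum>k\<in>K P. real (fst k i) * x k) = load P i})"
    using cl cl' by (auto intro: closed_INT)
  ultimately show ?thesis using cbox by (auto intro: compact_Int_closed)
qed

lemma continuous_on_L_box_xbar: "continuous_on (X_diamond P) (\<lambda>x. L_box P (xbar P x))"
  unfolding L_box_entropy
proof (intro continuous_on_sum)
  fix k assume k: "k \<in> Kbar P"
  have cont: "continuous_on (X_diamond P) (\<lambda>x::('i,'s) config \<Rightarrow> real. x l)" for l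
    by (rule continuous_on_subset[OF continuous_on_product_coordinates]) simp
  have "continuous_on (X_diamond P) (\<lambda>x. xbar P x k)"
    unfolding xbar_def
    by (cases "k = zero_cfg (snd k)") (auto intro!: continuous_intros cont)
  moreover have "(\<lambda>x. xbar P x k) ` X_diamond P \<subseteq> {0..}"
    using feasible_xbar k by (auto simp: feasible_def)
  ultimately show "continuous_on (X_diamond P) (\<lambda>x. entropy_term (cfg_fact k) (xbar P x k))"
    using continuous_on_compose2[OF continuous_on_entropy_term[OF cfg_fact_pos]] by blast
qed

lemma feasible_convex:
  assumes "feasible P p" "feasible P y" "0 \<le> t" "t \<le> 1"
  shows "feasible P (\<lambda>k. (1 - t) * p k + t * y k)"
proof -
  have "(\<Sum>k\<in>A. w k * ((1 - t) * p k + t * y k)) = (1 - t) * (\<Sum>k\<in>A. w k * p k) + t * (\<Sum>k\<in>A. w k * y k)"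
    for A and w :: "('i, 's) config \<Rightarrow> real"
    by (simp add: distrib_left sum.distrib sum_distrib_left mult_ac)
  note wsum = this and sum1 = this[of "\<lambda>_. 1", simplified]
  show ?thesis
    unfolding feasible_def wsum sum1
    using assms by (auto simp: feasible_def simp flip: distrib_right)
qed

lemma x_opt_minimal:
  assumes "X_diamond P \<noteq> {}"
  shows "x_opt P \<in> X_diamond P"
    and "feasible P y \<Longrightarrow> L_box P (xbar P (x_opt P)) \<le> L_box P y"
proof -
  let ?L = "\<lambda>x. L_box P (xbar P x)"
  obtain x0 where x0: "x0 \<in> X_diamond P" "\<And>y. y \<in> X_diamond P \<Longrightarrow> ?L x0 \<le> ?L y"
    using continuous_attains_inf[OF compact_X_diamond assms continuous_on_L_box_xbar] by blast
  have uniq: "x = x0" if x: "x \<in> X_diamond P" "\<And>y. y \<in> X_diamond P \<Longrightarrow> ?L x \<le> ?L y" for x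
  proof (rule ccontr)
    assume "x \<noteq> x0"
    then obtain k where k: "k \<in> K P" "x k \<noteq> x0 k"
      using x x0 unfolding X_diamond_def X_box_def
      by (metis (no_types, lifting) IntD1 PiE_ext mem_Collect_eq)
    define m where "m = (\<lambda>k. (1 - 1/2) * xbar P x k + 1/2 * xbar P x0 k)"
    have m: "feasible P m" unfolding m_def
      using x x0 feasible_xbar by (intro feasible_convex) auto
    have nn: "0 \<le> xbar P x k" "0 \<le> xbar P x0 k" if "k \<in> Kbar P" for k
      using that feasible_xbar x x0 by (auto simp: feasible_def)
    have "L_box P m < (\<Sum>k\<in>Kbar P. (1 - 1/2) * entropy_term (cfg_fact k) (xbar P x k)
        + 1/2 * entropy_term (cfg_fact k) (xbar P x0 k))"
      unfolding L_box_entropy m_def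
    proof (rule sum_strict_mono_ex1)
      have k': "k \<in> Kbar P" "xbar P x k \<noteq> xbar P x0 k" using k by (auto simp: K_eq xbar_K)
      show "\<forall>l\<in>Kbar P. entropy_term (cfg_fact l) ((1 - 1/2) * xbar P x l + 1/2 * xbar P x0 l)
          \<le> (1 - 1/2) * entropy_term (cfg_fact l) (xbar P x l)
        + 1/2 * entropy_term (cfg_fact l) (xbar P x0 l)"
        using nn cfg_fact_pos by (intro ballI entropy_term_convex) auto
      have "entropy_term (cfg_fact k) ((1 - 1/2) * xbar P x k + 1/2 * xbar P x0 k)
          < (1 - 1/2) * entropy_term (cfg_fact k) (xbar P x k)
        + 1/2 * entropy_term (cfg_fact k) (xbar P x0 k)"
        by (rule entropy_term_strictly_convex[OF nn(1)[OF k'(1)] nn(2)[OF k'(1)] cfg_fact_pos _ _ k'(2)]) simp_all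
      then show "\<exists>l\<in>Kbar P. entropy_term (cfg_fact l) ((1 - 1/2) * xbar P x l + 1/2 * xbar P x0 l)
          < (1 - 1/2) * entropy_term (cfg_fact l) (xbar P x l)
        + 1/2 * entropy_term (cfg_fact l) (xbar P x0 l)"
        using k'(1) by blast
    qed simp
    also have "\<dots> = 1/2 * (?L x + ?L x0)"
      by (simp add: L_box_entropy sum.distrib sum_distrib_left distrib_left)
    also have "\<dots> \<le> ?L x0" using x(2)[OF x0(1)] by simp
    also have "\<dots> \<le> ?L (restrict m (K P))" using x0 feasible_restrict[OF m] by blast
    also have "\<dots> = L_box P m"
      unfolding L_box_entropy using feasible_restrict[OF m] by (intro sum.cong) auto
    finally show False by simp
  qed
  have "x_opt P = x0"
    unfolding x_opt_def is_arg_min_linorder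
  proof (rule the_equality)
    show "x0 \<in> X_diamond P \<and> (\<forall>y. y \<in> X_diamond P \<longrightarrow> ?L x0 \<le> ?L y)" using x0 by blast
    show "x = x0" if "x \<in> X_diamond P \<and> (\<forall>y. y \<in> X_diamond P \<longrightarrow> ?L x \<le> ?L y)" for x
      using that uniq by blast
  qed
  then show "x_opt P \<in> X_diamond P" using x0 by simp
  show "?L (x_opt P) \<le> L_box P y" if "feasible P y"
  proof -
    have "?L (x_opt P) \<le> ?L (restrict y (K P))"
      using x0 feasible_restrict[OF that] \<open>x_opt P = x0\<close> by blast
    also have "\<dots> = L_box P y"
      unfolding L_box_entropy using feasible_restrict[OF that] by (intro sum.cong) auto
    finally show ?thesis .
  qed
qed

end

section \<open>The minimiser is a detailed-balance equilibrium\<close>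

context finite_server_system
begin

text \<open>A direction that respects the linear constraints and points inwards at the zero coordinates is
  feasible for a short time.\<close>

lemma feasible_perturb:
  assumes x: "feasible P x"
    and tot: "\<And>s. (\<Sum>k\<in>Kbar_of P s. v k) = 0"
    and ld: "\<And>i. (\<Sum>k\<in>Kbar P. real (fst k i) * v k) = 0"
    and nn: "\<And>k. k \<in> Kbar P \<Longrightarrow> x k = 0 \<Longrightarrow> 0 \<le> v k"
  shows "\<forall>\<^sub>F t in at_right 0. feasible P (\<lambda>k. x k + t * v k)"
proof -
  have "\<forall>\<^sub>F t in at_right 0. \<forall>k\<in>Kbar P. 0 \<le> x k + t * v k"
  proof (intro eventually_ball_finite ballI finite_Kbar)
    fix k assume k: "k \<in> Kbar P"
    show "\<forall>\<^sub>F t in at_right 0. 0 \<le> x k + t * v k"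
    proof (cases "x k = 0")
      case True
      then show ?thesis using nn[OF k]
        by (auto intro!: eventually_mono[OF eventually_at_right_less])
    next
      case False
      then have "0 < x k" using x k by (auto simp: feasible_def less_le)
      moreover have "((\<lambda>t. x k + t * v k) \<longlongrightarrow> x k + 0 * v k) (at_right 0)"
        by (intro tendsto_intros)
      ultimately have "\<forall>\<^sub>F t in at_right 0. 0 < x k + t * v k"
        by (simp add: order_tendstoD(1))
      then show ?thesis by (rule eventually_mono) simp
    qed
  qed
  moreover have "(\<Sum>k\<in>Kbar P. real (fst k i) * (x k + t * v k)) = load P i" for i t
  proof -
    have "(\<Sum>k\<in>Kbar P. real (fst k i) * (x k + t * v k))
        = (\<Sum>k\<in>Kbar P. real (fst k i) * x k) + t * (\<Sum>k\<in>Kbar P. real (fst k i) * v k)"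
      by (simp add: distrib_left sum.distrib sum_distrib_left mult_ac)
    then show ?thesis using x ld by (simp add: feasible_def)
  qed
  moreover have "(\<Sum>k\<in>Kbar_of P s. x k + t * v k) = server_frac P s" for s t
    using x tot by (simp add: feasible_def sum.distrib flip: sum_distrib_left)
  ultimately show ?thesis by (simp add: feasible_def)
qed

lemma sum_unit:
  assumes "l \<in> Kbar P"
  shows "(\<Sum>k\<in>Kbar_of P s. of_bool (k = l) :: real) = of_bool (s = snd l)"
    and "(\<Sum>k\<in>Kbar P. f k * of_bool (k = l)) = (f l :: real)"
  using assms finite_Kbar_of[of s] by (auto simp: of_bool_def Kbar_of_def if_distrib cong: if_cong)

text \<open>Some mass of empty servers can be brought into configuration \<open>k\<close>: the customers that this needs are
  taken from servers that hold them, which exist because every load is positive.\<close>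

lemma feasible_positive_at:
  assumes x: "feasible P x" and empty: "\<And>s. 0 < x (zero_cfg s)" and k: "k \<in> Kbar P"
  shows "\<exists>y. feasible P y \<and> 0 < y k"
proof (cases "x k = 0")
  case False
  then show ?thesis using x k by (auto simp: feasible_def less_le)
next
  case xk: True
  \<comment> \<open>\<open>l i\<close> is an occupied configuration from which a type-\<open>i\<close> customer can be removed.\<close>
  have "\<exists>l. l \<in> Kbar P \<and> 1 \<le> fst l i \<and> 0 < x l" for i
  proof (rule ccontr)
    assume none: "\<not> ?thesis"
    have "real (fst l i) * x l = 0" if "l \<in> Kbar P" for l
    proof -
      have "0 \<le> x l" using x that by (simp add: feasible_def)
      moreover have "\<not> (1 \<le> fst l i \<and> 0 < x l)" using none that by blast
      ultimately show ?thesis by (cases "fst l i = 0") auto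
    qed
    then have "(\<Sum>l\<in>Kbar P. real (fst l i) * x l) = 0" by (intro sum.neutral) blast
    then show False using x load_pos[of i] by (simp add: feasible_def)
  qed
  then obtain l where l: "\<And>i. l i \<in> Kbar P" "\<And>i. 1 \<le> fst (l i) i" "\<And>i. 0 < x (l i)" by metis
  have l': "rem_cust i (l i) \<in> Kbar P" for i using l rem_cust_Kbar by blast
  have snd_rem: "snd (rem_cust i m) = snd m" for i and m :: "('i, 's) config"
    by (simp add: rem_cust_def)
  define z where "z = (zero_cfg (snd k) :: ('i, 's) config)"
  have z: "z \<in> Kbar P" using zero_in_Kbar by (simp add: z_def)
  define v :: "('i, 's) config \<Rightarrow> real" where
    "v = (\<lambda>m. of_bool (m = k) - of_bool (m = z)
       + (\<Sum>i\<in>UNIV. real (fst k i) * (of_bool (m = rem_cust i (l i)) - of_bool (m = l i))))"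
  have sum_v: "(\<Sum>m\<in>Kbar P. f m * v m)
      = f k - f z + (\<Sum>i\<in>UNIV. real (fst k i) * (f (rem_cust i (l i)) - f (l i)))" for f
  proof -
    have "(\<Sum>m\<in>Kbar P. f m * v m) = (\<Sum>m\<in>Kbar P. f m * of_bool (m = k)) - (\<Sum>m\<in>Kbar P. f m * of_bool (m = z))
        + (\<Sum>m\<in>Kbar P. \<Sum>i\<in>UNIV. real (fst k i) * (f m * of_bool (m = rem_cust i (l i)) - f m * of_bool (m = l i)))"
      unfolding v_def distrib_left right_diff_distrib sum.distrib sum_subtractf sum_distrib_left
      by (simp add: mult_ac)
    also have "(\<Sum>m\<in>Kbar P. \<Sum>i\<in>UNIV. real (fst k i) * (f m * of_bool (m = rem_cust i (l i)) - f m * of_bool (m = l i)))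
        = (\<Sum>i\<in>UNIV. real (fst k i) * ((\<Sum>m\<in>Kbar P. f m * of_bool (m = rem_cust i (l i)))
             - (\<Sum>m\<in>Kbar P. f m * of_bool (m = l i))))"
      by (subst sum.swap) (simp only: sum_distrib_left sum_subtractf right_diff_distrib)
    finally show ?thesis using k z l l' by (simp add: sum_unit)
  qed
  have "(\<Sum>m\<in>Kbar_of P s. v m) = 0" for s
  proof -
    have "(\<Sum>m\<in>Kbar_of P s. v m) = (\<Sum>m\<in>Kbar P. of_bool (snd m = s) * v m)"
      by (rule sum.mono_neutral_cong_left) (auto simp: Kbar_of_def)
    then show ?thesis by (simp add: sum_v z_def snd_rem)
  qed
  moreover have "(\<Sum>m\<in>Kbar P. real (fst m j) * v m) = 0" for j
  proof -
    have "real (fst k i) * (real (fst (rem_cust i (l i)) j) - real (fst (l i) j))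
        = (if i = j then - real (fst k j) else 0)" for i
      using l(2)[of i] by (auto simp: rem_cust_def of_nat_diff algebra_simps)
    then show ?thesis unfolding sum_v by (simp add: z_def)
  qed
  moreover have vk: "of_bool (m = k) \<le> v m" if m: "x m = 0" for m
  proof -
    have "m \<noteq> z" "\<And>i. m \<noteq> l i" using m empty l(3) by (auto simp: z_def less_le)
    then show ?thesis by (auto simp: v_def intro!: sum_nonneg)
  qed
  then have "0 \<le> v m" if "x m = 0" for m using order_trans[OF _ vk[OF that]] by simp
  ultimately have "\<forall>\<^sub>F t in at_right 0. feasible P (\<lambda>k. x k + t * v k)"
    using x by (intro feasible_perturb) auto
  moreover have "\<forall>\<^sub>F t::real in at_right 0. 0 < t" by (rule eventually_at_right_less)
  ultimately have "\<forall>\<^sub>F t in at_right 0. feasible P (\<lambda>k. x k + t * v k) \<and> 0 < t"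
    by (rule eventually_conj)
  then obtain t where t: "feasible P (\<lambda>k. x k + t * v k)" "0 < t"
    using eventually_happens'[OF trivial_limit_at_right_real] by blast
  have "0 < x k + t * v k" using vk[OF xk] xk t by simp
  then show ?thesis using t by blast
qed

text \<open>At a zero coordinate the entropy has slope \<open>- \<infinity>\<close>, so moving towards a point that is positive there
  decreases it.\<close>

lemma minimizer_positive:
  assumes p: "feasible P p" and min: "\<And>y. feasible P y \<Longrightarrow> L_box P p \<le> L_box P y"
    and y: "feasible P y" and k: "k \<in> Kbar P" "0 < y k"
  shows "0 < p k"
proof (rule ccontr)
  assume "\<not> 0 < p k"
  then have pk: "p k = 0" using p k by (auto simp: feasible_def less_le)
  define S where "S = (\<Sum>l | l \<in> Kbar P \<and> p l = 0. y l)"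
  have S: "0 < S" unfolding S_def
    using k pk y by (intro sum_pos2[of _ k]) (auto simp: feasible_def)
  have zero_part: "(\<Sum>l\<in>Kbar P. if p l = 0 then t * y l * ln t else 0) = t * ln t * S" for t
    unfolding S_def sum_distrib_left sum.inter_filter[OF finite_Kbar]
    by (intro sum.cong) auto
  \<comment> \<open>Chosen such that the gain \<open>t ln t S = - t D\<close> exceeds the linear change of the entropy.\<close>
  define D where "D = \<bar>L_box P y - L_box P p\<bar> + 1"
  define t where "t = exp (- D / S)"
  have t: "0 < t" "t < 1" using S by (auto simp: t_def D_def divide_neg_pos)
  have le: "entropy_term (cfg_fact l) ((1 - t) * p l + t * y l)
      \<le> (1 - t) * entropy_term (cfg_fact l) (p l) + t * entropy_term (cfg_fact l) (y l)
         + (if p l = 0 then t * y l * ln t else 0)" if l: "l \<in> Kbar P" for l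
  proof (cases "p l = 0")
    case True
    then show ?thesis
      using y l t entropy_term_scale[OF _ cfg_fact_pos, of "y l" t l]
      by (simp add: feasible_def) (simp add: entropy_term_def)
  next
    case False
    then show ?thesis
      using y p l t entropy_term_convex[OF _ _ cfg_fact_pos, of "p l" "y l" t l]
      by (simp add: feasible_def)
  qed
  have "L_box P p \<le> L_box P (\<lambda>k. (1 - t) * p k + t * y k)"
    using t p y by (intro min feasible_convex) auto
  also have "\<dots> \<le> (\<Sum>l\<in>Kbar P. (1 - t) * entropy_term (cfg_fact l) (p l)
      + t * entropy_term (cfg_fact l) (y l) + (if p l = 0 then t * y l * ln t else 0))"
    unfolding L_box_entropy by (intro sum_mono le)
  also have "\<dots> = (1 - t) * L_box P p + t * L_box P y + t * ln t * S"
    by (simp add: sum.distrib L_box_entropy zero_part flip: sum_distrib_left)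
  also have "t * ln t * S = - (t * D)" using S by (simp add: t_def)
  finally have "t * L_box P p \<le> t * (L_box P y - D)" by (simp add: algebra_simps)
  then have "L_box P p \<le> L_box P y - D" using t by simp
  then show False unfolding D_def by linarith
qed

text \<open>At a positive point both \<open>v\<close> and \<open>- v\<close> are feasible directions, so the derivative along \<open>v\<close> vanishes.\<close>

lemma minimizer_stationary:
  assumes p: "feasible P p" and min: "\<And>y. feasible P y \<Longrightarrow> L_box P p \<le> L_box P y"
    and pos: "\<And>k. k \<in> Kbar P \<Longrightarrow> 0 < p k"
    and tot: "\<And>s. (\<Sum>k\<in>Kbar_of P s. v k) = 0"
    and ld: "\<And>i. (\<Sum>k\<in>Kbar P. real (fst k i) * v k) = 0"
  shows "(\<Sum>k\<in>Kbar P. ln (p k * cfg_fact k) * v k) = 0"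
proof -
  let ?f = "\<lambda>t. L_box P (\<lambda>k. p k + t * v k)"
  have der: "(?f has_real_derivative (\<Sum>k\<in>Kbar P. ln (p k * cfg_fact k) * v k)) (at 0)"
    unfolding L_box_entropy
  proof (rule DERIV_sum)
    fix k assume k: "k \<in> Kbar P"
    show "((\<lambda>t. entropy_term (cfg_fact k) (p k + t * v k)) has_real_derivative
        ln (p k * cfg_fact k) * v k) (at 0)"
      unfolding entropy_term_def
      by (rule derivative_eq_intros refl | use pos[OF k] cfg_fact_pos[of k] in
          \<open>simp add: ln_mult ln_div field_simps\<close>)+
  qed
  have "\<forall>\<^sub>F t in at_right 0. feasible P (\<lambda>k. p k + t * v k)"
    using pos by (intro feasible_perturb p tot ld) force
  moreover have "\<forall>\<^sub>F t in at_right 0. feasible P (\<lambda>k. p k + t * (- v k))"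
    using pos by (intro feasible_perturb p) (force simp: sum_negf tot ld)+
  ultimately have "\<forall>\<^sub>F t in at_right 0. feasible P (\<lambda>k. p k + t * v k) \<and> feasible P (\<lambda>k. p k + t * (- v k))"
    by (rule eventually_conj)
  then obtain d where d: "0 < d"
    "\<And>t. 0 < t \<Longrightarrow> t < d \<Longrightarrow> feasible P (\<lambda>k. p k + t * v k) \<and> feasible P (\<lambda>k. p k + t * (- v k))"
    unfolding eventually_at_right_field by auto
  have "?f 0 \<le> ?f t" if "\<bar>0 - t\<bar> < d" for t
  proof (cases t "0::real" rule: linorder_cases)
    case less
    then show ?thesis using min d(2)[of "- t"] that by simp
  next
    case greater
    then show ?thesis using min d(2)[of t] that by simp
  qed simp
  then show ?thesis using DERIV_local_min[OF der d(1)] by blast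
qed

text \<open>For two edges of type \<open>i\<close>, mass is moved up along one and down along the other. Stationarity in this
  direction equates the ratios \<open>R\<close> of the two edges; their common value follows by summing over all edges
  of type \<open>i\<close>, since the load is given.\<close>

lemma minimizer_balance:
  assumes p: "feasible P p" and min: "\<And>y. feasible P y \<Longrightarrow> L_box P p \<le> L_box P y"
    and pos: "\<And>k. k \<in> Kbar P \<Longrightarrow> 0 < p k"
    and k: "k \<in> fit_set P i"
  shows "service_rate P i * real (fst k i + 1) * p (add_cust i k) = arrival_rate P i * p k / fit_mass P i p"
proof -
  define R where "R = (\<lambda>k. real (fst k i + 1) * p (add_cust i k) / p k)"
  have R: "R l = R k" if l: "l \<in> fit_set P i" for l
  proof -
    define v :: "('i, 's) config \<Rightarrow> real" where
      "v = (\<lambda>m. of_bool (m = add_cust i k) - of_bool (m = k) - of_bool (m = add_cust i l) + of_bool (m = l))"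
    have in_K: "k \<in> Kbar P" "add_cust i k \<in> Kbar P" "l \<in> Kbar P" "add_cust i l \<in> Kbar P"
      using k l by (auto simp: fit_set_eq)
    have sum_v: "(\<Sum>m\<in>Kbar P. f m * v m) = f (add_cust i k) - f k - f (add_cust i l) + f l" for f
      unfolding v_def distrib_left right_diff_distrib sum.distrib sum_subtractf
      by (simp add: sum_unit in_K)
    have "(\<Sum>m\<in>Kbar_of P s. v m) = 0" for s
      unfolding v_def by (simp add: sum.distrib sum_subtractf sum_unit in_K)
    moreover have "(\<Sum>m\<in>Kbar P. real (fst m j) * v m) = 0" for j
      unfolding sum_v by (simp add: fst_add_cust)
    ultimately have "(\<Sum>m\<in>Kbar P. ln (p m * cfg_fact m) * v m) = 0"
      by (intro minimizer_stationary p min pos)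
    then have "ln (p (add_cust i k) * cfg_fact (add_cust i k)) - ln (p k * cfg_fact k)
      = ln (p (add_cust i l) * cfg_fact (add_cust i l)) - ln (p l * cfg_fact l)"
      unfolding sum_v by simp
    moreover have "ln (p (add_cust i m) * cfg_fact (add_cust i m)) - ln (p m * cfg_fact m) = ln (R m)"
      if m: "m \<in> Kbar P" "add_cust i m \<in> Kbar P" for m
      using pos[OF m(1)] pos[OF m(2)] cfg_fact_pos[of m]
      by (simp add: R_def cfg_fact_add ln_mult ln_div)
    moreover have "0 < R m" if m: "m \<in> Kbar P" "add_cust i m \<in> Kbar P" for m
      using pos[OF m(1)] pos[OF m(2)] by (simp add: R_def)
    ultimately show ?thesis using in_K by simp
  qed
  have eq: "real (fst l i + 1) * p (add_cust i l) = R k * p l" if l: "l \<in> fit_set P i" for l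
    using R[OF l] pos[of l] l by (simp add: R_def fit_set_eq field_simps)
  have "load P i = (\<Sum>m\<in>Kbar P. real (fst m i) * p m)" using p by (simp add: feasible_def)
  also have "\<dots> = (\<Sum>m | m \<in> Kbar P \<and> 1 \<le> fst m i. real (fst m i) * p m)"
    by (rule sum.mono_neutral_right) (auto simp: Suc_le_eq)
  also have "\<dots> = (\<Sum>l\<in>fit_set P i. real (fst l i + 1) * p (add_cust i l))"
    unfolding sum_upper_end by (simp add: fst_add_cust)
  also have "\<dots> = (\<Sum>l\<in>fit_set P i. R k * p l)"
    by (intro sum.cong refl eq)
  also have "\<dots> = R k * fit_mass P i p"
    by (simp add: fit_mass_def sum_distrib_left)
  finally have ld: "load P i = R k * fit_mass P i p" .
  have fm: "0 < fit_mass P i p" unfolding fit_mass_def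
    using pos fit_set_nonempty by (intro sum_pos) (auto simp: fit_set_eq)
  have "service_rate P i * (real (fst k i + 1) * p (add_cust i k)) = service_rate P i * load P i * p k / fit_mass P i p"
    unfolding eq[OF k] ld using fm by simp
  then show ?thesis using service_rate_pos[of i] by (simp add: load_def mult_ac)
qed

end

section \<open>Dissipation near the equilibrium\<close>

text \<open>Balancing the derivative of the Lyapunov function. Here \<open>g\<close>, \<open>s\<close>, \<open>y\<close> are the norms of the imbalances, of
  the deviation and of the load deviation. The coercivity \<open>s \<le> A (g + y)\<close> lets \<open>g\<^sup>2\<close> dominate \<open>s\<^sup>2\<close> up to a
  multiple of \<open>y\<^sup>2\<close>; the mixed terms are split by the inequality between the arithmetic and the
  geometric mean, and \<open>b\<close> is taken large enough for the weighted decay of \<open>y\<^sup>2\<close> to pay for all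
  multiples of \<open>y\<^sup>2\<close>.\<close>

lemma dissipation_constants:
  fixes A C D m :: real
  assumes "0 < A" "0 \<le> C" "0 \<le> D" "0 < m"
  obtains h b c where "0 < h" "0 < b" "0 < c"
    "\<And>g s y. 0 \<le> g \<Longrightarrow> 0 \<le> s \<Longrightarrow> 0 \<le> y \<Longrightarrow> s \<le> A * (g + y) \<Longrightarrow>
       - g\<^sup>2 + C * s * y + D * h * g * s - 2 * b * m * y\<^sup>2 \<le> - c * (s\<^sup>2 / 2 + b * y\<^sup>2)"
proof -
  define e where "e = 1 / (8 * A\<^sup>2)"
  define h where "h = sqrt e / (D + 1)"
  define b where "b = (1/2 + C\<^sup>2 / (2 * e)) / m"
  define c where "c = min (2 * e) m"
  have e: "0 < e" using assms by (simp add: e_def)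
  have h: "0 < h" using e assms by (simp add: h_def)
  have num: "0 < 1/2 + C\<^sup>2 / (2 * e)" using e by (intro add_pos_nonneg) auto
  then have b: "0 < b" unfolding b_def using assms by (intro divide_pos_pos)
  have c: "0 < c" using e assms by (simp add: c_def)
  have bm: "b * m = 1/2 + C\<^sup>2 / (2 * e)" using assms by (simp add: b_def)
  have "D * h \<le> sqrt e"
    unfolding h_def using assms e by (simp add: divide_simps mult_right_mono)
  then have "(D * h)\<^sup>2 \<le> (sqrt e)\<^sup>2" using assms h by (intro power_mono) auto
  then have Dh: "(D * h)\<^sup>2 \<le> e" using e by simp
  show thesis
  proof (rule that[OF h b c])
    fix g s y :: real
    assume nn: "0 \<le> g" "0 \<le> s" "0 \<le> y" and s: "s \<le> A * (g + y)"
    have "s\<^sup>2 \<le> (A * (g + y))\<^sup>2" using nn s by (intro power_mono) auto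
    also have "\<dots> = A\<^sup>2 * (g + y)\<^sup>2" by (simp add: power_mult_distrib)
    also have "\<dots> \<le> A\<^sup>2 * (2 * (g\<^sup>2 + y\<^sup>2))"
      using sum_squares_bound[of g y]
      by (intro mult_left_mono) (auto simp: power2_eq_square algebra_simps)
    finally have "s\<^sup>2 * (1 / (2 * A\<^sup>2)) \<le> A\<^sup>2 * (2 * (g\<^sup>2 + y\<^sup>2)) * (1 / (2 * A\<^sup>2))"
      by (intro mult_right_mono) auto
    also have "\<dots> = g\<^sup>2 + y\<^sup>2" using assms by simp
    finally have 1: "4 * (e * s\<^sup>2) \<le> g\<^sup>2 + y\<^sup>2" by (simp add: e_def)
    have "2 * (g * (D * h * s)) \<le> g\<^sup>2 + (D * h * s)\<^sup>2"
      using sum_squares_bound[of g "D * h * s"] by simp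
    also have "(D * h * s)\<^sup>2 \<le> e * s\<^sup>2"
      using Dh by (simp add: power_mult_distrib mult_right_mono)
    finally have 2: "2 * (D * h * g * s) \<le> g\<^sup>2 + e * s\<^sup>2" by (simp add: mult_ac)
    define Q where "Q = C\<^sup>2 / e * y\<^sup>2"
    have "2 * (e * s) * (C * y) \<le> (e * s)\<^sup>2 + (C * y)\<^sup>2" by (rule sum_squares_bound)
    then have "(2 * (e * s) * (C * y)) / e \<le> ((e * s)\<^sup>2 + (C * y)\<^sup>2) / e"
      using e by (intro divide_right_mono) auto
    then have 3: "2 * (C * s * y) \<le> e * s\<^sup>2 + Q"
      using e by (simp add: Q_def add_divide_distrib power_mult_distrib power2_eq_square mult_ac)
    have "2 * b * m * y\<^sup>2 = m * (b * y\<^sup>2) + (1/2 + C\<^sup>2 / (2 * e)) * y\<^sup>2"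
      unfolding bm[symmetric] by simp
    also have "\<dots> = m * (b * y\<^sup>2) + y\<^sup>2 / 2 + Q / 2"
      by (simp add: Q_def distrib_right)
    finally have 4: "2 * b * m * y\<^sup>2 = m * (b * y\<^sup>2) + y\<^sup>2 / 2 + Q / 2" .
    have "- g\<^sup>2 + C * s * y + D * h * g * s - 2 * b * m * y\<^sup>2 \<le> - (e * s\<^sup>2) - m * (b * y\<^sup>2)"
      using 1 2 3 unfolding 4 by linarith
    also have "\<dots> \<le> - c * (s\<^sup>2 / 2 + b * y\<^sup>2)"
    proof -
      have "c * (s\<^sup>2 / 2) \<le> 2 * e * (s\<^sup>2 / 2)" by (intro mult_right_mono) (auto simp: c_def)
      moreover have "c * (b * y\<^sup>2) \<le> m * (b * y\<^sup>2)"
        using b by (intro mult_right_mono) (auto simp: c_def)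
      ultimately show ?thesis by (simp add: algebra_simps)
    qed
    finally show "- g\<^sup>2 + C * s * y + D * h * g * s - 2 * b * m * y\<^sup>2 \<le> - c * (s\<^sup>2 / 2 + b * y\<^sup>2)" .
  qed
qed

lemma abs_le_sqrt_weighted_sum:
  fixes f w :: "'a \<Rightarrow> real"
  assumes "finite A" "x \<in> A" "0 < m" "\<And>y. y \<in> A \<Longrightarrow> m \<le> w y"
  shows "\<bar>f x\<bar> \<le> (1 / sqrt m) * sqrt (\<Sum>y\<in>A. w y * (f y)\<^sup>2)"
proof -
  have w: "0 \<le> w y" if "y \<in> A" for y using assms(3) assms(4)[OF that] by simp
  have "m * (f x)\<^sup>2 \<le> w x * (f x)\<^sup>2" using assms by (intro mult_right_mono) auto
  also have "\<dots> \<le> (\<Sum>y\<in>A. w y * (f y)\<^sup>2)"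
    using assms(1,2) w by (intro member_le_sum) auto
  finally have "sqrt (m * (f x)\<^sup>2) \<le> sqrt (\<Sum>y\<in>A. w y * (f y)\<^sup>2)" by (rule real_sqrt_le_mono)
  then show ?thesis using assms(3) by (simp add: real_sqrt_mult field_simps)
qed

lemma abs_sum_le:
  fixes f g :: "'a \<Rightarrow> real"
  shows "(\<And>x. x \<in> A \<Longrightarrow> \<bar>f x\<bar> \<le> g x) \<Longrightarrow> \<bar>\<Sum>x\<in>A. f x\<bar> \<le> (\<Sum>x\<in>A. g x)"
  by (rule order_trans[OF sum_abs sum_mono])

lemma finite_positive_lower_bound:
  fixes f :: "'a \<Rightarrow> real"
  assumes "finite A" "\<And>x. x \<in> A \<Longrightarrow> 0 < f x"
  obtains m where "0 < m" "\<And>x. x \<in> A \<Longrightarrow> m \<le> f x"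
proof (rule that)
  show "0 < Min (insert 1 (f ` A))" using assms by (subst Min_gr_iff) auto
  show "Min (insert 1 (f ` A)) \<le> f x" if "x \<in> A" for x using assms that by (intro Min_le) auto
qed

locale equilibrium = finite_server_system P
  for P :: "('i::finite, 's::finite) server_system" +
  fixes p :: "('i, 's) config \<Rightarrow> real"
  assumes p_pos: "\<And>k. k \<in> Kbar P \<Longrightarrow> 0 < p k"
    and p_feasible: "feasible P p"
    and p_balance: "\<And>i k. k \<in> fit_set P i \<Longrightarrow>
      service_rate P i * real (fst k i + 1) * p (add_cust i k) = arrival_rate P i * p k / fit_mass P i p"
begin

text \<open>Below, \<open>u\<close> stands for a relative deviation, so that the state is \<open>scaled u\<close>, that is \<open>p\<^sub>k (1 + u\<^sub>k)\<close>.\<close>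

definition flow :: "'i \<Rightarrow> ('i, 's) config \<Rightarrow> real" where
  "flow i k = arrival_rate P i * p k / fit_mass P i p"

definition fit_dev :: "'i \<Rightarrow> (('i, 's) config \<Rightarrow> real) \<Rightarrow> real" where
  "fit_dev i u = (\<Sum>k\<in>fit_set P i. p k * u k) / fit_mass P i p"

definition load_dev :: "'i \<Rightarrow> (('i, 's) config \<Rightarrow> real) \<Rightarrow> real" where
  "load_dev i u = (\<Sum>k\<in>Kbar P. real (fst k i) * (p k * u k)) / load P i"

text \<open>This is \<open>1 - 1 / (1 + fit_dev i u)\<close>: the relative loss of the arrival rate per available server.\<close>

definition fit_shift :: "'i \<Rightarrow> (('i, 's) config \<Rightarrow> real) \<Rightarrow> real" where
  "fit_shift i u = fit_dev i u / (1 + fit_dev i u)"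

definition net_flow :: "'i \<Rightarrow> ('i, 's) config \<Rightarrow> (('i, 's) config \<Rightarrow> real) \<Rightarrow> real" where
  "net_flow i k x = arrival_rate P i * x k / fit_mass P i x
     - service_rate P i * real (fst k i + 1) * x (add_cust i k)"

text \<open>The net downward flow along the edge, relative to the stationary flow; see \<open>net_flow_scaled\<close>.\<close>

definition imbalance :: "'i \<Rightarrow> ('i, 's) config \<Rightarrow> (('i, 's) config \<Rightarrow> real) \<Rightarrow> real" where
  "imbalance i k u = 1 + u (add_cust i k) - (1 - fit_shift i u) * (1 + u k)"

definition scaled :: "(('i, 's) config \<Rightarrow> real) \<Rightarrow> ('i, 's) config \<Rightarrow> real" where
  "scaled u k = p k * (1 + u k)"

lemma fit_mass_pos: "0 < fit_mass P i p"
  unfolding fit_mass_def using p_pos fit_set_nonempty by (intro sum_pos) (auto simp: fit_set_eq)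

lemma fit_mass_scaled: "fit_mass P i (scaled u) = fit_mass P i p * (1 + fit_dev i u)"
  using fit_mass_pos[of i]
  by (simp add: fit_dev_def scaled_def fit_mass_def distrib_left sum.distrib)

lemma flow_pos: "k \<in> fit_set P i \<Longrightarrow> 0 < flow i k"
  unfolding flow_def using p_pos[OF fit_set_Kbar] fit_mass_pos arrival_rate_pos by simp

lemma sum_flow: "(\<Sum>k\<in>fit_set P i. flow i k) = arrival_rate P i"
  using fit_mass_pos[of i]
  by (simp add: flow_def fit_mass_def flip: sum_divide_distrib sum_distrib_left)

lemma flow_balance: "k \<in> fit_set P i \<Longrightarrow>
    flow i k = service_rate P i * real (fst k i + 1) * p (add_cust i k)"
  unfolding flow_def by (rule p_balance[symmetric])

lemma net_flow_scaled:
  assumes "k \<in> fit_set P i" "0 < 1 + fit_dev i u"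
  shows "net_flow i k (scaled u) = - (flow i k * imbalance i k u)"
proof -
  have sh: "1 - fit_shift i u = 1 / (1 + fit_dev i u)"
    using assms(2) by (simp add: fit_shift_def field_simps)
  have "arrival_rate P i * scaled u k / fit_mass P i (scaled u) = flow i k * ((1 - fit_shift i u) * (1 + u k))"
    unfolding fit_mass_scaled sh by (simp add: scaled_def flow_def)
  moreover have "service_rate P i * real (fst k i + 1) * scaled u (add_cust i k)
      = flow i k * (1 + u (add_cust i k))"
    unfolding flow_balance[OF assms(1)] by (simp add: scaled_def)
  ultimately show ?thesis unfolding net_flow_def imbalance_def by (simp add: algebra_simps)
qed

lemma load_eq: "(\<Sum>k\<in>Kbar P. real (fst k i) * p k) = load P i"
  using p_feasible by (simp add: feasible_def)

lemma sum_flow_upper: "(\<Sum>k\<in>fit_set P i. flow i k * f (add_cust i k))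
    = service_rate P i * (\<Sum>k\<in>Kbar P. real (fst k i) * (p k * f k))"
proof -
  have "(\<Sum>k\<in>Kbar P. real (fst k i) * (p k * f k))
      = (\<Sum>k | k \<in> Kbar P \<and> 1 \<le> fst k i. real (fst k i) * (p k * f k))"
    by (rule sum.mono_neutral_right) (auto simp: Suc_le_eq)
  also have "\<dots> = (\<Sum>k\<in>fit_set P i. real (fst k i + 1) * (p (add_cust i k) * f (add_cust i k)))"
    unfolding sum_upper_end by (simp add: fst_add_cust)
  finally show ?thesis
    by (simp only: sum_distrib_left) (intro sum.cong refl, simp add: flow_balance)
qed

text \<open>All type-\<open>i\<close> arrivals are placed somewhere, so the total net flow of type \<open>i\<close> is \<open>\<lambda>\<^sub>i\<close> minus the total
  departure rate, whatever the placement.\<close>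

lemma sum_imbalance:
  assumes "0 < 1 + fit_dev i u"
  shows "(\<Sum>k\<in>fit_set P i. flow i k * imbalance i k u) = arrival_rate P i * load_dev i u"
proof -
  have sh: "1 - fit_shift i u = 1 / (1 + fit_dev i u)"
    using assms by (simp add: fit_shift_def field_simps)
  have ld: "service_rate P i * load P i = arrival_rate P i"
    using service_rate_pos[of i] by (simp add: load_def)
  have up: "(\<Sum>k\<in>fit_set P i. flow i k * u (add_cust i k)) = arrival_rate P i * load_dev i u"
    unfolding sum_flow_upper load_dev_def ld[symmetric] using load_pos[of i] by simp
  have "(\<Sum>k\<in>fit_set P i. flow i k * u k) = arrival_rate P i * fit_dev i u"
    by (simp add: flow_def fit_dev_def sum_distrib_left sum_divide_distrib mult_ac)
  then have low: "(\<Sum>k\<in>fit_set P i. flow i k * (1 + u k)) = arrival_rate P i * (1 + fit_dev i u)"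
    by (simp add: distrib_left sum.distrib sum_flow)
  have "(\<Sum>k\<in>fit_set P i. flow i k * imbalance i k u)
     = (\<Sum>k\<in>fit_set P i. flow i k) + (\<Sum>k\<in>fit_set P i. flow i k * u (add_cust i k))
        - (1 - fit_shift i u) * (\<Sum>k\<in>fit_set P i. flow i k * (1 + u k))"
    unfolding imbalance_def sum_distrib_left sum.distrib[symmetric] sum_subtractf[symmetric]
    by (intro sum.cong refl) (simp add: algebra_simps)
  also have "\<dots> = arrival_rate P i * load_dev i u"
    unfolding up low sh sum_flow using assms by simp
  finally show ?thesis .
qed

text \<open>The left side is the derivative of half the energy. Along an edge, \<open>u\<close> increases by the imbalance
  minus \<open>fit_shift i u * (1 + u k)\<close>; the constant part of the second term sums to the load deviation by
  \<open>sum_imbalance\<close>, and its variable part is of third order.\<close>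

lemma dissipation_identity:
  assumes "\<And>i. 0 < 1 + fit_dev i u"
  shows "(\<Sum>i\<in>UNIV. \<Sum>k\<in>fit_set P i. (u (add_cust i k) - u k) * net_flow i k (scaled u))
    = - (\<Sum>i\<in>UNIV. \<Sum>k\<in>fit_set P i. flow i k * (imbalance i k u)\<^sup>2)
      + (\<Sum>i\<in>UNIV. fit_shift i u * (arrival_rate P i * load_dev i u))
      + (\<Sum>i\<in>UNIV. \<Sum>k\<in>fit_set P i. flow i k * imbalance i k u * (fit_shift i u * u k))"
proof -
  have "(\<Sum>k\<in>fit_set P i. (u (add_cust i k) - u k) * net_flow i k (scaled u))
     = - (\<Sum>k\<in>fit_set P i. flow i k * (imbalance i k u)\<^sup>2)
       + fit_shift i u * (arrival_rate P i * load_dev i u)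
       + (\<Sum>k\<in>fit_set P i. flow i k * imbalance i k u * (fit_shift i u * u k))" for i
  proof -
    have "(u (add_cust i k) - u k) * net_flow i k (scaled u)
        = - (flow i k * (imbalance i k u)\<^sup>2) + fit_shift i u * (flow i k * imbalance i k u)
          + flow i k * imbalance i k u * (fit_shift i u * u k)" if k: "k \<in> fit_set P i" for k
    proof -
      have diff: "u (add_cust i k) - u k = imbalance i k u - fit_shift i u * (1 + u k)"
        by (simp add: imbalance_def algebra_simps)
      show ?thesis unfolding diff net_flow_scaled[OF k assms]
        by (simp add: algebra_simps power2_eq_square)
    qed
    then have "(\<Sum>k\<in>fit_set P i. (u (add_cust i k) - u k) * net_flow i k (scaled u))
      = (\<Sum>k\<in>fit_set P i. - (flow i k * (imbalance i k u)\<^sup>2) + fit_shift i u * (flow i k * imbalance i k u)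
          + flow i k * imbalance i k u * (fit_shift i u * u k))"
      by (intro sum.cong refl)
    then show ?thesis
      unfolding sum.distrib sum_negf sum_imbalance[OF assms, symmetric] sum_distrib_left[symmetric] .
  qed
  then have "(\<Sum>i\<in>UNIV. \<Sum>k\<in>fit_set P i. (u (add_cust i k) - u k) * net_flow i k (scaled u))
    = (\<Sum>i\<in>UNIV. - (\<Sum>k\<in>fit_set P i. flow i k * (imbalance i k u)\<^sup>2)
       + fit_shift i u * (arrival_rate P i * load_dev i u)
       + (\<Sum>k\<in>fit_set P i. flow i k * imbalance i k u * (fit_shift i u * u k)))"
    by (intro sum.cong refl)
  then show ?thesis unfolding sum.distrib sum_negf .
qed

text \<open>The failure of \<open>u\<close> to be affine in the occupancy vector with slopes \<open>- fit_shift i u\<close>. Along each edge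
  it changes only by the imbalance and a second-order term, so it is controlled by summing along a path
  from the empty server.\<close>

definition path_rest :: "(('i, 's) config \<Rightarrow> real) \<Rightarrow> ('i, 's) config \<Rightarrow> real" where
  "path_rest u k = u k - u (zero_cfg (snd k)) + (\<Sum>i\<in>UNIV. real (fst k i) * fit_shift i u)"

lemma path_rest_zero: "path_rest u (zero_cfg s) = 0"
  by (simp add: path_rest_def)

lemma path_rest_add:
  "path_rest u (add_cust i k) = path_rest u k + (imbalance i k u - fit_shift i u * u k)"
proof -
  have "(\<Sum>j\<in>UNIV. real (fst (add_cust i k) j) * fit_shift j u)
      = (\<Sum>j\<in>UNIV. real (fst k j) * fit_shift j u + (if j = i then fit_shift i u else 0))"
    by (intro sum.cong) (auto simp: fst_add_cust algebra_simps)
  then show ?thesis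
    by (simp add: path_rest_def imbalance_def sum.distrib algebra_simps)
qed

lemma path_rest_bound:
  assumes M: "\<And>i k. k \<in> fit_set P i \<Longrightarrow> \<bar>imbalance i k u - fit_shift i u * u k\<bar> \<le> M"
    and k: "k \<in> Kbar P"
  shows "\<bar>path_rest u k\<bar> \<le> (\<Sum>i\<in>UNIV. real (fst k i)) * M"
  using k
proof (induction "\<Sum>i\<in>UNIV. fst k i" arbitrary: k rule: less_induct)
  case (less k)
  show ?case
  proof (cases "k = zero_cfg (snd k)")
    case True
    then show ?thesis using path_rest_zero[of u "snd k"] config_eq_zero_iff[of k] by simp
  next
    case False
    then obtain i where i: "1 \<le> fst k i"
      unfolding config_eq_zero_iff by (auto simp: Suc_le_eq)
    define l where "l = rem_cust i k"
    have k_eq: "k = add_cust i l" using i by (simp add: l_def add_rem_cust)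
    have l: "l \<in> fit_set P i" using less.prems unfolding k_eq by (rule add_in_Kbar_fit)
    have sum_k: "(\<Sum>j\<in>UNIV. fst k j) = Suc (\<Sum>j\<in>UNIV. fst l j)"
      unfolding k_eq by (simp add: fst_add_cust sum.distrib)
    have "\<bar>path_rest u l\<bar> \<le> (\<Sum>j\<in>UNIV. real (fst l j)) * M"
      using sum_k fit_set_Kbar[OF l] by (intro less.hyps) auto
    moreover have "\<bar>path_rest u k\<bar> \<le> \<bar>path_rest u l\<bar> + M"
      using M[OF l] unfolding k_eq path_rest_add by linarith
    moreover have "(\<Sum>j\<in>UNIV. real (fst k j)) = (\<Sum>j\<in>UNIV. real (fst l j)) + 1"
      using sum_k by (simp flip: of_nat_sum)
    ultimately show ?thesis by (simp add: algebra_simps)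
  qed
qed

text \<open>Coercivity: the affine part of \<open>u\<close> is orthogonal to \<open>u\<close> with weights \<open>p\<close> up to the load deviation. The
  constant term drops out because the number of servers of each type is fixed, and the linear terms
  pair with \<open>u\<close> to the load deviations.\<close>

lemma energy_identity:
  assumes bal: "\<And>s. (\<Sum>k\<in>Kbar_of P s. p k * u k) = 0"
  shows "(\<Sum>k\<in>Kbar P. p k * (u k)\<^sup>2)
    = (\<Sum>k\<in>Kbar P. p k * u k * path_rest u k) - (\<Sum>i\<in>UNIV. fit_shift i u * (load P i * load_dev i u))"
proof -
  have "p k * u k * path_rest u k = p k * (u k)\<^sup>2 - u (zero_cfg (snd k)) * (p k * u k)
     + (\<Sum>i\<in>UNIV. fit_shift i u * (real (fst k i) * (p k * u k)))" for k
    unfolding path_rest_def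
    by (simp add: distrib_left right_diff_distrib sum_distrib_left power2_eq_square mult_ac)
  then have "(\<Sum>k\<in>Kbar P. p k * u k * path_rest u k)
     = (\<Sum>k\<in>Kbar P. p k * (u k)\<^sup>2) - (\<Sum>k\<in>Kbar P. u (zero_cfg (snd k)) * (p k * u k))
       + (\<Sum>k\<in>Kbar P. \<Sum>i\<in>UNIV. fit_shift i u * (real (fst k i) * (p k * u k)))"
    by (simp add: sum.distrib sum_subtractf)
  also have "(\<Sum>k\<in>Kbar P. u (zero_cfg (snd k)) * (p k * u k)) = 0"
  proof -
    have "(\<Sum>k\<in>Kbar_of P s. u (zero_cfg (snd k)) * (p k * u k)) = u (zero_cfg s) * (\<Sum>k\<in>Kbar_of P s. p k * u k)" for s
      unfolding sum_distrib_left by (rule sum.cong) (auto simp: Kbar_of_def)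
    then show ?thesis by (simp add: sum_Kbar_of bal)
  qed
  also have "(\<Sum>k\<in>Kbar P. \<Sum>i\<in>UNIV. fit_shift i u * (real (fst k i) * (p k * u k)))
      = (\<Sum>i\<in>UNIV. fit_shift i u * (load P i * load_dev i u))"
    using load_pos by (subst sum.swap) (simp add: load_dev_def less_imp_neq[symmetric] flip: sum_distrib_left)
  finally show ?thesis by simp
qed


lemma fit_dev_bound:
  assumes "\<And>k. k \<in> Kbar P \<Longrightarrow> \<bar>u k\<bar> \<le> h"
  shows "\<bar>fit_dev i u\<bar> \<le> h"
proof -
  have "\<bar>\<Sum>k\<in>fit_set P i. p k * u k\<bar> \<le> (\<Sum>k\<in>fit_set P i. p k * h)"
  proof (rule abs_sum_le)
    show "\<bar>p k * u k\<bar> \<le> p k * h" if "k \<in> fit_set P i" for k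
      using assms[OF fit_set_Kbar[OF that]] p_pos[OF fit_set_Kbar[OF that]]
      by (simp add: abs_mult)
  qed
  also have "\<dots> = fit_mass P i p * h" by (simp add: fit_mass_def sum_distrib_right)
  finally show ?thesis using fit_mass_pos[of i]
    by (simp add: fit_dev_def abs_divide field_simps)
qed

lemma shift_bound:
  assumes "\<bar>fit_dev i u\<bar> \<le> 1/2"
  shows "\<bar>fit_shift i u\<bar> \<le> 2 * \<bar>fit_dev i u\<bar>"
proof -
  have "\<bar>fit_dev i u\<bar> * 1 \<le> \<bar>fit_dev i u\<bar> * (2 * (1 + fit_dev i u))"
    using assms by (intro mult_left_mono) auto
  moreover have "0 < 1 + fit_dev i u" using assms by linarith
  ultimately show ?thesis by (simp add: fit_shift_def abs_divide pos_divide_le_eq algebra_simps)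
qed

definition energy :: "(('i, 's) config \<Rightarrow> real) \<Rightarrow> real" where
  "energy u = (\<Sum>k\<in>Kbar P. p k * (u k)\<^sup>2)"

definition load_energy :: "(('i, 's) config \<Rightarrow> real) \<Rightarrow> real" where
  "load_energy u = (\<Sum>i\<in>UNIV. (load_dev i u)\<^sup>2)"

lemma energy_nonneg: "0 \<le> energy u"
  unfolding energy_def using p_pos
  by (intro sum_nonneg mult_nonneg_nonneg zero_le_power2) (blast intro: less_imp_le)

lemma load_energy_nonneg: "0 \<le> load_energy u"
  unfolding load_energy_def by (intro sum_nonneg) auto

lemma load_dev_bound: "\<bar>load_dev i u\<bar> \<le> sqrt (load_energy u)"
proof -
  have "(load_dev i u)\<^sup>2 \<le> load_energy u"
    unfolding load_energy_def by (intro member_le_sum) auto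
  then show ?thesis by (rule real_le_rsqrt[OF _, of "\<bar>load_dev i u\<bar>", simplified])
qed

text \<open>For every state with the given numbers of servers within relative distance \<open>h\<close> of the equilibrium, the drift of
  \<open>energy u / 2 + b * load_energy u\<close> is at most \<open>- c\<close> times this quantity. The left side is the
  drift; see \<open>lyapunov_derivative\<close>.\<close>

definition dissipative :: "real \<Rightarrow> real \<Rightarrow> real \<Rightarrow> bool" where
  "dissipative h b c \<longleftrightarrow> (\<forall>u. (\<forall>s. (\<Sum>k\<in>Kbar_of P s. p k * u k) = 0) \<longrightarrow> (\<forall>k\<in>Kbar P. \<bar>u k\<bar> \<le> h) \<longrightarrow>
     (\<Sum>i\<in>UNIV. \<Sum>k\<in>fit_set P i. (u (add_cust i k) - u k) * net_flow i k (scaled u))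
       - 2 * b * (\<Sum>i\<in>UNIV. service_rate P i * (load_dev i u)\<^sup>2)
     \<le> - c * (energy u / 2 + b * load_energy u))"

text \<open>All sup-norm bounds are expressed by the three norms \<open>g\<close>, \<open>s\<close>, \<open>y\<close>: then \<open>energy_identity\<close> gives the
  coercivity and \<open>dissipation_identity\<close> the drift in the form that \<open>dissipation_constants\<close> treats.\<close>

lemma dissipative_near_equilibrium:
  obtains h b c where "0 < h" "h \<le> 1/2" "0 < b" "0 < c" "dissipative h b c"
proof -
  obtain m where m: "0 < m" "\<And>k. k \<in> Kbar P \<Longrightarrow> m \<le> p k"
    using finite_positive_lower_bound[of "Kbar P" p] p_pos by auto
  let ?E = "SIGMA i:UNIV. fit_set P i"
  obtain q where q: "0 < q" "\<And>e. e \<in> ?E \<Longrightarrow> q \<le> (case e of (i, k) \<Rightarrow> flow i k)"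
  proof (rule finite_positive_lower_bound[of ?E "\<lambda>(i, k). flow i k"])
    show "0 < (case e of (i, k) \<Rightarrow> flow i k)" if "e \<in> ?E" for e
      using that flow_pos by auto
  qed auto
  obtain m0 where m0: "0 < m0" "\<And>i. m0 \<le> service_rate P i"
    using finite_positive_lower_bound[of UNIV "service_rate P"] service_rate_pos by auto
  define c1 where "c1 = 1 / sqrt m"
  define c2 where "c2 = 1 / sqrt q"
  have c12: "0 < c1" "0 < c2" using m q by (auto simp: c1_def c2_def)
  define La where "La = (\<Sum>i\<in>UNIV. arrival_rate P i)"
  have La: "0 \<le> La" unfolding La_def using arrival_rate_pos by (intro sum_nonneg less_imp_le)
  define A where "A = 2 * c1 * c2 + 4 * c1"
  obtain h0 b c where hbc: "0 < h0" "0 < b" "0 < c"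
    "\<And>g s y. 0 \<le> g \<Longrightarrow> 0 \<le> s \<Longrightarrow> 0 \<le> y \<Longrightarrow> s \<le> A * (g + y) \<Longrightarrow>
       - g\<^sup>2 + (2 * c1 * La) * s * y + (2 * c1 * c2 * La) * h0 * g * s - 2 * b * m0 * y\<^sup>2
         \<le> - c * (s\<^sup>2 / 2 + b * y\<^sup>2)"
  proof (rule dissipation_constants[of A "2 * c1 * La" "2 * c1 * c2 * La" m0])
    show "0 < A" using c12 by (auto simp: A_def intro!: add_pos_pos mult_pos_pos)
  qed (use c12 La m0 in auto)
  \<comment> \<open>The last bound makes the second-order part of \<open>path_rest\<close> contribute at most \<open>s / 2\<close> below.\<close>
  define h where "h = min h0 (min (1/2) (1 / (4 * c1\<^sup>2)))"
  have h: "0 < h" "h \<le> 1/2" "h \<le> h0" "2 * c1\<^sup>2 * h \<le> 1/2"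
  proof -
    show "0 < h" "h \<le> 1/2" "h \<le> h0" using hbc c12 by (auto simp: h_def)
    have "2 * c1\<^sup>2 * h \<le> 2 * c1\<^sup>2 * (1 / (4 * c1\<^sup>2))"
      by (intro mult_left_mono) (auto simp: h_def)
    then show "2 * c1\<^sup>2 * h \<le> 1/2" using c12 by simp
  qed
  show thesis
  proof (rule that[OF h(1,2) hbc(2,3)], unfold dissipative_def, intro allI impI)
    fix u
    assume "\<forall>s. (\<Sum>k\<in>Kbar_of P s. p k * u k) = 0" "\<forall>k\<in>Kbar P. \<bar>u k\<bar> \<le> h"
    then have bal: "\<And>s. (\<Sum>k\<in>Kbar_of P s. p k * u k) = 0"
      and uh: "\<And>k. k \<in> Kbar P \<Longrightarrow> \<bar>u k\<bar> \<le> h" by blast+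
    define s where "s = sqrt (energy u)"
    define G where "G = (\<Sum>i\<in>UNIV. \<Sum>k\<in>fit_set P i. flow i k * (imbalance i k u)\<^sup>2)"
    define g where "g = sqrt G"
    define y where "y = sqrt (load_energy u)"
    have G0: "0 \<le> G" unfolding G_def
      using flow_pos by (intro sum_nonneg mult_nonneg_nonneg) (auto intro: less_imp_le)
    have nn: "0 \<le> g" "0 \<le> s" "0 \<le> y" "g\<^sup>2 = G" "s\<^sup>2 = energy u" "y\<^sup>2 = load_energy u"
      using G0 energy_nonneg load_energy_nonneg by (auto simp: g_def s_def y_def)
    have us: "\<bar>u k\<bar> \<le> c1 * s" if "k \<in> Kbar P" for k
      unfolding c1_def s_def energy_def
      using m that by (intro abs_le_sqrt_weighted_sum) auto
    have ig: "\<bar>imbalance i k u\<bar> \<le> c2 * g" if k: "k \<in> fit_set P i" for i k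
    proof -
      have "G = (\<Sum>e\<in>?E. (case e of (i, k) \<Rightarrow> flow i k) * (case e of (i, k) \<Rightarrow> imbalance i k u)\<^sup>2)"
        unfolding G_def by (simp add: sum.Sigma split_beta)
      then show ?thesis
        unfolding c2_def g_def
        using abs_le_sqrt_weighted_sum[of ?E "(i, k)" q "\<lambda>(i, k). flow i k" "\<lambda>(i, k). imbalance i k u"] q k
        by auto
    qed
    have dev: "\<bar>fit_dev i u\<bar> \<le> 1/2" for i
      using fit_dev_bound[of u h i, OF uh] h by simp
    have dev_pos: "0 < 1 + fit_dev i u" for i using dev[of i] by linarith
    have sh: "\<bar>fit_shift i u\<bar> \<le> 2 * c1 * s" for i
      using shift_bound[OF dev[of i]] fit_dev_bound[of u "c1 * s" i, OF us] by linarith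
    have ld: "\<bar>load_dev i u\<bar> \<le> y" for i unfolding y_def by (rule load_dev_bound)
    have shu: "\<bar>fit_shift i u * u k\<bar> \<le> 2 * c1 * s * h" if "k \<in> Kbar P" for i k
      unfolding abs_mult using sh uh[OF that] nn c12 by (intro mult_mono) auto
    define M where "M = c2 * g + 2 * c1 * s * h"
    have rest: "\<bar>path_rest u k\<bar> \<le> (\<Sum>i\<in>UNIV. real (fst k i)) * M" if "k \<in> Kbar P" for k
    proof (rule path_rest_bound[OF _ that])
      show "\<bar>imbalance i k u - fit_shift i u * u k\<bar> \<le> M" if "k \<in> fit_set P i" for i k
        using ig[OF that] shu[OF fit_set_Kbar[OF that], where i = i] unfolding M_def by linarith
    qed
    have sM: "0 \<le> c1 * s * M" unfolding M_def using c12 nn h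
      by (intro mult_nonneg_nonneg add_nonneg_nonneg) auto
    have "\<bar>\<Sum>k\<in>Kbar P. p k * u k * path_rest u k\<bar>
        \<le> (\<Sum>k\<in>Kbar P. p k * ((c1 * s) * ((\<Sum>i\<in>UNIV. real (fst k i)) * M)))"
    proof (rule abs_sum_le)
      fix k assume k: "k \<in> Kbar P"
      have "\<bar>u k\<bar> * \<bar>path_rest u k\<bar> \<le> (c1 * s) * ((\<Sum>i\<in>UNIV. real (fst k i)) * M)"
        using us[OF k] rest[OF k] c12 nn by (intro mult_mono) auto
      then show "\<bar>p k * u k * path_rest u k\<bar> \<le> p k * ((c1 * s) * ((\<Sum>i\<in>UNIV. real (fst k i)) * M))"
        using p_pos[OF k] by (simp add: abs_mult mult.assoc)
    qed
    also have "\<dots> = c1 * s * M * (\<Sum>k\<in>Kbar P. \<Sum>i\<in>UNIV. real (fst k i) * p k)"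
      by (simp add: sum_distrib_left sum_distrib_right mult_ac)
    \<comment> \<open>The mean path length under \<open>p\<close> is the total load, which is normalised to \<open>1\<close>.\<close>
    also have "(\<Sum>k\<in>Kbar P. \<Sum>i\<in>UNIV. real (fst k i) * p k) = 1"
      by (subst sum.swap) (simp add: load_eq load_sum)
    finally have e1: "\<bar>\<Sum>k\<in>Kbar P. p k * u k * path_rest u k\<bar> \<le> c1 * s * M" by simp
    have sl: "\<bar>fit_shift i u * load_dev i u\<bar> \<le> 2 * c1 * s * y" for i
      unfolding abs_mult using sh ld nn c12 by (intro mult_mono) auto
    have "\<bar>\<Sum>i\<in>UNIV. fit_shift i u * (load P i * load_dev i u)\<bar> \<le> (\<Sum>i\<in>UNIV. load P i * (2 * c1 * s * y))"
    proof (rule abs_sum_le)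
      show "\<bar>fit_shift i u * (load P i * load_dev i u)\<bar> \<le> load P i * (2 * c1 * s * y)" for i
        using mult_left_mono[OF sl[of i], of "load P i"] load_pos[of i] by (simp add: abs_mult mult_ac)
    qed
    also have "\<dots> = 2 * c1 * s * y" by (simp add: load_sum flip: sum_distrib_right)
    finally have e2: "\<bar>\<Sum>i\<in>UNIV. fit_shift i u * (load P i * load_dev i u)\<bar> \<le> 2 * c1 * s * y" .
    have "s * s \<le> s * (c1 * M + 2 * c1 * y)"
      using e1 e2 energy_identity[OF bal] nn(5)
      by (simp add: energy_def power2_eq_square algebra_simps)
    then have "s \<le> c1 * M + 2 * c1 * y"
      using nn c12 sM by (cases "s = 0") (auto simp: M_def)
    also have "c1 * M = c1 * c2 * g + 2 * c1\<^sup>2 * h * s"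
      by (simp add: M_def algebra_simps power2_eq_square)
    also have "\<dots> \<le> c1 * c2 * g + 1/2 * s"
      using h(4) nn by (intro add_left_mono mult_right_mono) auto
    finally have "s \<le> 2 * c1 * c2 * g + 4 * c1 * y" by simp
    also have "\<dots> \<le> A * g + A * y"
      using c12 nn unfolding A_def by (intro add_mono mult_right_mono) auto
    finally have sA: "s \<le> A * (g + y)" by (simp add: distrib_left)
    have t2: "(\<Sum>i\<in>UNIV. fit_shift i u * (arrival_rate P i * load_dev i u)) \<le> (2 * c1 * La) * s * y"
    proof -
      have "(\<Sum>i\<in>UNIV. fit_shift i u * (arrival_rate P i * load_dev i u)) \<le> (\<Sum>i\<in>UNIV. arrival_rate P i * (2 * c1 * s * y))"
      proof (rule sum_mono)
        show "fit_shift i u * (arrival_rate P i * load_dev i u) \<le> arrival_rate P i * (2 * c1 * s * y)" for i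
          using mult_left_mono[OF order_trans[OF abs_ge_self sl[of i]], of "arrival_rate P i"] arrival_rate_pos[of i]
          by (simp add: mult_ac)
      qed
      then show ?thesis by (simp add: La_def mult_ac flip: sum_distrib_right sum_distrib_left)
    qed
    have t3: "(\<Sum>i\<in>UNIV. \<Sum>k\<in>fit_set P i. flow i k * imbalance i k u * (fit_shift i u * u k))
        \<le> (2 * c1 * c2 * La) * h0 * g * s"
    proof -
      have "(\<Sum>i\<in>UNIV. \<Sum>k\<in>fit_set P i. flow i k * imbalance i k u * (fit_shift i u * u k))
          \<le> (\<Sum>i\<in>UNIV. \<Sum>k\<in>fit_set P i. flow i k * ((c2 * g) * (2 * c1 * s * h0)))"
      proof (intro sum_mono)
        fix i k assume k: "k \<in> fit_set P i"
        have "\<bar>fit_shift i u * u k\<bar> \<le> 2 * c1 * s * h0"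
          using order_trans[OF shu[OF fit_set_Kbar[OF k], where i = i] mult_left_mono[OF h(3), of "2 * c1 * s"]] nn c12
          by simp
        then have "\<bar>imbalance i k u\<bar> * \<bar>fit_shift i u * u k\<bar> \<le> (c2 * g) * (2 * c1 * s * h0)"
          using ig[OF k] nn c12 by (intro mult_mono) auto
        then have "imbalance i k u * (fit_shift i u * u k) \<le> (c2 * g) * (2 * c1 * s * h0)"
          by (metis abs_ge_self abs_mult order_trans)
        then show "flow i k * imbalance i k u * (fit_shift i u * u k) \<le> flow i k * ((c2 * g) * (2 * c1 * s * h0))"
          using flow_pos[OF k] by (simp add: mult.assoc)
      qed
      also have "\<dots> = (2 * c1 * c2 * La) * h0 * g * s"
        by (simp only: sum_distrib_right[symmetric] sum_flow La_def[symmetric]) (simp add: mult_ac)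
      finally show ?thesis .
    qed
    have t4: "m0 * y\<^sup>2 \<le> (\<Sum>i\<in>UNIV. service_rate P i * (load_dev i u)\<^sup>2)"
      unfolding nn(6) load_energy_def sum_distrib_left using m0
      by (intro sum_mono mult_right_mono) auto
    have "2 * b * (m0 * y\<^sup>2) \<le> 2 * b * (\<Sum>i\<in>UNIV. service_rate P i * (load_dev i u)\<^sup>2)"
      using t4 hbc by (intro mult_left_mono) auto
    then have "(\<Sum>i\<in>UNIV. \<Sum>k\<in>fit_set P i. (u (add_cust i k) - u k) * net_flow i k (scaled u))
        - 2 * b * (\<Sum>i\<in>UNIV. service_rate P i * (load_dev i u)\<^sup>2)
      \<le> - g\<^sup>2 + (2 * c1 * La) * s * y + (2 * c1 * c2 * La) * h0 * g * s - 2 * b * m0 * y\<^sup>2"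
      unfolding dissipation_identity[OF dev_pos] G_def[symmetric] nn(4)
      using t2 t3 by (simp add: mult.assoc)
    also have "\<dots> \<le> - c * (s\<^sup>2 / 2 + b * y\<^sup>2)" by (rule hbc(4)[OF nn(1-3) sA])
    finally show "(\<Sum>i\<in>UNIV. \<Sum>k\<in>fit_set P i. (u (add_cust i k) - u k) * net_flow i k (scaled u))
        - 2 * b * (\<Sum>i\<in>UNIV. service_rate P i * (load_dev i u)\<^sup>2)
      \<le> - c * (energy u / 2 + b * load_energy u)"
      unfolding nn(5,6) .
  qed
qed

end

section \<open>Placement by marks\<close>

lemma loc_lipschitz_continuous:
  assumes "loc_lipschitz f"
  shows "continuous_on {0..} f"
  unfolding continuous_on_iff
proof (intro ballI allI impI)
  fix t e :: real assume t: "t \<in> {0..}" and e: "0 < e"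
  then obtain d L where d: "0 < d" and L: "L-lipschitz_on (cball t d \<inter> {0..}) f"
    using assms by (auto simp: loc_lipschitz_def)
  have "continuous_on (cball t d \<inter> {0..}) f" by (rule lipschitz_on_continuous_on[OF L])
  moreover have "t \<in> cball t d \<inter> {0..}" using t d by simp
  ultimately obtain d' where d': "0 < d'"
    "\<And>u. u \<in> cball t d \<inter> {0..} \<Longrightarrow> dist u t < d' \<Longrightarrow> dist (f u) (f t) < e"
    using e unfolding continuous_on_iff by blast
  have "dist (f u) (f t) < e" if "u \<in> {0..}" "dist u t < min d d'" for u
    using that by (intro d'(2)) (auto simp: dist_commute)
  then show "\<exists>d>0. \<forall>u\<in>{0..}. dist u t < d \<longrightarrow> dist (f u) (f t) < e"
    using d d'(1) by (intro exI[of _ "min d d'"]) auto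
qed


text \<open>A bounded integer-valued monotone function has finitely many values, so it is constant just before \<open>t\<close>.\<close>

lemma mono_nat_eventually_const_left:
  fixes f :: "real \<Rightarrow> nat"
  assumes mono: "mono_on {0..} f" and t: "0 < t"
  shows "\<exists>c. \<forall>\<^sub>F u in at_left t. f u = c"
proof -
  let ?S = "f ` {0..<t}"
  have "?S \<subseteq> {..f t}" using mono t by (auto simp: mono_on_def)
  then have fin: "finite ?S" by (rule finite_subset) simp
  have "?S \<noteq> {}" using t by auto
  then obtain u0 where u0: "u0 \<in> {0..<t}" "f u0 = Max ?S"
    using Max_in[OF fin] by (metis (no_types, lifting) imageE)
  have "f u = Max ?S" if "u0 < u" "u < t" for u
  proof (rule antisym)
    show "f u \<le> Max ?S" using that u0 by (intro Max_ge fin) auto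
    show "Max ?S \<le> f u" using that u0 mono by (auto simp: mono_on_def simp flip: u0(2))
  qed
  then have "\<forall>\<^sub>F u in at_left t. f u = Max ?S"
    unfolding eventually_at_left_field using u0 by (intro exI[of _ u0]) auto
  then show ?thesis by blast
qed

lemma fraction_perturbation:
  fixes v x :: "'a \<Rightarrow> real"
  assumes A: "finite A" "B \<subseteq> A" and close: "\<And>l. l \<in> A \<Longrightarrow> \<bar>v l - x l\<bar> \<le> h"
    and x: "\<And>l. l \<in> A \<Longrightarrow> 0 \<le> x l" and F: "0 < (\<Sum>l\<in>A. x l)"
    and h: "real (card A) * h \<le> (\<Sum>l\<in>A. x l) / 2"
  shows "0 < (\<Sum>l\<in>A. v l)"
    and "\<bar>(\<Sum>l\<in>B. v l) / (\<Sum>l\<in>A. v l) - (\<Sum>l\<in>B. x l) / (\<Sum>l\<in>A. x l)\<bar>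
      \<le> 4 * (real (card A) * h) / (\<Sum>l\<in>A. x l)"
proof -
  define N where "N = real (card A) * h"
  have diff: "\<bar>(\<Sum>l\<in>C. v l) - (\<Sum>l\<in>C. x l)\<bar> \<le> N" if C: "C \<subseteq> A" for C
  proof -
    have "\<bar>(\<Sum>l\<in>C. v l) - (\<Sum>l\<in>C. x l)\<bar> \<le> (\<Sum>l\<in>C. \<bar>v l - x l\<bar>)"
      unfolding sum_subtractf[symmetric] by (rule sum_abs)
    also have "\<dots> \<le> (\<Sum>l\<in>A. \<bar>v l - x l\<bar>)" using A C by (intro sum_mono2) auto
    also have "\<dots> \<le> N" unfolding N_def using close sum_bounded_above[of A "\<lambda>l. \<bar>v l - x l\<bar>" h] by simp
    finally show ?thesis .
  qed
  define F where "F = (\<Sum>l\<in>A. x l)"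
  define G where "G = (\<Sum>l\<in>A. v l)"
  define S where "S = (\<Sum>l\<in>B. v l)"
  define S0 where "S0 = (\<Sum>l\<in>B. x l)"
  have F0: "0 < F" "N \<le> F / 2" using assms by (simp_all add: F_def N_def)
  have GF: "\<bar>G - F\<bar> \<le> N" and SS: "\<bar>S - S0\<bar> \<le> N"
    using diff[of A] diff[OF A(2)] by (simp_all add: G_def F_def S_def S0_def)
  have N: "0 \<le> N" using GF by linarith
  have S0: "0 \<le> S0" "S0 \<le> F"
    unfolding S0_def F_def using A x by (auto intro!: sum_nonneg sum_mono2)
  have G: "F / 2 \<le> G" "0 < G" using GF F0 by linarith+
  then show "0 < (\<Sum>l\<in>A. v l)" by (simp add: G_def)
  have eq: "S / G - S0 / F = ((S - S0) + (S0 / F) * (F - G)) / G"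
    using G F0 by (simp add: field_simps)
  have "\<bar>(S0 / F) * (F - G)\<bar> \<le> 1 * N"
    unfolding abs_mult using S0 F0 GF by (intro mult_mono) (auto simp: abs_minus_commute)
  then have num: "\<bar>(S - S0) + (S0 / F) * (F - G)\<bar> \<le> 2 * N"
    using order_trans[OF abs_triangle_ineq add_mono[OF SS]] by fastforce
  have "\<bar>S / G - S0 / F\<bar> \<le> 2 * N / G"
    unfolding eq abs_divide using num G by (simp add: divide_right_mono)
  also have "\<dots> \<le> 2 * N / (F / 2)" using G F0 N by (intro divide_left_mono) auto
  finally show "\<bar>(\<Sum>l\<in>B. v l) / (\<Sum>l\<in>A. v l) - (\<Sum>l\<in>B. x l) / (\<Sum>l\<in>A. x l)\<bar>
      \<le> 4 * (real (card A) * h) / (\<Sum>l\<in>A. x l)"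
    by (simp add: S_def G_def S0_def F_def N_def)
qed

lemma card_initial_segment_diff:
  assumes "m \<le> (n::nat)"
  shows "real (card {l \<in> {m<..n}. Q l}) = real (card {l \<in> {1..n}. Q l}) - real (card {l \<in> {1..m}. Q l})"
proof -
  have "card {l \<in> {1..n}. Q l} = card {l \<in> {1..m}. Q l} + card {l \<in> {m<..n}. Q l}"
  proof (subst card_Un_disjoint[symmetric])
    show "card {l \<in> {1..n}. Q l} = card ({l \<in> {1..m}. Q l} \<union> {l \<in> {m<..n}. Q l})"
      using assms by (intro arg_cong[of _ _ card]) auto
  qed auto
  then show ?thesis by simp
qed

context finite_server_system
begin

lemma grand_interval_bounds:
  fixes u :: "('i, 's) config \<Rightarrow> nat" and i :: 'i and j :: nat
  defines "a \<equiv> (\<Sum>l<j. real (u (fit_order P i ! l))) / real (fit_count P i u)"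
    and "b \<equiv> (\<Sum>l\<le>j. real (u (fit_order P i ! l))) / real (fit_count P i u)"
  shows "grand_interval P i u j \<subseteq> {a..b}" "{a<..b} \<subseteq> grand_interval P i u j"
  unfolding grand_interval_def Let_def a_def b_def sum_divide_distrib[symmetric] by auto

lemma placed_along_iff:
  assumes j: "j < length (fit_order P i)"
  shows "placed_along P i u z (add_cust i (fit_order P i ! j))
    \<longleftrightarrow> 1 \<le> fit_count P i u \<and> z \<in> grand_interval P i u j"
  using j fit_order_distinct[of i]
  by (auto simp: placed_along_def inj_add_cust nth_eq_iff_index_eq)

lemma sum_fit_order:
  fixes f :: "('i, 's) config \<Rightarrow> real"
  assumes "J \<subseteq> {..<length (fit_order P i)}"
  shows "(\<Sum>l\<in>J. f (fit_order P i ! l)) = (\<Sum>k\<in>(!) (fit_order P i) ` J. f k)"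
    and "(!) (fit_order P i) ` J \<subseteq> fit_set P i"
proof -
  have "inj_on ((!) (fit_order P i)) J"
    using assms fit_order_distinct[of i] by (intro inj_on_nth) auto
  then show "(\<Sum>l\<in>J. f (fit_order P i ! l)) = (\<Sum>k\<in>(!) (fit_order P i) ` J. f k)"
    by (simp add: sum.reindex)
  show "(!) (fit_order P i) ` J \<subseteq> fit_set P i"
    using assms fit_order_set[of i] by (auto simp: set_conv_nth subset_iff)
qed

text \<open>The end points of the interval of \<open>k\<close> are continuous functions of the scaled state. So near \<open>y\<close> the random
  placement can be sandwiched between two fixed intervals of marks, both of length about
  \<open>y\<^sub>k / fit_mass P i y\<close>. The lower end is widened by \<open>2 * e\<close> because a first interval may be closed
  on the left.\<close>

lemma placement_interval:
  assumes k: "k \<in> fit_set P i" and y: "\<And>l. l \<in> Kbar P \<Longrightarrow> 0 \<le> y l"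
    and pos: "0 < fit_mass P i y" and e: "0 < e"
  obtains \<alpha> \<beta> h where "0 \<le> \<alpha>" "\<beta> \<le> 1" "\<beta> - \<alpha> = y k / fit_mass P i y" "0 < h"
    "\<forall>u r z. 1 \<le> r \<longrightarrow> (\<forall>l\<in>Kbar P. \<bar>real (u l) / r - y l\<bar> \<le> h) \<longrightarrow>
      (placed_along P i u z (add_cust i k) \<longrightarrow> \<alpha> - 2 * e < z \<and> z \<le> \<beta> + e) \<and>
      (\<alpha> + e < z \<and> z \<le> \<beta> - e \<longrightarrow> placed_along P i u z (add_cust i k))"
proof -
  let ?L = "fit_order P i"
  obtain j where j: "j < length ?L" "?L ! j = k"
    using k fit_order_set[of i] by (metis in_set_conv_nth)
  define F where "F = fit_mass P i y"
  define \<alpha> where "\<alpha> = (\<Sum>l<j. y (?L ! l)) / F"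
  define \<beta> where "\<beta> = (\<Sum>l\<le>j. y (?L ! l)) / F"
  define N where "N = real (card (fit_set P i))"
  have N: "0 < N" using fit_set_nonempty[of i] by (simp add: N_def card_gt_0_iff)
  define h where "h = min e 1 * F / (4 * N)"
  have F: "0 < F" using pos by (simp add: F_def)
  have h: "0 < h" using e F N by (simp add: h_def)
  have sub: "{..<j} \<subseteq> {..<length ?L}" "{..j} \<subseteq> {..<length ?L}" using j by auto
  have yf: "0 \<le> y l" if "l \<in> fit_set P i" for l using y fit_set_Kbar[OF that] by simp
  have "0 \<le> \<alpha>" unfolding \<alpha>_def sum_fit_order(1)[OF sub(1)]
    using F sum_fit_order(2)[OF sub(1)] yf by (intro divide_nonneg_pos sum_nonneg) auto
  moreover have "\<beta> \<le> 1"
  proof -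
    have "(\<Sum>l\<le>j. y (?L ! l)) \<le> F"
      unfolding sum_fit_order(1)[OF sub(2)] F_def fit_mass_def
      using yf sum_fit_order(2)[OF sub(2)] by (intro sum_mono2) auto
    then show ?thesis using F by (simp add: \<beta>_def)
  qed
  moreover have "\<beta> - \<alpha> = y k / fit_mass P i y"
    by (simp add: \<alpha>_def \<beta>_def F_def j lessThan_Suc_atMost[symmetric] add_divide_distrib)
  moreover have "(placed_along P i u z (add_cust i k) \<longrightarrow> \<alpha> - 2 * e < z \<and> z \<le> \<beta> + e) \<and>
      (\<alpha> + e < z \<and> z \<le> \<beta> - e \<longrightarrow> placed_along P i u z (add_cust i k))"
    if r: "1 \<le> r" and u: "\<And>l. l \<in> Kbar P \<Longrightarrow> \<bar>real (u l) / r - y l\<bar> \<le> h" for u r z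
  proof -
    let ?a = "(\<Sum>l<j. real (u (?L ! l))) / real (fit_count P i u)"
    let ?b = "(\<Sum>l\<le>j. real (u (?L ! l))) / real (fit_count P i u)"
    have Nh: "N * h = min e 1 * F / 4" using N by (simp add: h_def)
    have "min e 1 * F \<le> 1 * F" using F by (intro mult_right_mono) auto
    then have Nh2: "real (card (fit_set P i)) * h \<le> (\<Sum>l\<in>fit_set P i. y l) / 2"
      using Nh F unfolding N_def F_def fit_mass_def by linarith
    have yF: "(\<Sum>l\<in>fit_set P i. y l) = F" by (simp add: F_def fit_mass_def)
    have uf: "\<bar>real (u l) / r - y l\<bar> \<le> h" if "l \<in> fit_set P i" for l
      using u fit_set_Kbar[OF that] by simp
    note frac = fraction_perturbation[OF finite_fit_set _ uf yf _ Nh2, unfolded yF, OF _ _ _ F]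
    have cnt: "(\<Sum>l\<in>fit_set P i. real (u l) / r) = real (fit_count P i u) / r"
      by (simp add: fit_count_def sum_divide_distrib)
    have "0 < real (fit_count P i u) / r" using frac(1)[of "{}"] cnt by simp
    then have c1: "1 \<le> fit_count P i u" using r by (simp add: zero_less_divide_iff)
    have bound: "4 * (real (card (fit_set P i)) * h) / F \<le> e"
    proof -
      have "4 * (real (card (fit_set P i)) * h) = min e 1 * F" using Nh unfolding N_def by simp
      then show ?thesis using F by simp
    qed
    have near: "\<bar>(\<Sum>l\<in>J. real (u (?L ! l))) / real (fit_count P i u) - (\<Sum>l\<in>J. y (?L ! l)) / F\<bar> \<le> e"
      if J: "J \<subseteq> {..<length ?L}" for J
    proof -
      have "(\<Sum>l\<in>J. real (u (?L ! l))) / real (fit_count P i u)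
         = (\<Sum>k\<in>(!) ?L ` J. real (u k) / r) / (\<Sum>l\<in>fit_set P i. real (u l) / r)"
        unfolding cnt sum_fit_order(1)[OF J, of "\<lambda>k. real (u k)"] sum_divide_distrib[symmetric]
        using r by (simp add: fit_count_def)
      then show ?thesis
        unfolding sum_fit_order(1)[OF J, of y]
        using frac(2)[OF sum_fit_order(2)[OF J]] bound by simp
    qed
    have a: "\<bar>?a - \<alpha>\<bar> \<le> e" and b: "\<bar>?b - \<beta>\<bar> \<le> e"
      using near[OF sub(1)] near[OF sub(2)] by (simp_all add: \<alpha>_def \<beta>_def)
    have iff: "placed_along P i u z (add_cust i k) \<longleftrightarrow> z \<in> grand_interval P i u j"
      using placed_along_iff[OF j(1), of u z] c1 by (simp add: j)
    note gi = grand_interval_bounds[where i = i and j = j and u = u]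
    show ?thesis unfolding iff
    proof (intro conjI impI)
      assume "z \<in> grand_interval P i u j"
      then have "?a \<le> z" "z \<le> ?b" using gi(1) by auto
      then show "\<alpha> - 2 * e < z" "z \<le> \<beta> + e" using a b e by linarith+
    next
      assume "\<alpha> + e < z \<and> z \<le> \<beta> - e"
      then have "z \<in> {?a<..?b}" using a b by auto
      then show "z \<in> grand_interval P i u j" using gi(2) by blast
    qed
  qed
  ultimately show thesis using h by (intro that) auto
qed

end

section \<open>Balance and departures of a fluid sample path\<close>

lemma uniform_limit_sum:
  fixes f :: "'b \<Rightarrow> nat \<Rightarrow> real \<Rightarrow> real"
  assumes "finite I" "\<And>i. i \<in> I \<Longrightarrow> uniform_limit S (f i) (g i) sequentially"
  shows "uniform_limit S (\<lambda>n t. \<Sum>i\<in>I. f i n t) (\<lambda>t. \<Sum>i\<in>I. g i t) sequentially"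
  using assms by (induction I rule: finite_induct) (auto intro!: uniform_limit_intros)

text \<open>A fluid sample path together with the primitives and the converging sequence of scaled processes that
  witness it.\<close>

locale fluid_limit = finite_server_system P + driving_primitives P W
  for P :: "('i::finite, 's::finite) server_system" and W :: "('i, 's, 'w) primitives" +
  fixes x :: "('i, 's) config \<Rightarrow> real \<Rightarrow> real"
    and d a :: "('i, 's) config \<times> 'i \<Rightarrow> real \<Rightarrow> real"
    and \<omega> :: 'w and \<phi> :: "nat \<Rightarrow> nat"
    and X :: "nat \<Rightarrow> real \<Rightarrow> ('i, 's) config \<Rightarrow> nat"
    and D A :: "nat \<Rightarrow> ('i, 's) config \<times> 'i \<Rightarrow> real \<Rightarrow> nat"
  assumes x_lipschitz: "\<And>k. k \<in> K P \<Longrightarrow> loc_lipschitz (x k)"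
    and omega: "\<omega> \<in> space (sample_space W)"
    and lln: "lln_realization P W \<omega>"
    and subseq: "strict_mono \<phi>"
    and path: "\<And>n. grand_f_path P W \<omega> (scaling P (\<phi> n)) (X n) (D n) (A n)"
    and x_lim: "\<And>k. k \<in> K P \<Longrightarrow> uoc_limit {0..} (\<lambda>n t. real (X n t k) / scaling P (\<phi> n)) (x k)"
    and d_lim: "\<And>e. e \<in> edges P \<Longrightarrow> uoc_limit {0..} (\<lambda>n t. real (D n e t) / scaling P (\<phi> n)) (d e)"
    and a_lim: "\<And>e. e \<in> edges P \<Longrightarrow> uoc_limit {0..} (\<lambda>n t. real (A n e t) / scaling P (\<phi> n)) (a e)"
begin

abbreviation r :: "nat \<Rightarrow> real" where "r n \<equiv> scaling P (\<phi> n)"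

definition state :: "('i, 's) config \<Rightarrow> real \<Rightarrow> real" where
  "state k t = xbar P (state_at P x t) k"

lemma r_ge_1: "1 \<le> r n" and r_pos: "0 < r n"
  using scaling_ge_1[of "\<phi> n"] by auto

lemma state_K: "k \<in> K P \<Longrightarrow> state k t = x k t"
  by (simp add: state_def xbar_K state_at_def)

lemma state_zero: "state (zero_cfg s) t = server_frac P s - (\<Sum>l\<in>K_of P s. x l t)"
proof -
  have "(\<Sum>l\<in>K_of P s. state_at P x t l) = (\<Sum>l\<in>K_of P s. x l t)"
    by (rule sum.cong) (auto simp: state_at_def K_of_eq)
  then show ?thesis by (simp add: state_def xbar_def)
qed

lemma state_K_fun: "k \<in> K P \<Longrightarrow> state k = x k"
  by (simp add: state_K fun_eq_iff)

lemma Kbar_cases: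
  assumes "k \<in> Kbar P"
  obtains "k \<in> K P" | s where "k = zero_cfg s"
  using assms by (auto simp: K_eq)

lemma path_total: "0 \<le> t \<Longrightarrow> (\<Sum>k\<in>Kbar_of P s. real (X n t k)) = server_frac P s * r n"
  and path_balance: "0 \<le> t \<Longrightarrow> k \<in> Kbar P \<Longrightarrow> real (X n t k) = real (X n 0 k)
        + (\<Sum>i | (k, i) \<in> edges P. real (A n (k, i) t) - real (D n (k, i) t))
        - (\<Sum>i | (add_cust i k, i) \<in> edges P.
             real (A n (add_cust i k, i) t) - real (D n (add_cust i k, i) t))"
  and path_integrable: "0 \<le> t \<Longrightarrow> (k, i) \<in> edges P \<Longrightarrow> (\<lambda>u. real (X n u k)) integrable_on {0..t}"
  and path_departures: "0 \<le> t \<Longrightarrow> (k, i) \<in> edges P \<Longrightarrow> D n (k, i) t = dep_process W (k, i) \<omega>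
          (integral {0..t} (\<lambda>u. real (X n u k) * real (fst k i) * service_rate P i))"
  and path_arrivals: "0 \<le> t \<Longrightarrow> (k, i) \<in> edges P \<Longrightarrow> A n (k, i) t = card {m \<in> {1..arrivals P W \<omega> (r n) i t}.
        placed_along P i (state_before (X n) (arrival_time P W \<omega> (r n) i m)) (mark W i m \<omega>) k}"
  using path[of n] unfolding grand_f_path_def by blast+

lemma state_lim:
  assumes "k \<in> Kbar P"
  shows "uniform_limit {0..T} (\<lambda>n t. real (X n t k) / r n) (state k) sequentially"
proof -
  have K: "uniform_limit {0..T} (\<lambda>n t. real (X n t l) / r n) (x l) sequentially" if "l \<in> K P" for l
    using x_lim[OF that] unfolding uoc_limit_def by auto
  from assms show ?thesis
  proof (cases rule: Kbar_cases)
    case 1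
    then show ?thesis using K[OF 1] by (simp add: state_K_fun)
  next
    case (2 s)
    have "uniform_limit {0..T} (\<lambda>n t. server_frac P s - (\<Sum>l\<in>K_of P s. real (X n t l) / r n))
        (\<lambda>t. server_frac P s - (\<Sum>l\<in>K_of P s. x l t)) sequentially"
      by (intro uniform_limit_intros uniform_limit_sum K) (auto simp: K_of_eq)
    moreover have "real (X n t k) / r n = server_frac P s - (\<Sum>l\<in>K_of P s. real (X n t l) / r n)"
      if "t \<in> {0..T}" for n t
    proof -
      have "real (X n t k) = server_frac P s * r n - (\<Sum>l\<in>K_of P s. real (X n t l))"
        using path_total[where t = t and s = s and n = n] that unfolding sum_Kbar_of_zero 2 by simp
      then show ?thesis using r_pos[of n] by (simp add: diff_divide_distrib sum_divide_distrib)
    qed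
    ultimately show ?thesis
      using uniform_limit_cong'[of "{0..T}" "\<lambda>n t. real (X n t k) / r n"
          "\<lambda>n t. server_frac P s - (\<Sum>l\<in>K_of P s. real (X n t l) / r n)" "state k"
          "\<lambda>t. server_frac P s - (\<Sum>l\<in>K_of P s. x l t)"]
      by (simp add: 2 state_zero)
  qed
qed

lemma state_tendsto:
  assumes "k \<in> Kbar P" "0 \<le> t"
  shows "(\<lambda>n. real (X n t k) / r n) \<longlonglongrightarrow> state k t"
  using tendsto_uniform_limitI[OF state_lim[OF assms(1), of t]] assms(2) by simp

lemma a_tendsto: "e \<in> edges P \<Longrightarrow> 0 \<le> t \<Longrightarrow> (\<lambda>n. real (A n e t) / r n) \<longlonglongrightarrow> a e t"
  and d_tendsto: "e \<in> edges P \<Longrightarrow> 0 \<le> t \<Longrightarrow> (\<lambda>n. real (D n e t) / r n) \<longlonglongrightarrow> d e t"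
proof -
  have pointwise: "(\<lambda>n. f n t) \<longlonglongrightarrow> g t" if "uoc_limit {0..} f g" "0 \<le> t" for f g and t :: real
  proof -
    have "uniform_limit {0..t} f g sequentially" using that by (auto simp: uoc_limit_def)
    then show ?thesis by (rule tendsto_uniform_limitI) (use that in simp)
  qed
  show "e \<in> edges P \<Longrightarrow> 0 \<le> t \<Longrightarrow> (\<lambda>n. real (A n e t) / r n) \<longlonglongrightarrow> a e t"
    using pointwise[OF a_lim] by simp
  show "e \<in> edges P \<Longrightarrow> 0 \<le> t \<Longrightarrow> (\<lambda>n. real (D n e t) / r n) \<longlonglongrightarrow> d e t"
    using pointwise[OF d_lim] by simp
qed

lemma state_nonneg: "k \<in> Kbar P \<Longrightarrow> 0 \<le> t \<Longrightarrow> 0 \<le> state k t"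
  using LIMSEQ_le_const[OF state_tendsto, of k t 0] r_pos by (auto simp: less_imp_le[OF r_pos])

lemma state_continuous: "k \<in> Kbar P \<Longrightarrow> continuous_on {0..} (state k)"
proof (erule Kbar_cases)
  assume "k \<in> K P"
  then show "continuous_on {0..} (state k)"
    using loc_lipschitz_continuous[OF x_lipschitz] by (simp add: state_K_fun)
next
  fix s assume k: "k = zero_cfg s"
  have "continuous_on {0..} (\<lambda>t. server_frac P s - (\<Sum>l\<in>K_of P s. x l t))"
    by (intro continuous_on_diff continuous_on_const continuous_on_sum loc_lipschitz_continuous x_lipschitz)
      (simp add: K_of_eq)
  then show "continuous_on {0..} (state k)" by (simp add: k state_zero[abs_def])
qed

lemma state_total: "(\<Sum>k\<in>Kbar_of P s. state k t) = server_frac P s"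
  unfolding state_def by (rule sum_xbar)

text \<open>The balance equations are linear, so they pass to the limit.\<close>

lemma state_weak_balance:
  assumes "0 \<le> t"
  shows "(\<Sum>k\<in>Kbar P. f k * (state k t - state k 0))
    = (\<Sum>i\<in>UNIV. \<Sum>k\<in>fit_set P i. (f (add_cust i k) - f k) * (a (add_cust i k, i) t - d (add_cust i k, i) t))"
proof -
  define w where "w = (\<lambda>n e. (real (A n e t) - real (D n e t)) / r n)"
  have "(\<Sum>k\<in>Kbar P. f k * (real (X n t k) / r n - real (X n 0 k) / r n))
      = (\<Sum>i\<in>UNIV. \<Sum>k\<in>fit_set P i. (f (add_cust i k) - f k) * w n (add_cust i k, i))" for n
    unfolding sum_by_parts[of f "w n", symmetric]
  proof (intro sum.cong refl)
    fix k assume k: "k \<in> Kbar P"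
    show "f k * (real (X n t k) / r n - real (X n 0 k) / r n)
      = f k * ((\<Sum>i | (k, i) \<in> edges P. w n (k, i)) - (\<Sum>i | (add_cust i k, i) \<in> edges P. w n (add_cust i k, i)))"
      unfolding path_balance[OF assms k, of n] w_def
      by (simp add: diff_divide_distrib add_divide_distrib sum_divide_distrib)
  qed
  moreover have "(\<lambda>n. \<Sum>k\<in>Kbar P. f k * (real (X n t k) / r n - real (X n 0 k) / r n))
      \<longlonglongrightarrow> (\<Sum>k\<in>Kbar P. f k * (state k t - state k 0))"
    using assms by (intro tendsto_intros state_tendsto) auto
  moreover have "(\<lambda>n. \<Sum>i\<in>UNIV. \<Sum>k\<in>fit_set P i. (f (add_cust i k) - f k) * w n (add_cust i k, i))
      \<longlonglongrightarrow> (\<Sum>i\<in>UNIV. \<Sum>k\<in>fit_set P i. (f (add_cust i k) - f k) * (a (add_cust i k, i) t - d (add_cust i k, i) t))"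
    unfolding w_def diff_divide_distrib using assms
    by (intro tendsto_intros a_tendsto d_tendsto) (auto simp: edges_add_iff fit_set_add)
  ultimately show ?thesis using LIMSEQ_unique by simp
qed

text \<open>Uniformity of the law of large numbers on compact intervals allows the time argument to vary with \<open>n\<close>.\<close>

lemma dep_process_lim:
  assumes e: "e \<in> edges P" and s: "s \<longlonglongrightarrow> l" "\<And>n. 0 \<le> s n"
  shows "(\<lambda>n. real (dep_process W e \<omega> (r n * s n)) / r n) \<longlonglongrightarrow> l"
proof -
  have l: "0 \<le> l" using s by (intro LIMSEQ_le_const[OF s(1)]) auto
  have "uoc_limit {0..} (\<lambda>n t. real (dep_process W e \<omega> (scaling P n * t)) / scaling P n) (\<lambda>t. t)"
    using lln e by (auto simp: lln_realization_def)
  then have "uniform_limit {0..l + 1} (\<lambda>n t. real (dep_process W e \<omega> (scaling P n * t)) / scaling P n) (\<lambda>t. t) sequentially"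
    unfolding uoc_limit_def by auto
  then have ul: "uniform_limit {0..l + 1} (\<lambda>n t. real (dep_process W e \<omega> (r n * t)) / r n) (\<lambda>t. t) sequentially"
    using filterlim_compose[OF _ filterlim_subseq[OF subseq]] by fastforce
  have ev: "\<forall>\<^sub>F n in sequentially. s n < l + 1" using order_tendstoD(2)[OF s(1)] by simp
  have "(\<lambda>n. real (dep_process W e \<omega> (r n * s n)) / r n - s n) \<longlonglongrightarrow> 0"
  proof (rule tendstoI)
    fix h :: real assume "0 < h"
    from uniform_limitD[OF ul this] ev
    show "\<forall>\<^sub>F n in sequentially. dist (real (dep_process W e \<omega> (r n * s n)) / r n - s n) 0 < h"
      by eventually_elim (use s(2) in \<open>auto simp: dist_real_def less_imp_le\<close>)
  qed
  from tendsto_add[OF this s(1)] show ?thesis by simp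
qed

lemma departures_fluid:
  assumes e: "(k, i) \<in> edges P" and t: "0 \<le> t"
  shows "d (k, i) t = real (fst k i) * service_rate P i * integral {0..t} (state k)"
proof -
  have k: "k \<in> Kbar P" using e by (simp add: edges_iff)
  let ?c = "real (fst k i) * service_rate P i"
  have c: "0 \<le> ?c" using service_rate_pos[of i] by simp
  define s where "s = (\<lambda>n. ?c * integral {0..t} (\<lambda>u. real (X n u k) / r n))"
  have int: "(\<lambda>u. real (X n u k) / r n) integrable_on {0..t}" for n
    using integrable_on_mult_right[OF path_integrable[OF t e, of n], of "1 / r n"] by simp
  have int_st: "state k integrable_on {0..t}"
    by (intro integrable_continuous_real continuous_on_subset[OF state_continuous[OF k]]) auto
  have "(\<lambda>n. integral {0..t} (\<lambda>u. real (X n u k) / r n)) \<longlonglongrightarrow> integral {0..t} (state k)"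
  proof (rule tendstoI)
    fix h :: real assume h: "0 < h"
    then have "0 < h / (t + 1)" using t by simp
    from uniform_limitD[OF state_lim[OF k, of t] this]
    show "\<forall>\<^sub>F n in sequentially. dist (integral {0..t} (\<lambda>u. real (X n u k) / r n)) (integral {0..t} (state k)) < h"
    proof eventually_elim
      case (elim n)
      have "norm (integral {0..t} (\<lambda>u. real (X n u k) / r n - state k u)) \<le> integral {0..t} (\<lambda>u. h / (t + 1))"
        using elim by (intro integral_norm_bound_integral integrable_diff int int_st)
          (auto simp: dist_real_def less_imp_le)
      also have "\<dots> = t * (h / (t + 1))" using t by simp
      also have "\<dots> < h" using t h by (simp add: divide_simps)
      finally show ?case by (simp add: dist_real_def integral_diff[OF int int_st])
    qed
  qed
  then have "s \<longlonglongrightarrow> ?c * integral {0..t} (state k)" unfolding s_def by (intro tendsto_intros)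
  moreover have "0 \<le> s n" for n
    unfolding s_def using c r_pos[of n] less_imp_le[OF service_rate_pos[of i]]
    by (intro mult_nonneg_nonneg integral_nonneg int) (auto intro: divide_nonneg_pos)
  ultimately have "(\<lambda>n. real (dep_process W (k, i) \<omega> (r n * s n)) / r n) \<longlonglongrightarrow> ?c * integral {0..t} (state k)"
    by (intro dep_process_lim e)
  moreover have "D n (k, i) t = dep_process W (k, i) \<omega> (r n * s n)" for n
  proof -
    have "r n * s n = integral {0..t} (\<lambda>u. real (X n u k) * real (fst k i) * service_rate P i)"
    proof -
      have "integral {0..t} (\<lambda>u. real (X n u k) * real (fst k i) * service_rate P i)
          = integral {0..t} (\<lambda>u. (r n * ?c) * (real (X n u k) / r n))"
        using r_pos[of n] by (intro integral_cong) simp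
      then show ?thesis by (simp add: s_def)
    qed
    then show ?thesis using path_departures[OF t e, of n] by simp
  qed
  ultimately show ?thesis using LIMSEQ_unique[OF d_tendsto[OF e t]] by simp
qed

lemma departures_derivative:
  assumes e: "(k, i) \<in> edges P" and t: "0 < t"
  shows "(d (k, i) has_real_derivative real (fst k i) * service_rate P i * state k t) (at t)"
proof -
  have k: "k \<in> Kbar P" using e by (simp add: edges_iff)
  have "continuous_on {0..t + 1} (state k)"
    by (rule continuous_on_subset[OF state_continuous[OF k]]) auto
  from integral_has_real_derivative[OF this, of t] t
  have "((\<lambda>u. integral {0..u} (state k)) has_real_derivative state k t) (at t within {0..t + 1})" by simp
  moreover have "at t within {0..t + 1} = at t" using t by (intro at_within_interior) auto
  ultimately have "((\<lambda>u. integral {0..u} (state k)) has_real_derivative state k t) (at t)" by simp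
  then have "((\<lambda>u. real (fst k i) * service_rate P i * integral {0..u} (state k)) has_real_derivative
      real (fst k i) * service_rate P i * state k t) (at t)"
    by (rule DERIV_cmult)
  then show ?thesis
  proof (rule has_field_derivative_transform_within_open[where S = "{0<..}"])
  qed (use t departures_fluid[OF e] in auto)
qed

end

section \<open>Arrivals of a fluid sample path\<close>

text \<open>The prelimit state has a left limit that is attained just before: each coordinate is a finite
  combination of monotone counting processes.\<close>

definition eventually_const_left :: "real \<Rightarrow> (real \<Rightarrow> real) \<Rightarrow> bool" where
  "eventually_const_left t f \<longleftrightarrow> (\<exists>c. \<forall>\<^sub>F u in at_left t. f u = c)"

lemma eventually_const_left_const: "eventually_const_left t (\<lambda>_. c)"
  by (auto simp: eventually_const_left_def)

lemma eventually_const_left_combine: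
  assumes "eventually_const_left t f" "eventually_const_left t g"
  shows "eventually_const_left t (\<lambda>u. h (f u) (g u))"
proof -
  obtain c c' where "\<forall>\<^sub>F u in at_left t. f u = c" "\<forall>\<^sub>F u in at_left t. g u = c'"
    using assms by (auto simp: eventually_const_left_def)
  then have "\<forall>\<^sub>F u in at_left t. h (f u) (g u) = h c c'" by eventually_elim simp
  then show ?thesis by (auto simp: eventually_const_left_def)
qed

lemma eventually_const_left_sum:
  assumes "finite I" "\<And>i. i \<in> I \<Longrightarrow> eventually_const_left t (f i)"
  shows "eventually_const_left t (\<lambda>u. \<Sum>i\<in>I. f i u)"
  using assms
  by (induction I rule: finite_induct)
    (auto intro: eventually_const_left_const eventually_const_left_combine[where h = "(+)"])

context fluid_limit
begin

lemma arrivals_mono: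
  assumes "0 \<le> s" "s \<le> t"
  shows "arrivals P W \<omega> (r n) i s \<le> arrivals P W \<omega> (r n) i t"
proof -
  have "mono_on {0..} (arr_process W i \<omega>)"
    using arr_poisson[of i] omega by (simp add: unit_poisson_def counting_path_def)
  then show ?thesis
    unfolding arrivals_def using assms r_ge_1[of n] arrival_rate_pos[of i]
    by (auto simp: mono_on_def intro!: mult_left_mono)
qed

lemma A_mono:
  assumes "e \<in> edges P"
  shows "mono_on {0..} (A n e)"
proof (rule mono_onI)
  fix s t :: real assume st: "s \<in> {0..}" "t \<in> {0..}" "s \<le> t"
  obtain k i where e: "e = (k, i)" by (cases e)
  show "A n e s \<le> A n e t"
    unfolding e using st assms arrivals_mono[of s t n i]
    by (auto simp: path_arrivals e intro!: card_mono)
qed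

lemma D_mono:
  assumes "e \<in> edges P"
  shows "mono_on {0..} (D n e)"
proof (rule mono_onI)
  fix s t :: real assume st: "s \<in> {0..}" "t \<in> {0..}" "s \<le> t"
  obtain k i where e: "e = (k, i)" by (cases e)
  have mono: "mono_on {0..} (dep_process W (k, i) \<omega>)"
    using dep_poisson[of e] assms omega by (simp add: e unit_poisson_def counting_path_def)
  have int: "(\<lambda>u. real (X n u k) * real (fst k i) * service_rate P i) integrable_on {0..u}" if "0 \<le> u" for u
    using path_integrable[OF that, of k i n] assms e
    by (intro integrable_on_mult_left) auto
  have nn: "0 \<le> real (X n u k) * real (fst k i) * service_rate P i" for u
    using service_rate_pos[of i] by simp
  have "integral {0..s} (\<lambda>u. real (X n u k) * real (fst k i) * service_rate P i)
    \<le> integral {0..t} (\<lambda>u. real (X n u k) * real (fst k i) * service_rate P i)"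
    using st int nn by (intro integral_subset_le) auto
  moreover have "0 \<le> integral {0..s} (\<lambda>u. real (X n u k) * real (fst k i) * service_rate P i)"
    using st int nn by (intro integral_nonneg) auto
  ultimately show "D n e s \<le> D n e t"
    unfolding e using st assms mono by (auto simp: path_departures e mono_on_def)
qed

lemma state_before_attained:
  assumes t: "0 < t"
  shows "\<forall>\<^sub>F u in at_left t. \<forall>k\<in>Kbar P. X n u k = state_before (X n) t k"
proof (intro eventually_ball_finite ballI finite_Kbar)
  fix k assume k: "k \<in> Kbar P"
  have AD: "eventually_const_left t (\<lambda>u. real (A n e u) - real (D n e u))" if e: "e \<in> edges P" for e
  proof (rule eventually_const_left_combine[where h = "(-)"])
    obtain c where "\<forall>\<^sub>F u in at_left t. A n e u = c"
      using mono_nat_eventually_const_left[OF A_mono[OF e] t] by blast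
    then have "\<forall>\<^sub>F u in at_left t. real (A n e u) = real c" by eventually_elim simp
    then show "eventually_const_left t (\<lambda>u. real (A n e u))" unfolding eventually_const_left_def by blast
    obtain c where "\<forall>\<^sub>F u in at_left t. D n e u = c"
      using mono_nat_eventually_const_left[OF D_mono[OF e] t] by blast
    then have "\<forall>\<^sub>F u in at_left t. real (D n e u) = real c" by eventually_elim simp
    then show "eventually_const_left t (\<lambda>u. real (D n e u))" unfolding eventually_const_left_def by blast
  qed
  have "eventually_const_left t (\<lambda>u. real (X n 0 k)
        + (\<Sum>i | (k, i) \<in> edges P. real (A n (k, i) u) - real (D n (k, i) u))
        - (\<Sum>i | (add_cust i k, i) \<in> edges P.
             real (A n (add_cust i k, i) u) - real (D n (add_cust i k, i) u)))"
    by (rule eventually_const_left_combine[where h = "(-)"],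
        rule eventually_const_left_combine[where h = "(+)"])
      (auto intro!: eventually_const_left_const eventually_const_left_sum AD)
  then obtain c where c: "\<forall>\<^sub>F u in at_left t. real (X n 0 k)
        + (\<Sum>i | (k, i) \<in> edges P. real (A n (k, i) u) - real (D n (k, i) u))
        - (\<Sum>i | (add_cust i k, i) \<in> edges P.
             real (A n (add_cust i k, i) u) - real (D n (add_cust i k, i) u)) = c"
    unfolding eventually_const_left_def by blast
  have pos: "\<forall>\<^sub>F u in at_left t. 0 < u" using eventually_at_left_field t by blast
  from c pos have c': "\<forall>\<^sub>F u in at_left t. real (X n u k) = c"
  proof eventually_elim
    case (elim u)
    then show ?case using path_balance[of u k n] k by simp
  qed
  then obtain u0 where u0: "real (X n u0 k) = c"
    using eventually_happens'[OF trivial_limit_at_left_real] by blast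
  have ev: "\<forall>\<^sub>F u in at_left t. X n u k = X n u0 k"
    using c' by eventually_elim (metis u0 of_nat_eq_iff)
  then have "((\<lambda>u. X n u k) \<longlongrightarrow> X n u0 k) (at_left t)" by (rule tendsto_eventually)
  then have "state_before (X n) t k = X n u0 k"
    unfolding state_before_def by (intro tendsto_Lim) auto
  then show "\<forall>\<^sub>F u in at_left t. X n u k = state_before (X n) t k" using ev by simp
qed

lemma arrival_time_bounds:
  assumes "0 < t1" "t1 \<le> t2" and m: "m \<in> {arrivals P W \<omega> (r n) i t1<..arrivals P W \<omega> (r n) i t2}"
  shows "t1 \<le> arrival_time P W \<omega> (r n) i m" "arrival_time P W \<omega> (r n) i m \<le> t2"
proof -
  let ?S = "{t. 0 \<le> t \<and> m \<le> arrivals P W \<omega> (r n) i t}"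
  have t2: "t2 \<in> ?S" using assms by auto
  have low: "t1 \<le> t" if "t \<in> ?S" for t
  proof (rule ccontr)
    assume "\<not> t1 \<le> t"
    then show False using arrivals_mono[of t t1 n i] that m by auto
  qed
  show "t1 \<le> arrival_time P W \<omega> (r n) i m"
    unfolding arrival_time_def by (rule cInf_greatest) (use t2 low in auto)
  show "arrival_time P W \<omega> (r n) i m \<le> t2"
    unfolding arrival_time_def using t2 by (rule cInf_lower) (auto intro: bdd_belowI)
qed

lemma arrivals_lim:
  assumes "0 \<le> t"
  shows "(\<lambda>n. real (arrivals P W \<omega> (r n) i t) / r n) \<longlonglongrightarrow> arrival_rate P i * t"
proof -
  have s: "0 \<le> arrival_rate P i * t" using assms arrival_rate_pos[of i] by simp
  have "uoc_limit {0..} (\<lambda>n t. real (arr_process W i \<omega> (scaling P n * t)) / scaling P n) (\<lambda>t. t)"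
    using lln by (auto simp: lln_realization_def)
  then have "uniform_limit {0..arrival_rate P i * t}
      (\<lambda>n t. real (arr_process W i \<omega> (scaling P n * t)) / scaling P n) (\<lambda>t. t) sequentially"
    unfolding uoc_limit_def by auto
  then have "(\<lambda>n. real (arr_process W i \<omega> (scaling P n * (arrival_rate P i * t))) / scaling P n)
      \<longlonglongrightarrow> arrival_rate P i * t"
    by (rule tendsto_uniform_limitI) (use s in simp)
  from filterlim_compose[OF this filterlim_subseq[OF subseq]] show ?thesis
    by (simp add: arrivals_def mult_ac)
qed

text \<open>Scaled number of type-\<open>i\<close> arrivals up to time \<open>t\<close> whose mark is at most \<open>z\<close>. Differences of it count the
  arrivals in a time interval with marks in a given interval. Its limit is needed also for \<open>z\<close> outside
  \<open>[0, 1]\<close>, since the widened intervals of marks may stick out.\<close>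

definition marks_upto :: "nat \<Rightarrow> 'i \<Rightarrow> real \<Rightarrow> real \<Rightarrow> real" where
  "marks_upto n i z t = real (card {m \<in> {1..arrivals P W \<omega> (r n) i t}. mark W i m \<omega> \<le> z}) / r n"

lemma marks_upto_lim:
  assumes t: "0 \<le> t"
  shows "(\<lambda>n. marks_upto n i z t) \<longlonglongrightarrow> arrival_rate P i * t * max 0 (min 1 z)"
proof (cases "z < 0")
  case True
  have "{m \<in> {1..arrivals P W \<omega> (r n) i t}. mark W i m \<omega> \<le> z} = {}" for n
  proof -
    have "0 \<le> mark W i m \<omega>" if "1 \<le> m" for m using mark_range[OF that omega, of i] by simp
    then show ?thesis using True by (fastforce dest: order_trans)
  qed
  then have "marks_upto n i z t = 0" for n unfolding marks_upto_def by (simp only: card.empty of_nat_0 div_0)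
  then show ?thesis using True by simp
next
  case False
  define c where "c = max 0 (min 1 z)"
  have c: "0 \<le> c" "c \<le> 1" by (auto simp: c_def)
  define l where "l = arrival_rate P i * t"
  have l: "0 \<le> l" using t arrival_rate_pos[of i] by (simp add: l_def)
  define s where "s = (\<lambda>n. real (arrivals P W \<omega> (r n) i t) / r n)"
  have s: "s \<longlonglongrightarrow> l" using arrivals_lim[OF t, of i] by (simp add: s_def l_def)
  have s0: "0 \<le> s n" for n using r_pos[of n] by (simp add: s_def)
  let ?G = "\<lambda>n (\<sigma>, \<zeta>). (\<Sum>m = 1..nat \<lfloor>scaling P n * \<sigma>\<rfloor>. indicator {..\<zeta>} (mark W i m \<omega>)) / scaling P n :: real"
  have "uoc_limit ({0..} \<times> {0..1}) ?G (\<lambda>(\<sigma>, \<zeta>). \<sigma> * \<zeta>)"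
    using lln by (auto simp: lln_realization_def)
  then have "uniform_limit ({0..l + 1} \<times> {c}) ?G (\<lambda>(\<sigma>, \<zeta>). \<sigma> * \<zeta>) sequentially"
  proof -
    have "compact ({0..l + 1} \<times> {c})" "{0..l + 1} \<times> {c} \<subseteq> {0..} \<times> {0..1}"
      using c by (auto intro: compact_Times)
    moreover assume "uoc_limit ({0..} \<times> {0..1}) ?G (\<lambda>(\<sigma>, \<zeta>). \<sigma> * \<zeta>)"
    ultimately show ?thesis unfolding uoc_limit_def by blast
  qed
  then have ul: "uniform_limit ({0..l + 1} \<times> {c}) (\<lambda>n. ?G (\<phi> n)) (\<lambda>(\<sigma>, \<zeta>). \<sigma> * \<zeta>) sequentially"
    using filterlim_compose[OF _ filterlim_subseq[OF subseq]] by fastforce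
  have G: "?G (\<phi> n) (s n, c) = marks_upto n i z t" for n
  proof -
    have "nat \<lfloor>r n * s n\<rfloor> = arrivals P W \<omega> (r n) i t" using r_pos[of n] by (simp add: s_def)
    moreover have "(\<Sum>m = 1..N. indicator {..c} (mark W i m \<omega>)) = real (card {m \<in> {1..N}. mark W i m \<omega> \<le> z})" for N
    proof -
      have "mark W i m \<omega> \<le> c \<longleftrightarrow> mark W i m \<omega> \<le> z" if "1 \<le> m" for m
        using mark_range[OF that omega, of i] False by (auto simp: c_def)
      then have "(\<Sum>m = 1..N. indicator {..c} (mark W i m \<omega>)) = (\<Sum>m = 1..N. if mark W i m \<omega> \<le> z then 1 else 0 :: real)"
        by (intro sum.cong) (auto simp: indicator_def)
      also have "\<dots> = real (card {m \<in> {1..N}. mark W i m \<omega> \<le> z})"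
        by (simp add: sum.inter_filter[symmetric])
      finally show ?thesis .
    qed
    ultimately show ?thesis by (simp add: marks_upto_def)
  qed
  have ev: "\<forall>\<^sub>F n in sequentially. s n < l + 1" using order_tendstoD(2)[OF s] by simp
  have "(\<lambda>n. marks_upto n i z t - s n * c) \<longlonglongrightarrow> 0"
  proof (rule tendstoI)
    fix h :: real assume "0 < h"
    from uniform_limitD[OF ul this] ev
    show "\<forall>\<^sub>F n in sequentially. dist (marks_upto n i z t - s n * c) 0 < h"
    proof eventually_elim
      case (elim n)
      have "(s n, c) \<in> {0..l + 1} \<times> {c}" using elim(2) s0[of n] by simp
      then have "dist (?G (\<phi> n) (s n, c)) (s n * c) < h" using elim(1) by fastforce
      then show ?case unfolding G by (simp add: dist_real_def)
    qed
  qed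
  from tendsto_add[OF this tendsto_mult[OF s tendsto_const[of c]]] show ?thesis
    by (simp add: c_def l_def)
qed

text \<open>For \<open>n\<close> large and times close to \<open>t\<close>, every state seen by an arrival is close to the fluid state at \<open>t\<close>, so
  \<open>placement_interval\<close> bounds the number of placements between two numbers of marks, whose limits are
  known. The error \<open>3 * e\<close> covers both widenings.\<close>

lemma arrivals_local_rate:
  assumes k: "k \<in> fit_set P i" and t: "0 < t" and pos: "0 < fit_mass P i (\<lambda>l. state l t)" and e: "0 < e"
  obtains \<delta> where "0 < \<delta>" "\<delta> \<le> t"
    "\<And>t1 t2. t - \<delta> < t1 \<Longrightarrow> t1 \<le> t2 \<Longrightarrow> t2 < t + \<delta> \<Longrightarrow>
      \<bar>a (add_cust i k, i) t2 - a (add_cust i k, i) t1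
        - arrival_rate P i * (state k t / fit_mass P i (\<lambda>l. state l t)) * (t2 - t1)\<bar>
      \<le> arrival_rate P i * (3 * e) * (t2 - t1)"
proof -
  let ?y = "\<lambda>l. state l t"
  let ?e = "(add_cust i k, i)"
  have edge: "?e \<in> edges P" using k by (simp add: edges_add_iff fit_set_add)
  have y0: "0 \<le> ?y l" if "l \<in> Kbar P" for l using state_nonneg[OF that] t by simp
  obtain \<alpha> \<beta> h where ab: "0 \<le> \<alpha>" "\<beta> \<le> 1" "\<beta> - \<alpha> = state k t / fit_mass P i ?y" and h: "0 < h"
    and place: "\<forall>u r z. 1 \<le> r \<longrightarrow> (\<forall>l\<in>Kbar P. \<bar>real (u l) / r - ?y l\<bar> \<le> h) \<longrightarrow>
      (placed_along P i u z (add_cust i k) \<longrightarrow> \<alpha> - 2 * e < z \<and> z \<le> \<beta> + e) \<and>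
      (\<alpha> + e < z \<and> z \<le> \<beta> - e \<longrightarrow> placed_along P i u z (add_cust i k))"
    by (rule placement_interval[OF k y0 pos e])
  have le_ab: "\<alpha> \<le> \<beta>"
  proof -
    have "0 \<le> state k t / fit_mass P i ?y"
      using state_nonneg[OF fit_set_Kbar[OF k], of t] t pos by simp
    then show ?thesis using ab(3) by simp
  qed
  have "\<exists>d>0. \<forall>u. 0 \<le> u \<and> \<bar>u - t\<bar> < d \<longrightarrow> \<bar>state l u - state l t\<bar> < h / 2" if l: "l \<in> Kbar P" for l
  proof -
    have "t \<in> {0..}" "0 < h / 2" using t h by auto
    then obtain d where "0 < d" "\<forall>u\<in>{0..}. dist u t < d \<longrightarrow> dist (state l u) (state l t) < h / 2"
      using state_continuous[OF l] unfolding continuous_on_iff by metis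
    then show ?thesis by (intro exI[of _ d]) (auto simp: dist_real_def)
  qed
  then obtain dl where dl: "\<And>l. l \<in> Kbar P \<Longrightarrow> 0 < dl l"
    "\<And>l u. l \<in> Kbar P \<Longrightarrow> 0 \<le> u \<Longrightarrow> \<bar>u - t\<bar> < dl l \<Longrightarrow> \<bar>state l u - state l t\<bar> < h / 2"
    by metis
  define \<delta> where "\<delta> = Min (insert (min t 1) (dl ` Kbar P))"
  have \<delta>: "0 < \<delta>" "\<delta> \<le> t" "\<delta> \<le> 1" "\<And>l. l \<in> Kbar P \<Longrightarrow> \<delta> \<le> dl l"
  proof -
    show "0 < \<delta>" unfolding \<delta>_def using t dl(1) by (subst Min_gr_iff) auto
    have "\<delta> \<le> min t 1" unfolding \<delta>_def by (intro Min_le) auto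
    then show "\<delta> \<le> t" "\<delta> \<le> 1" by auto
    show "\<delta> \<le> dl l" if "l \<in> Kbar P" for l unfolding \<delta>_def using that by (intro Min_le) auto
  qed
  have "\<forall>\<^sub>F n in sequentially. \<forall>l\<in>Kbar P. \<forall>u\<in>{0..t + 1}. dist (real (X n u l) / r n) (state l u) < h / 2"
    using h by (intro eventually_ball_finite ballI finite_Kbar uniform_limitD[OF state_lim]) auto
  then have near: "\<forall>\<^sub>F n in sequentially. \<forall>u l. l \<in> Kbar P \<longrightarrow> t - \<delta> < u \<longrightarrow> u < t + \<delta> \<longrightarrow>
      \<bar>real (X n u l) / r n - ?y l\<bar> \<le> h"
  proof eventually_elim
    case (elim n)
    show ?case
    proof (intro allI impI)
      fix u l assume l: "l \<in> Kbar P" and u: "t - \<delta> < u" "u < t + \<delta>"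
      have "\<bar>state l u - state l t\<bar> < h / 2" using l u \<delta>(2) \<delta>(4)[OF l] by (intro dl) auto
      moreover have "\<bar>real (X n u l) / r n - state l u\<bar> < h / 2"
        using elim l u \<delta>(2,3) by (auto simp: dist_real_def)
      ultimately show "\<bar>real (X n u l) / r n - ?y l\<bar> \<le> h" by linarith
    qed
  qed
  show thesis
  proof (rule that[OF \<delta>(1,2)])
    fix t1 t2 assume t12: "t - \<delta> < t1" "t1 \<le> t2" "t2 < t + \<delta>"
    then have pos12: "0 < t1" "0 < t2" using \<delta>(2) by auto
    have sandwich: "\<forall>\<^sub>F n in sequentially.
       (marks_upto n i (\<beta> - e) t2 - marks_upto n i (\<beta> - e) t1) - (marks_upto n i (\<alpha> + e) t2 - marks_upto n i (\<alpha> + e) t1)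
         \<le> real (A n ?e t2) / r n - real (A n ?e t1) / r n \<and>
       real (A n ?e t2) / r n - real (A n ?e t1) / r n
         \<le> (marks_upto n i (\<beta> + e) t2 - marks_upto n i (\<beta> + e) t1) - (marks_upto n i (\<alpha> - 2 * e) t2 - marks_upto n i (\<alpha> - 2 * e) t1)"
      using near
    proof eventually_elim
      case (elim n)
      define I where "I = {arrivals P W \<omega> (r n) i t1<..arrivals P W \<omega> (r n) i t2}"
      define S where "S = (\<lambda>m. state_before (X n) (arrival_time P W \<omega> (r n) i m))"
      define Z where "Z = (\<lambda>m. mark W i m \<omega>)"
      have le: "arrivals P W \<omega> (r n) i t1 \<le> arrivals P W \<omega> (r n) i t2"
        using t12 pos12 by (intro arrivals_mono) auto
      have inc: "marks_upto n i z t2 - marks_upto n i z t1 = real (card {m \<in> I. Z m \<le> z}) / r n" for z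
        unfolding marks_upto_def I_def Z_def card_initial_segment_diff[OF le] by (simp add: diff_divide_distrib)
      have incA: "real (A n ?e t2) / r n - real (A n ?e t1) / r n
          = real (card {m \<in> I. placed_along P i (S m) (Z m) (add_cust i k)}) / r n"
        using pos12 unfolding I_def S_def Z_def card_initial_segment_diff[OF le]
        by (simp add: path_arrivals[OF _ edge] diff_divide_distrib)
      have rules: "placed_along P i (S m) (Z m) (add_cust i k) \<Longrightarrow> \<alpha> - 2 * e < Z m \<and> Z m \<le> \<beta> + e"
        "\<alpha> + e < Z m \<Longrightarrow> Z m \<le> \<beta> - e \<Longrightarrow> placed_along P i (S m) (Z m) (add_cust i k)" if m: "m \<in> I" for m
      proof -
        let ?\<tau> = "arrival_time P W \<omega> (r n) i m"
        have \<tau>: "t1 \<le> ?\<tau>" "?\<tau> \<le> t2"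
          using arrival_time_bounds[OF pos12(1) t12(2)] m by (auto simp: I_def)
        have "\<forall>\<^sub>F u in at_left ?\<tau>. t - \<delta> < u \<and> u < ?\<tau>"
          unfolding eventually_at_left_field using \<tau> t12 by (intro exI[of _ "t - \<delta>"]) auto
        moreover have "\<forall>\<^sub>F u in at_left ?\<tau>. \<forall>l\<in>Kbar P. X n u l = S m l"
          unfolding S_def using \<tau> pos12 by (intro state_before_attained) auto
        ultimately have "\<forall>\<^sub>F u in at_left ?\<tau>. (t - \<delta> < u \<and> u < ?\<tau>) \<and> (\<forall>l\<in>Kbar P. X n u l = S m l)"
          by (rule eventually_conj)
        then obtain u where u: "t - \<delta> < u" "u < ?\<tau>" "\<And>l. l \<in> Kbar P \<Longrightarrow> X n u l = S m l"
          using eventually_happens'[OF trivial_limit_at_left_real] by blast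
        have "\<bar>real (S m l) / r n - ?y l\<bar> \<le> h" if "l \<in> Kbar P" for l
          using elim that u \<tau> t12 by (metis order_less_trans order_le_less_trans)
        then show "placed_along P i (S m) (Z m) (add_cust i k) \<Longrightarrow> \<alpha> - 2 * e < Z m \<and> Z m \<le> \<beta> + e"
          "\<alpha> + e < Z m \<Longrightarrow> Z m \<le> \<beta> - e \<Longrightarrow> placed_along P i (S m) (Z m) (add_cust i k)"
          using place r_ge_1[of n] by blast+
      qed
      have fin: "finite I" by (simp add: I_def)
      let ?pl = "{m \<in> I. placed_along P i (S m) (Z m) (add_cust i k)}"
      have "card {m \<in> I. Z m \<le> \<beta> - e} \<le> card ({m \<in> I. Z m \<le> \<alpha> + e} \<union> ?pl)"
      proof (intro card_mono subsetI)
        fix m assume "m \<in> {m \<in> I. Z m \<le> \<beta> - e}"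
        then show "m \<in> {m \<in> I. Z m \<le> \<alpha> + e} \<union> ?pl"
          using rules(2)[of m] by (cases "Z m \<le> \<alpha> + e") auto
      qed (use fin in simp)
      also have "\<dots> \<le> card {m \<in> I. Z m \<le> \<alpha> + e} + card ?pl" by (rule card_Un_le)
      finally have lower: "real (card {m \<in> I. Z m \<le> \<beta> - e}) - real (card {m \<in> I. Z m \<le> \<alpha> + e}) \<le> real (card ?pl)"
        by simp
      have "card (?pl \<union> {m \<in> I. Z m \<le> \<alpha> - 2 * e}) = card ?pl + card {m \<in> I. Z m \<le> \<alpha> - 2 * e}"
        using fin rules(1) by (intro card_Un_disjoint) force+
      moreover have "card (?pl \<union> {m \<in> I. Z m \<le> \<alpha> - 2 * e}) \<le> card {m \<in> I. Z m \<le> \<beta> + e}"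
      proof (intro card_mono subsetI)
        fix m assume "m \<in> ?pl \<union> {m \<in> I. Z m \<le> \<alpha> - 2 * e}"
        then show "m \<in> {m \<in> I. Z m \<le> \<beta> + e}" using rules(1)[of m] le_ab e by auto
      qed (use fin in simp)
      ultimately have upper: "real (card ?pl) \<le> real (card {m \<in> I. Z m \<le> \<beta> + e}) - real (card {m \<in> I. Z m \<le> \<alpha> - 2 * e})"
        by simp
      show ?case unfolding inc incA unfolding diff_divide_distrib[symmetric]
        using lower upper r_pos[of n] by (auto intro!: divide_right_mono)
    qed
    let ?c = "\<lambda>z. max 0 (min 1 z) :: real"
    have mlim: "(\<lambda>n. (marks_upto n i z t2 - marks_upto n i z t1) - (marks_upto n i z' t2 - marks_upto n i z' t1))
       \<longlonglongrightarrow> (arrival_rate P i * t2 * ?c z - arrival_rate P i * t1 * ?c z)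
          - (arrival_rate P i * t2 * ?c z' - arrival_rate P i * t1 * ?c z')" for z z'
      using pos12 by (intro tendsto_intros marks_upto_lim) auto
    have alim: "(\<lambda>n. real (A n ?e t2) / r n - real (A n ?e t1) / r n) \<longlonglongrightarrow> a ?e t2 - a ?e t1"
      using pos12 by (intro tendsto_intros a_tendsto edge) auto
    define q where "q = arrival_rate P i * (t2 - t1)"
    have q: "0 \<le> q" using arrival_rate_pos[of i] t12 by (simp add: q_def)
    have "(arrival_rate P i * t2 * ?c (\<beta> - e) - arrival_rate P i * t1 * ?c (\<beta> - e))
          - (arrival_rate P i * t2 * ?c (\<alpha> + e) - arrival_rate P i * t1 * ?c (\<alpha> + e)) \<le> a ?e t2 - a ?e t1"
      using sandwich by (intro tendsto_le[OF _ alim mlim]) (auto elim: eventually_mono)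
    then have lower: "q * (?c (\<beta> - e) - ?c (\<alpha> + e)) \<le> a ?e t2 - a ?e t1"
      by (simp add: q_def algebra_simps)
    have "a ?e t2 - a ?e t1 \<le> (arrival_rate P i * t2 * ?c (\<beta> + e) - arrival_rate P i * t1 * ?c (\<beta> + e))
          - (arrival_rate P i * t2 * ?c (\<alpha> - 2 * e) - arrival_rate P i * t1 * ?c (\<alpha> - 2 * e))"
      using sandwich by (intro tendsto_le[OF _ mlim alim]) (auto elim: eventually_mono)
    then have upper: "a ?e t2 - a ?e t1 \<le> q * (?c (\<beta> + e) - ?c (\<alpha> - 2 * e))"
      by (simp add: q_def algebra_simps)
    have "q * (\<beta> - \<alpha> - 3 * e) \<le> q * (?c (\<beta> - e) - ?c (\<alpha> + e))"
      using q ab e le_ab by (intro mult_left_mono) auto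
    moreover have "q * (?c (\<beta> + e) - ?c (\<alpha> - 2 * e)) \<le> q * (\<beta> - \<alpha> + 3 * e)"
      using q ab e le_ab by (intro mult_left_mono) auto
    ultimately have "\<bar>a ?e t2 - a ?e t1 - q * (\<beta> - \<alpha>)\<bar> \<le> q * (3 * e)"
      using lower upper by (simp add: abs_le_iff algebra_simps)
    then show "\<bar>a ?e t2 - a ?e t1 - arrival_rate P i * (state k t / fit_mass P i ?y) * (t2 - t1)\<bar>
      \<le> arrival_rate P i * (3 * e) * (t2 - t1)"
      unfolding ab(3)[symmetric] q_def by (simp add: mult_ac)
  qed
qed

lemma arrivals_derivative:
  assumes k: "k \<in> fit_set P i" and t: "0 < t" and pos: "0 < fit_mass P i (\<lambda>l. state l t)"
  shows "(a (add_cust i k, i) has_real_derivative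
    arrival_rate P i * state k t / fit_mass P i (\<lambda>l. state l t)) (at t)"
proof -
  let ?a = "a (add_cust i k, i)"
  define q where "q = arrival_rate P i * (state k t / fit_mass P i (\<lambda>l. state l t))"
  have "(\<lambda>y. (?a y - ?a t) / (y - t)) \<midarrow>t\<rightarrow> q"
  proof (rule LIM_I)
    fix h :: real assume h: "0 < h"
    define e where "e = h / (6 * arrival_rate P i)"
    have e: "0 < e" "arrival_rate P i * (3 * e) < h"
      using h arrival_rate_pos[of i] by (simp_all add: e_def)
    obtain \<delta> where \<delta>: "0 < \<delta>"
      "\<And>t1 t2. t - \<delta> < t1 \<Longrightarrow> t1 \<le> t2 \<Longrightarrow> t2 < t + \<delta> \<Longrightarrow>
        \<bar>?a t2 - ?a t1 - q * (t2 - t1)\<bar> \<le> arrival_rate P i * (3 * e) * (t2 - t1)"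
      using arrivals_local_rate[OF k t pos e(1), folded q_def] by metis
    have "\<bar>(?a y - ?a t) / (y - t) - q\<bar> < h" if y: "y \<noteq> t" "\<bar>y - t\<bar> < \<delta>" for y
    proof -
      have "\<bar>?a y - ?a t - q * (y - t)\<bar> \<le> arrival_rate P i * (3 * e) * \<bar>y - t\<bar>"
      proof (cases "y \<le> t")
        case True
        have "\<bar>?a t - ?a y - q * (t - y)\<bar> \<le> arrival_rate P i * (3 * e) * (t - y)"
          using y True \<delta>(1) by (intro \<delta>(2)) auto
        moreover have "?a y - ?a t - q * (y - t) = - (?a t - ?a y - q * (t - y))"
          by (simp add: algebra_simps)
        ultimately show ?thesis using True by (metis abs_minus_cancel abs_minus_commute abs_of_nonneg diff_ge_0_iff_ge)
      next
        case False
        then show ?thesis using y \<delta>(1) \<delta>(2)[of t y] by auto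
      qed
      also have "\<dots> < h * \<bar>y - t\<bar>" using e y by (intro mult_strict_right_mono) auto
      finally have "\<bar>?a y - ?a t - q * (y - t)\<bar> / \<bar>y - t\<bar> < h" using y by (simp add: divide_less_eq)
      moreover have "(?a y - ?a t) / (y - t) - q = (?a y - ?a t - q * (y - t)) / (y - t)"
        using y by (simp add: diff_divide_distrib)
      ultimately show ?thesis by (simp add: abs_divide)
    qed
    then show "\<exists>s>0. \<forall>y. y \<noteq> t \<and> norm (y - t) < s \<longrightarrow> norm ((?a y - ?a t) / (y - t) - q) < h"
      using \<delta>(1) by (intro exI[of _ \<delta>]) auto
  qed
  then show ?thesis by (simp add: has_field_derivative_iff q_def)
qed

end

section \<open>Exponential decay of the Lyapunov function\<close>

text \<open>A quantity that dissipates exponentially below a threshold never crosses the threshold from below: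
  up to the first crossing time it is nonincreasing.\<close>

lemma local_exponential_decay:
  fixes V :: "real \<Rightarrow> real"
  assumes cont: "continuous_on {0..} V" and c: "0 \<le> c" and init: "0 \<le> V 0" "V 0 < v"
    and der: "\<And>t. 0 < t \<Longrightarrow> V t < v \<Longrightarrow> \<exists>D. (V has_real_derivative D) (at t) \<and> D \<le> - c * V t"
    and t: "0 \<le> t"
  shows "V t \<le> V 0 * exp (- c * t)"
proof -
  have decay: "V t \<le> V 0 * exp (- c * t)" if t: "0 \<le> t" and below: "\<And>s. 0 \<le> s \<Longrightarrow> s < t \<Longrightarrow> V s < v" for t
  proof -
    have "V t * exp (c * t) \<le> V 0 * exp (c * 0)"
    proof (rule DERIV_nonpos_imp_decreasing_open[OF t])
      show "continuous_on {0..t} (\<lambda>s. V s * exp (c * s))"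
        by (intro continuous_intros continuous_on_subset[OF cont]) auto
      fix s assume s: "0 < s" "s < t"
      then obtain D where D: "(V has_real_derivative D) (at s)" "D \<le> - c * V s"
        using der below[of s] by auto
      have "((\<lambda>s. V s * exp (c * s)) has_real_derivative (D + c * V s) * exp (c * s)) (at s)"
        by (rule derivative_eq_intros D(1) refl)+ (simp add: algebra_simps)
      moreover have "(D + c * V s) * exp (c * s) \<le> 0"
        using D(2) by (intro mult_nonpos_nonneg) auto
      ultimately show "\<exists>y. ((\<lambda>s. V s * exp (c * s)) has_real_derivative y) (at s) \<and> y \<le> 0" by blast
    qed
    then have "V t * exp (c * t) * exp (- c * t) \<le> V 0 * exp (- c * t)"
      by (intro mult_right_mono) auto
    then show ?thesis by (simp add: mult.assoc flip: exp_add)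
  qed
  have "V s < v" if "0 \<le> s" for s
  proof (rule ccontr)
    assume "\<not> V s < v"
    define S where "S = {0..} \<inter> V -` {v..}"
    have S: "S \<noteq> {}" "closed S" "bdd_below S"
      using \<open>\<not> V s < v\<close> that continuous_closed_preimage[OF cont] unfolding S_def
      by (auto intro: bdd_belowI[of _ 0])
    define t0 where "t0 = Inf S"
    have t0: "0 \<le> t0" "v \<le> V t0"
      using closed_contains_Inf[OF S(1,3,2)] by (auto simp: t0_def S_def)
    have "V s < v" if "0 \<le> s" "s < t0" for s
    proof (rule ccontr)
      assume "\<not> V s < v"
      then have "t0 \<le> s" unfolding t0_def using S(3) that by (intro cInf_lower) (auto simp: S_def)
      then show False using that by simp
    qed
    then have "V t0 \<le> V 0 * exp (- c * t0)" by (intro decay t0) auto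
    also have "\<dots> \<le> V 0 * 1" using init c t0 by (intro mult_left_mono) auto
    finally show False using init t0 by simp
  qed
  then show ?thesis using decay t by blast
qed

context equilibrium
begin

definition mass :: real where "mass = (\<Sum>k\<in>Kbar P. p k)"

lemma mass_pos: "0 < mass"
  unfolding mass_def using p_pos zero_in_Kbar by (intro sum_pos) auto

text \<open>Together with the bound of the deviation by the energy, this relates the Lyapunov function to the distance
  from the equilibrium in both directions.\<close>

lemma lyapunov_upper_bound:
  assumes u: "\<And>k. k \<in> Kbar P \<Longrightarrow> \<bar>u k\<bar> \<le> h" and b: "0 \<le> b"
  shows "energy u / 2 + b * load_energy u \<le> (mass / 2 + b * real (CARD('i))) * h\<^sup>2"
proof -
  have h: "0 \<le> h" using u[OF zero_in_Kbar] abs_ge_zero order_trans by blast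
  have "energy u \<le> (\<Sum>k\<in>Kbar P. p k * h\<^sup>2)"
    unfolding energy_def
  proof (rule sum_mono)
    fix k assume k: "k \<in> Kbar P"
    have "(u k)\<^sup>2 \<le> h\<^sup>2" using u[OF k] by (simp add: abs_le_square_iff[symmetric] h)
    then show "p k * (u k)\<^sup>2 \<le> p k * h\<^sup>2" using p_pos[OF k] by simp
  qed
  then have 1: "energy u \<le> mass * h\<^sup>2" by (simp add: mass_def sum_distrib_right)
  have "\<bar>load_dev i u\<bar> \<le> h" for i
  proof -
    have "\<bar>\<Sum>k\<in>Kbar P. real (fst k i) * (p k * u k)\<bar> \<le> (\<Sum>k\<in>Kbar P. real (fst k i) * p k * h)"
    proof (rule abs_sum_le)
      fix k assume k: "k \<in> Kbar P"
      have "real (fst k i) * p k * \<bar>u k\<bar> \<le> real (fst k i) * p k * h"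
        using u[OF k] p_pos[OF k] by (intro mult_left_mono) auto
      then show "\<bar>real (fst k i) * (p k * u k)\<bar> \<le> real (fst k i) * p k * h"
        using p_pos[OF k] by (simp add: abs_mult mult.assoc)
    qed
    also have "\<dots> = load P i * h" by (simp add: load_eq flip: sum_distrib_right)
    finally show ?thesis using load_pos[of i] by (simp add: load_dev_def abs_divide divide_le_eq mult.commute)
  qed
  then have "(load_dev i u)\<^sup>2 \<le> h\<^sup>2" for i by (simp add: abs_le_square_iff[symmetric] h)
  then have "load_energy u \<le> (\<Sum>i\<in>(UNIV::'i set). h\<^sup>2)" unfolding load_energy_def by (rule sum_mono)
  then have "b * load_energy u \<le> b * (real (CARD('i)) * h\<^sup>2)" using b by (intro mult_left_mono) auto
  then show ?thesis using 1 by (simp add: algebra_simps)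
qed

end

locale fluid_equilibrium = fluid_limit P W x d a \<omega> \<phi> X D A + equilibrium P p
  for P :: "('i::finite, 's::finite) server_system" and W :: "('i, 's, 'w) primitives"
    and x d a \<omega> \<phi> X D A p
begin

definition dev :: "real \<Rightarrow> ('i, 's) config \<Rightarrow> real" where
  "dev t k = state k t / p k - 1"

lemma scaled_dev: "k \<in> Kbar P \<Longrightarrow> scaled (dev t) k = state k t"
  using p_pos[of k] by (simp add: scaled_def dev_def)

lemma p_dev: "k \<in> Kbar P \<Longrightarrow> p k * dev t k = state k t - p k"
  using p_pos[of k] by (simp add: dev_def right_diff_distrib)

lemma fit_mass_state: "fit_mass P i (scaled (dev t)) = fit_mass P i (\<lambda>l. state l t)"
  unfolding fit_mass_def by (intro sum.cong refl) (simp add: scaled_dev fit_set_Kbar)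

lemma net_flow_state:
  "k \<in> fit_set P i \<Longrightarrow> net_flow i k (scaled (dev t)) = net_flow i k (\<lambda>l. state l t)"
  by (simp add: net_flow_def fit_mass_state scaled_dev fit_set_Kbar fit_set_add)

lemma dev_total: "(\<Sum>k\<in>Kbar_of P s. p k * dev t k) = 0"
proof -
  have "(\<Sum>k\<in>Kbar_of P s. p k * dev t k) = (\<Sum>k\<in>Kbar_of P s. state k t - p k)"
    by (intro sum.cong refl p_dev) (simp add: Kbar_of_def)
  then show ?thesis using p_feasible by (simp add: sum_subtractf state_total feasible_def)
qed

text \<open>The fluid equation in weak form. Time \<open>0\<close> is excluded, where only a one-sided derivative exists.\<close>

lemma weak_derivative:
  assumes t: "0 < t" and pos: "\<And>i. 0 < fit_mass P i (\<lambda>l. state l t)"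
  shows "((\<lambda>s. \<Sum>k\<in>Kbar P. f k * state k s) has_real_derivative
    (\<Sum>i\<in>UNIV. \<Sum>k\<in>fit_set P i. (f (add_cust i k) - f k) * net_flow i k (\<lambda>l. state l t))) (at t)"
proof -
  have "((\<lambda>s. (\<Sum>k\<in>Kbar P. f k * state k 0) + (\<Sum>i\<in>UNIV. \<Sum>k\<in>fit_set P i.
      (f (add_cust i k) - f k) * (a (add_cust i k, i) s - d (add_cust i k, i) s))) has_real_derivative
    0 + (\<Sum>i\<in>UNIV. \<Sum>k\<in>fit_set P i. (f (add_cust i k) - f k) * net_flow i k (\<lambda>l. state l t))) (at t)"
  proof (intro DERIV_add DERIV_const DERIV_sum DERIV_cmult)
    fix i k assume k: "k \<in> fit_set P i"
    then have e: "(add_cust i k, i) \<in> edges P" by (simp add: edges_add_iff fit_set_add)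
    show "((\<lambda>s. a (add_cust i k, i) s - d (add_cust i k, i) s) has_real_derivative
        net_flow i k (\<lambda>l. state l t)) (at t)"
      using DERIV_diff[OF arrivals_derivative[OF k t pos] departures_derivative[OF e t]]
      by (simp add: net_flow_def fst_add_cust mult_ac)
  qed
  then have "((\<lambda>s. (\<Sum>k\<in>Kbar P. f k * state k 0) + (\<Sum>i\<in>UNIV. \<Sum>k\<in>fit_set P i.
      (f (add_cust i k) - f k) * (a (add_cust i k, i) s - d (add_cust i k, i) s))) has_real_derivative
    (\<Sum>i\<in>UNIV. \<Sum>k\<in>fit_set P i. (f (add_cust i k) - f k) * net_flow i k (\<lambda>l. state l t))) (at t)" by simp
  then show ?thesis
  proof (rule has_field_derivative_transform_within_open[where S = "{0<..}"])
    fix s :: real assume "s \<in> {0<..}"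
    then show "(\<Sum>k\<in>Kbar P. f k * state k 0) + (\<Sum>i\<in>UNIV. \<Sum>k\<in>fit_set P i.
      (f (add_cust i k) - f k) * (a (add_cust i k, i) s - d (add_cust i k, i) s)) = (\<Sum>k\<in>Kbar P. f k * state k s)"
      by (subst state_weak_balance[of s f, symmetric]) (auto simp: right_diff_distrib sum_subtractf)
  qed (use t in auto)
qed

definition lyapunov :: "real \<Rightarrow> real \<Rightarrow> real" where
  "lyapunov b t = energy (dev t) / 2 + b * load_energy (dev t)"

lemma load_dev_dev: "load_dev i (dev t) = (\<Sum>k\<in>Kbar P. real (fst k i) * state k t) / load P i - 1"
proof -
  have "(\<Sum>k\<in>Kbar P. real (fst k i) * (p k * dev t k)) = (\<Sum>k\<in>Kbar P. real (fst k i) * (state k t - p k))"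
    by (intro sum.cong refl) (simp add: p_dev)
  then show ?thesis
    using load_pos[of i] by (simp add: load_dev_def right_diff_distrib sum_subtractf load_eq diff_divide_distrib)
qed

lemma lyapunov_continuous: "continuous_on {0..} (lyapunov b)"
  unfolding lyapunov_def[abs_def] energy_def load_energy_def load_dev_def dev_def
  using p_pos load_pos
  by (intro continuous_intros state_continuous) (auto simp: less_imp_neq[symmetric])

text \<open>The coordinates \<open>state k\<close> are differentiated through test functions that select one configuration, and the
  chain rule for the squares then has the weak form with test function \<open>dev t\<close>. For the load, the test
  function \<open>k\<^sub>i\<close> increases by one along edges of type \<open>i\<close> and is constant along the others, so \<open>sum_imbalance\<close>
  applies.\<close>

lemma lyapunov_derivative:
  assumes t: "0 < t" and pos: "\<And>i. 0 < 1 + fit_dev i (dev t)"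
  shows "(lyapunov b has_real_derivative
    (\<Sum>i\<in>UNIV. \<Sum>k\<in>fit_set P i. (dev t (add_cust i k) - dev t k) * net_flow i k (scaled (dev t)))
     - 2 * b * (\<Sum>i\<in>UNIV. service_rate P i * (load_dev i (dev t))\<^sup>2)) (at t)"
proof -
  have fm: "0 < fit_mass P i (\<lambda>l. state l t)" for i
    unfolding fit_mass_state[symmetric] fit_mass_scaled using fit_mass_pos pos by simp
  note wd = weak_derivative[OF t fm]
  define v where "v = (\<lambda>k. \<Sum>i\<in>UNIV. \<Sum>l\<in>fit_set P i.
     (of_bool (add_cust i l = k) - of_bool (l = k)) * net_flow i l (\<lambda>l. state l t))"
  have v: "(state k has_real_derivative v k) (at t)" if k: "k \<in> Kbar P" for k
  proof -
    have "(\<lambda>s. \<Sum>l\<in>Kbar P. of_bool (l = k) * state l s) = state k"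
      using sum_unit(2)[OF k] by (simp add: fun_eq_iff mult.commute)
    then show ?thesis using wd[of "\<lambda>l. of_bool (l = k)"] by (simp add: v_def)
  qed
  have v_sum: "(\<Sum>k\<in>Kbar P. f k * v k)
      = (\<Sum>i\<in>UNIV. \<Sum>k\<in>fit_set P i. (f (add_cust i k) - f k) * net_flow i k (\<lambda>l. state l t))" for f
  proof (rule DERIV_unique[OF _ wd])
    show "((\<lambda>s. \<Sum>k\<in>Kbar P. f k * state k s) has_real_derivative (\<Sum>k\<in>Kbar P. f k * v k)) (at t)"
      by (intro DERIV_sum DERIV_cmult v)
  qed
  have "((\<lambda>s. energy (dev s)) has_real_derivative (\<Sum>k\<in>Kbar P. 2 * (dev t k * v k))) (at t)"
    unfolding energy_def
  proof (rule DERIV_sum)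
    fix k assume k: "k \<in> Kbar P"
    have "((\<lambda>s. p k * (dev s k)\<^sup>2) has_real_derivative p k * (2 * dev t k * (v k / p k))) (at t)"
      unfolding dev_def
      using p_pos[OF k] by (auto intro!: derivative_eq_intros v[OF k] simp: power2_eq_square)
    moreover have "p k * (2 * dev t k * (v k / p k)) = 2 * (dev t k * v k)" using p_pos[OF k] by simp
    ultimately show "((\<lambda>s. p k * (dev s k)\<^sup>2) has_real_derivative 2 * (dev t k * v k)) (at t)"
      by (simp only:)
  qed
  moreover have "(\<Sum>k\<in>Kbar P. 2 * (dev t k * v k))
      = 2 * (\<Sum>i\<in>UNIV. \<Sum>k\<in>fit_set P i. (dev t (add_cust i k) - dev t k) * net_flow i k (scaled (dev t)))"
    unfolding sum_distrib_left[symmetric] v_sum by (simp add: net_flow_state)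
  ultimately have e: "((\<lambda>s. energy (dev s)) has_real_derivative
      2 * (\<Sum>i\<in>UNIV. \<Sum>k\<in>fit_set P i. (dev t (add_cust i k) - dev t k) * net_flow i k (scaled (dev t)))) (at t)"
    by simp
  have y: "((\<lambda>s. load_dev i (dev s)) has_real_derivative - (service_rate P i * load_dev i (dev t))) (at t)" for i
  proof -
    have "(\<Sum>j\<in>UNIV. \<Sum>k\<in>fit_set P j. (real (fst (add_cust j k) i) - real (fst k i)) * net_flow j k (\<lambda>l. state l t))
        = (\<Sum>j\<in>UNIV. if j = i then \<Sum>k\<in>fit_set P j. net_flow j k (\<lambda>l. state l t) else 0)"
      by (intro sum.cong refl) (simp add: fst_add_cust)
    also have "\<dots> = (\<Sum>k\<in>fit_set P i. net_flow i k (\<lambda>l. state l t))" by simp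
    also have "\<dots> = (\<Sum>k\<in>fit_set P i. - (flow i k * imbalance i k (dev t)))"
      by (intro sum.cong refl) (simp add: net_flow_state[symmetric] net_flow_scaled pos)
    also have "\<dots> = - (arrival_rate P i * load_dev i (dev t))"
      by (simp add: sum_negf sum_imbalance pos)
    finally have "((\<lambda>s. \<Sum>k\<in>Kbar P. real (fst k i) * state k s) has_real_derivative
       - (arrival_rate P i * load_dev i (dev t))) (at t)" using wd[of "\<lambda>k. real (fst k i)"] by simp
    then have "((\<lambda>s. (\<Sum>k\<in>Kbar P. real (fst k i) * state k s) / load P i - 1) has_real_derivative
       - (arrival_rate P i * load_dev i (dev t)) / load P i - 0) (at t)"
      by (intro DERIV_diff DERIV_cdivide DERIV_const)
    moreover have "- (arrival_rate P i * load_dev i (dev t)) / load P i - 0 = - (service_rate P i * load_dev i (dev t))"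
      using arrival_rate_pos[of i] service_rate_pos[of i] by (simp add: load_def)
    ultimately show ?thesis unfolding load_dev_dev[of i, symmetric] by (simp only:)
  qed
  have "((\<lambda>s. load_energy (dev s)) has_real_derivative
      (\<Sum>i\<in>UNIV. 2 * load_dev i (dev t) * - (service_rate P i * load_dev i (dev t)))) (at t)"
    unfolding load_energy_def
    by (rule DERIV_sum) (auto intro!: derivative_eq_intros y simp: power2_eq_square)
  then have l: "((\<lambda>s. load_energy (dev s)) has_real_derivative
      - 2 * (\<Sum>i\<in>UNIV. service_rate P i * (load_dev i (dev t))\<^sup>2)) (at t)"
    by (simp add: sum_distrib_left sum_negf power2_eq_square mult_ac)
  have "((\<lambda>s. energy (dev s) / 2 + b * load_energy (dev s)) has_real_derivative
      2 * (\<Sum>i\<in>UNIV. \<Sum>k\<in>fit_set P i. (dev t (add_cust i k) - dev t k) * net_flow i k (scaled (dev t))) / 2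
      + b * (- 2 * (\<Sum>i\<in>UNIV. service_rate P i * (load_dev i (dev t))\<^sup>2))) (at t)"
    by (intro DERIV_add DERIV_cdivide DERIV_cmult e l)
  then show ?thesis unfolding lyapunov_def[abs_def] by (simp add: mult_ac)
qed

text \<open>The threshold \<open>m * h\<^sup>2 / 2\<close> guarantees \<open>\<bar>dev t k\<bar> \<le> h\<close>, since \<open>m\<close> bounds the weights of the energy
  from below.\<close>

lemma lyapunov_decays:
  assumes h: "0 < h" "h \<le> 1/2" and b: "0 < b" and c: "0 < c"
    and m: "0 < m" "\<And>k. k \<in> Kbar P \<Longrightarrow> m \<le> p k"
    and dissipation: "dissipative h b c"
    and init: "lyapunov b 0 < m * h\<^sup>2 / 2" and t: "0 \<le> t"
  shows "lyapunov b t \<le> m * h\<^sup>2 / 2 * exp (- c * t)"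
proof -
  have nonneg: "0 \<le> lyapunov b s" for s
    unfolding lyapunov_def using b energy_nonneg load_energy_nonneg by simp
  have "lyapunov b t \<le> lyapunov b 0 * exp (- c * t)"
  proof (rule local_exponential_decay[OF lyapunov_continuous less_imp_le[OF c] nonneg init _ t])
    fix t assume t: "0 < t" and below: "lyapunov b t < m * h\<^sup>2 / 2"
    have "0 \<le> b * load_energy (dev t)" using b load_energy_nonneg by simp
    then have "energy (dev t) \<le> m * h\<^sup>2" using below unfolding lyapunov_def by linarith
    have small: "\<bar>dev t k\<bar> \<le> h" if k: "k \<in> Kbar P" for k
    proof -
      have "\<bar>dev t k\<bar> \<le> (1 / sqrt m) * sqrt (energy (dev t))"
        unfolding energy_def using m k by (intro abs_le_sqrt_weighted_sum) auto
      also have "\<dots> \<le> (1 / sqrt m) * sqrt (m * h\<^sup>2)"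
        using m \<open>energy (dev t) \<le> m * h\<^sup>2\<close> by (intro mult_left_mono) auto
      also have "\<dots> = h" using m h by (simp add: real_sqrt_mult)
      finally show ?thesis .
    qed
    have "0 < 1 + fit_dev i (dev t)" for i
      using fit_dev_bound[of "dev t" h i, OF small] h by linarith
    note der = lyapunov_derivative[OF t this]
    show "\<exists>D. (lyapunov b has_real_derivative D) (at t) \<and> D \<le> - c * lyapunov b t"
    proof (intro exI conjI)
      show "(\<Sum>i\<in>UNIV. \<Sum>k\<in>fit_set P i. (dev t (add_cust i k) - dev t k) * net_flow i k (scaled (dev t)))
        - 2 * b * (\<Sum>i\<in>UNIV. service_rate P i * (load_dev i (dev t))\<^sup>2) \<le> - c * lyapunov b t"
        using dissipation[unfolded dissipative_def, rule_format, OF dev_total small]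
        by (simp only: lyapunov_def)
    qed (rule der)
  qed
  also have "\<dots> \<le> m * h\<^sup>2 / 2 * exp (- c * t)" using init by (intro mult_right_mono) auto
  finally show ?thesis .
qed

lemma vec_dist_le_energy:
  assumes y: "\<And>k. k \<in> K P \<Longrightarrow> y k = p k"
  shows "vec_dist P (state_at P x t) y \<le> sqrt (mass * energy (dev t))"
proof -
  have "(\<Sum>k\<in>K P. (state_at P x t k - y k)\<^sup>2) = (\<Sum>k\<in>K P. (p k * dev t k)\<^sup>2)"
    by (intro sum.cong refl) (simp add: p_dev K_eq y state_at_def flip: state_K)
  also have "\<dots> \<le> (\<Sum>k\<in>Kbar P. (p k * dev t k)\<^sup>2)"
    by (rule sum_mono2) (auto simp: K_eq)
  also have "\<dots> \<le> (\<Sum>k\<in>Kbar P. mass * (p k * (dev t k)\<^sup>2))"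
  proof (rule sum_mono)
    fix k assume k: "k \<in> Kbar P"
    have "p k \<le> mass" unfolding mass_def using k p_pos by (intro member_le_sum) (auto intro: less_imp_le)
    then have "p k * (p k * (dev t k)\<^sup>2) \<le> mass * (p k * (dev t k)\<^sup>2)"
      using p_pos[OF k] by (intro mult_right_mono) auto
    then show "(p k * dev t k)\<^sup>2 \<le> mass * (p k * (dev t k)\<^sup>2)"
      by (simp add: power2_eq_square mult_ac)
  qed
  finally show ?thesis
    unfolding vec_dist_def L2_set_def energy_def sum_distrib_left by (rule real_sqrt_le_mono)
qed

text \<open>The distance does not see the zero configurations; their deviation is minus the sum of the others of the same
  server type, whence the factor \<open>card (Kbar P)\<close>.\<close>

lemma dev_le_vec_dist:
  assumes y: "\<And>k. k \<in> K P \<Longrightarrow> y k = p k"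
    and dist: "vec_dist P (state_at P x t) y \<le> \<epsilon>"
    and m: "0 < m" "\<And>k. k \<in> Kbar P \<Longrightarrow> m \<le> p k" and k: "k \<in> Kbar P"
  shows "\<bar>dev t k\<bar> \<le> real (card (Kbar P)) * \<epsilon> / m"
proof -
  have diff_K: "\<bar>state k t - p k\<bar> \<le> \<epsilon>" if k: "k \<in> K P" for k
  proof -
    have "\<bar>state k t - p k\<bar> = sqrt ((state_at P x t k - y k)\<^sup>2)"
      using k by (simp add: y state_at_def state_K)
    also have "\<dots> \<le> vec_dist P (state_at P x t) y"
      unfolding vec_dist_def L2_set_def using k by (intro real_sqrt_le_mono member_le_sum) auto
    finally show ?thesis using dist by simp
  qed
  have eps: "0 \<le> \<epsilon>" using dist L2_set_nonneg unfolding vec_dist_def by (rule order_trans[rotated])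
  have card: "1 \<le> card (Kbar P)" using k by (simp add: card_gt_0_iff Suc_le_eq) blast
  have "\<bar>state k t - p k\<bar> \<le> real (card (Kbar P)) * \<epsilon>"
    using k
  proof (cases rule: Kbar_cases)
    case 1
    have "\<epsilon> \<le> real (card (Kbar P)) * \<epsilon>" using mult_right_mono[OF _ eps, of 1 "real (card (Kbar P))"] card by simp
    then show ?thesis using diff_K[OF 1] by linarith
  next
    case (2 s)
    have "(\<Sum>l\<in>Kbar_of P s. state l t - p l) = 0"
      using p_feasible by (simp add: sum_subtractf state_total feasible_def)
    then have "\<bar>state k t - p k\<bar> = \<bar>\<Sum>l\<in>K_of P s. state l t - p l\<bar>"
      unfolding sum_Kbar_of_zero 2 by linarith
    also have "\<dots> \<le> (\<Sum>l\<in>K_of P s. \<epsilon>)" by (rule abs_sum_le) (auto simp: K_of_eq intro: diff_K)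
    also have "\<dots> = real (card (K_of P s)) * \<epsilon>" by simp
    also have "\<dots> \<le> real (card (Kbar P)) * \<epsilon>"
      using eps by (intro mult_right_mono) (auto intro!: card_mono simp: K_of_eq K_eq)
    finally show ?thesis .
  qed
  then have "p k * \<bar>dev t k\<bar> \<le> real (card (Kbar P)) * \<epsilon>"
    unfolding p_dev[OF k, symmetric] using p_pos[OF k] by (simp add: abs_mult)
  moreover have "m * \<bar>dev t k\<bar> \<le> p k * \<bar>dev t k\<bar>" using m(2)[OF k] by (intro mult_right_mono) auto
  ultimately show ?thesis using m(1) by (simp add: le_divide_eq mult.commute)
qed

end

context finite_server_system
begin

text \<open>Positivity of the minimiser, and with it detailed balance, rests on the feasible point that keeps empty servers
  of every type.\<close>

lemma x_opt_equilibrium: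
  assumes x: "x \<in> X_diamond P" and empty: "\<And>s. 0 < xbar P x (zero_cfg s)"
  shows "equilibrium P (xbar P (x_opt P))"
proof -
  let ?p = "xbar P (x_opt P)"
  have ne: "X_diamond P \<noteq> {}" using x by blast
  have feas: "feasible P ?p" by (rule feasible_xbar[OF x_opt_minimal(1)[OF ne]])
  note min = x_opt_minimal(2)[OF ne]
  have pos: "0 < ?p k" if k: "k \<in> Kbar P" for k
  proof -
    obtain y where "feasible P y" "0 < y k"
      using feasible_positive_at[OF feasible_xbar[OF x] empty k] by blast
    then show ?thesis using minimizer_positive[OF feas min] k by blast
  qed
  have bal: "service_rate P i * real (fst k i + 1) * ?p (add_cust i k) = arrival_rate P i * ?p k / fit_mass P i ?p"
    if k: "k \<in> fit_set P i" for i k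
    by (rule minimizer_balance[OF feas _ pos k]) (rule min)
  show ?thesis
    by unfold_locales (fact pos feas bal)+
qed

end

context equilibrium
begin

text \<open>The radius and the time depend on the equilibrium only, not on the fluid sample path.\<close>

lemma uniform_local_convergence:
  assumes W: "driving_primitives P (W :: ('i, 's, 'w) primitives)"
    and y: "\<And>k. k \<in> K P \<Longrightarrow> y k = p k"
  shows "\<exists>\<epsilon>>0. \<forall>\<delta>>0. \<exists>T\<ge>0. \<forall>x d a.
    fsp P W x d a \<and> vec_dist P (state_at P x 0) y \<le> \<epsilon> \<longrightarrow>
      (\<forall>t\<ge>T. vec_dist P (state_at P x t) y < \<delta>)"
proof -
  obtain m where m: "0 < m" "\<And>k. k \<in> Kbar P \<Longrightarrow> m \<le> p k"
    using finite_positive_lower_bound[of "Kbar P" p] p_pos by auto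
  obtain h b c where hbc: "0 < h" "h \<le> 1/2" "0 < b" "0 < c"
    and dissipation: "dissipative h b c"
    by (rule dissipative_near_equilibrium)
  define v where "v = m * h\<^sup>2 / 2"
  define C where "C = mass / 2 + b * real (CARD('i))"
  define N where "N = real (card (Kbar P))"
  \<comment> \<open>Deviations of at most \<open>\<theta>\<close> keep the Lyapunov function below its threshold \<open>v\<close>.\<close>
  define \<theta> where "\<theta> = sqrt (v / (C + 1))"
  define \<epsilon> where "\<epsilon> = m * \<theta> / N"
  have v: "0 < v" using m hbc by (simp add: v_def)
  have C: "0 \<le> C" unfolding C_def using mass_pos hbc by simp
  have "Kbar P \<noteq> {}" using zero_in_Kbar by blast
  then have N: "0 < N" by (simp add: N_def card_gt_0_iff)
  have \<theta>: "0 < \<theta>" using v C by (simp add: \<theta>_def)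
  have "C * \<theta>\<^sup>2 = C * v / (C + 1)" using v C by (simp add: \<theta>_def)
  also have "\<dots> < v" using v C by (simp add: divide_less_eq algebra_simps)
  finally have C\<theta>: "C * \<theta>\<^sup>2 < v" .
  have \<epsilon>: "0 < \<epsilon>" "N * \<epsilon> / m = \<theta>" using m N \<theta> by (simp_all add: \<epsilon>_def)
  have estimate: "vec_dist P (state_at P x t) y \<le> sqrt (mass * (2 * (v * exp (- c * t))))"
    if fsp: "fsp P W x d a" and init: "vec_dist P (state_at P x 0) y \<le> \<epsilon>" and t: "0 \<le> t" for x d a t
  proof -
    obtain \<omega> \<phi> X D A where
      "(\<forall>k\<in>K P. loc_lipschitz (x k))" "\<omega> \<in> space (sample_space W)" "lln_realization P W \<omega>"
      "strict_mono (\<phi> :: nat \<Rightarrow> nat)" "(\<forall>n. grand_f_path P W \<omega> (scaling P (\<phi> n)) (X n) (D n) (A n))"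
      "(\<forall>k\<in>K P. uoc_limit {0..} (\<lambda>n t. real (X n t k) / scaling P (\<phi> n)) (x k))"
      "(\<forall>e\<in>edges P. uoc_limit {0..} (\<lambda>n t. real (D n e t) / scaling P (\<phi> n)) (d e) \<and>
                      uoc_limit {0..} (\<lambda>n t. real (A n e t) / scaling P (\<phi> n)) (a e))"
      using fsp unfolding fsp_def by blast
    then have "fluid_limit_axioms P W x d a \<omega> \<phi> X D A"
      unfolding fluid_limit_axioms_def by blast
    then interpret fluid_equilibrium P W x d a \<omega> \<phi> X D A p
      by (intro fluid_equilibrium.intro fluid_limit.intro W finite_server_system_axioms equilibrium_axioms)
    have "\<bar>dev 0 k\<bar> \<le> \<theta>" if "k \<in> Kbar P" for k
      using dev_le_vec_dist[OF y init m that] \<epsilon>(2) by (simp add: N_def)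
    then have "lyapunov b 0 \<le> C * \<theta>\<^sup>2"
      unfolding lyapunov_def C_def using hbc by (intro lyapunov_upper_bound) auto
    then have "lyapunov b 0 < m * h\<^sup>2 / 2" using C\<theta> by (simp add: v_def)
    then have "lyapunov b t \<le> v * exp (- c * t)"
      unfolding v_def by (intro lyapunov_decays[OF hbc m dissipation _ t]) auto
    moreover have "0 \<le> b * load_energy (dev t)" using hbc load_energy_nonneg by simp
    ultimately have "energy (dev t) \<le> 2 * (v * exp (- c * t))" unfolding lyapunov_def by linarith
    then have "sqrt (mass * energy (dev t)) \<le> sqrt (mass * (2 * (v * exp (- c * t))))"
      using mass_pos by (intro real_sqrt_le_mono mult_left_mono) auto
    then show ?thesis using vec_dist_le_energy[OF y, of t] by linarith
  qed
  have "\<exists>T\<ge>0. \<forall>t\<ge>T. sqrt (mass * (2 * (v * exp (- c * t)))) < \<delta>" if \<delta>: "0 < \<delta>" for \<delta>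
  proof -
    have "filterlim (\<lambda>t. - c * t) at_bot at_top"
      using hbc(4) by (intro filterlim_tendsto_neg_mult_at_bot[OF tendsto_const _ filterlim_ident]) simp
    then have "((\<lambda>t. exp (- c * t)) \<longlongrightarrow> 0) at_top" by (rule filterlim_compose[OF exp_at_bot])
    then have "((\<lambda>t. sqrt (mass * (2 * (v * exp (- c * t))))) \<longlongrightarrow> sqrt (mass * (2 * (v * 0)))) at_top"
      by (intro tendsto_intros)
    then have "((\<lambda>t. sqrt (mass * (2 * (v * exp (- c * t))))) \<longlongrightarrow> 0) at_top" by simp
    then have "\<forall>\<^sub>F t in at_top. sqrt (mass * (2 * (v * exp (- c * t)))) < \<delta>"
      using \<delta> by (rule order_tendstoD(2))
    then obtain T where "\<forall>t\<ge>T. sqrt (mass * (2 * (v * exp (- c * t)))) < \<delta>"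
      unfolding eventually_at_top_linorder by blast
    then show ?thesis by (intro exI[of _ "max 0 T"]) auto
  qed
  then have "\<exists>T\<ge>0. \<forall>x d a. fsp P W x d a \<and> vec_dist P (state_at P x 0) y \<le> \<epsilon> \<longrightarrow>
      (\<forall>t\<ge>T. vec_dist P (state_at P x t) y < \<delta>)" if "0 < \<delta>" for \<delta>
    using that estimate by (meson order_trans order_le_less_trans)
  then show ?thesis using \<epsilon>(1) by blast
qed

end

theorem lemma16:
  fixes P :: "('i::finite, 's::finite) server_system"
    and W :: "('i, 's, 'w) primitives"
  assumes "finite_server_system P"
    and "driving_primitives P W"
    and "\<exists>x\<in>X_diamond P. \<forall>s. 0 < xbar P x (zero_cfg s)"
  shows "\<exists>\<epsilon>>0. \<forall>\<delta>>0. \<exists>T\<ge>0. \<forall>x d a.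
    fsp P W x d a \<and> state_at P x 0 \<in> X_box P \<inter> {y. vec_dist P y (x_opt P) \<le> \<epsilon>} \<longrightarrow>
      (\<forall>t\<ge>T. vec_dist P (state_at P x t) (x_opt P) < \<delta>)"
proof -
  interpret finite_server_system P by fact
  interpret equilibrium P "xbar P (x_opt P)" using assms(3) x_opt_equilibrium by blast
  show ?thesis
    using uniform_local_convergence[OF assms(2), of "x_opt P"] by (fastforce simp: xbar_K)
qed

end
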